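(* Let $\Omega=(0,1)^2$. Consider the Helmholtz equation $\Delta u+k^2u=0$ in $\Omega$ (vanishing source term), with boundary conditions $\mathcal{B}_ju=g_j$ on $\Gamma_j$, $j=1,\dots,4$, where: $\mathcal{B}_1,\mathcal{B}_3\in\{\mathbf{I}_d,\frac{\partial}{\partial\nu}\}$ with $g_1=0$ and $g_3=0$; $\mathcal{B}_4=\frac{\partial}{\partial\nu}-ik\mathbf{I}_d$ with $g_4=0$; and $\mathcal{B}_2\in\{\mathbf{I}_d,\frac{\partial}{\partial\nu},\frac{\partial}{\partial\nu}-ik\mathbf{I}_d\}$ with $g_2\in L^2(\Gamma_2)$. Then: (1) If $\mathcal{B}_2=\frac{\partial}{\partial\nu}-ik\mathbf{I}_d$, the unique (weak) solution $u$ satisfies $$\|\nabla u\|_{0,\Omega}+k\|u\|_{0,\Omega}\le\sqrt{12}\,\max\{k,1\}\,\|g_2\|_{0,\Gamma_2},\qquad\forall\,k>0.$$ (2) If $\mathcal{B}_2=\frac{\partial}{\partial\nu}$, the unique (weak) solution $u$ satisfies $$\|\nabla u\|_{0,\Omega}+k\|u\|_{0,\Omega}\le\sqrt{20}\,\max\{k^2,1\}\,\|g_2\|_{0,\Gamma_2},\qquad\forall\,k>0.$$ (3) If $\mathcal{B}_2=\mathbf{I}_d$ and $g_2\in\mathcal{Z}^{\frac12}(\Gamma_2)$, the unique (weak) solution $u$ satisfies $$\|\nabla u\|_{0,\Omega}+k\|u\|_{0,\Omega}\le\sqrt{14}\left(\max\{k^2,1\}\,\|g_2\|_{0,\Ga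mma_2}+\max\{k^{\frac12},1\}\,\|g_2\|_{\mathcal{Z}^{\frac12}(\Gamma_2)}\right),\qquad\forall\,k>0.$$
   Context: All functions are complex valued. $\Omega:=(0,1)^2$ with sides $\Gamma_1:=(0,1)\times\{0\}$, $\Gamma_2:=\{1\}\times(0,1)$, $\Gamma_3:=(0,1)\times\{1\}$, $\Gamma_4:=\{0\}\times(0,1)$. On $\Gamma_j$ the boundary operator $\mathcal{B}_j$ is $\mathbf{I}_d$ ($\mathbf{I}_du=u$, Dirichlet), $\frac{\partial}{\partial\nu}$ (Neumann), or $\frac{\partial}{\partial\nu}-ik\mathbf{I}_d$ (impedance), with $\nu$ the outward normal vector and $k>0$ a constant. $\Gamma_D,\Gamma_N,\Gamma_R$ denote the unions of the sides carrying respectively Dirichlet, Neumann and impedance conditions, and $\mathcal{H}:=\{v\in H^1(\Omega):v=0\text{ on }\Gamma_D\}$. The (weak) solution is the unique $u\in H^1(\Omega)$ (existence and uniqueness hold) whose trace on $\Gamma_D$ equals the prescribed Dirichlet data (so $u\in\mathcal{H}$ when these are zero) and such that $$\int_\Omega(\nabla u\cdot\nabla\overline v-k^2u\overline v)-ik\int_{\Gamma_R}u\overline v=\int_{\Gamma_R}g_R\overline v+\int_{\Gamma_N}g_N\overline v\quad\forall v\in\mathcal{H},$$ where $g_R,g_N$ are the impedance and Neumann data. $\|\cdot\|_{0,\Omega}$ and $\|\cdot\|_{0,\Gamma}$ denote the $L^2(\Omega)$ and $L^2(\Gamma)$ norms. The space $\mathcal{Z}^{s}(\Gamma_2)$, $s\ge0$: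 define for $n\in\mathbb{N}_0=\{0,1,2,\dots\}$ the pair $(\mu_n,Y_n)$ according to the horizontal boundary operators by - $\mathcal{B}_1=\mathcal{B}_3=\mathbf{I}_d$: $\mu_n=n\pi$, $Y_0=0$, $Y_n(y)=\sqrt2\sin(n\pi y)$ for $n\ge1$; - $\mathcal{B}_1=\mathcal{B}_3=\frac{\partial}{\partial\nu}$: $\mu_n=n\pi$, $Y_0=1$, $Y_n(y)=\sqrt2\cos(n\pi y)$ for $n\ge1$; - $\mathcal{B}_1=\mathbf{I}_d$, $\mathcal{B}_3=\frac{\partial}{\partial\nu}$: $\mu_n=(n+\frac12)\pi$, $Y_n(y)=\sqrt2\sin((n+\frac12)\pi y)$; - $\mathcal{B}_1=\frac{\partial}{\partial\nu}$, $\mathcal{B}_3=\mathbf{I}_d$: $\mu_n=(n+\frac12)\pi$, $Y_n(y)=\sqrt2\cos((n+\frac12)\pi y)$. Then $g\in\mathcal{Z}^s(\Gamma_2)$ means $g\in L^2(\Gamma_2)$ and $\|g\|^2_{\mathcal{Z}^s(\Gamma_2)}:=\sum_{n=0}^\infty|\widehat g(n)|^2\mu_n^{2s}<\infty$, where $\widehat g(n):=\int_0^1g(y)Y_n(y)\,dy$ ($\Gamma_2$ being identified with $(0,1)$). *)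

theory Defs
  imports "HOL-Analysis.Analysis"
begin

section \<open>The square, its sides and square-integrable functions\<close>

definition Omega :: "(real \<times> real) set" where
  "Omega = {0<..<1} \<times> {0<..<1}"

datatype side = Gamma1 | Gamma2 | Gamma3 | Gamma4

text \<open>
  Each side is parametrised by arc length over the unit interval. Functions on a side (boundary
  data, traces) are represented by their pull-backs to the unit interval, so the boundary measure
  becomes Lebesgue measure there.
\<close>

fun side_point :: "side \<Rightarrow> real \<Rightarrow> real \<times> real" where
  "side_point Gamma1 t = (t, 0)"
| "side_point Gamma2 t = (1, t)"
| "side_point Gamma3 t = (t, 1)"
| "side_point Gamma4 t = (0, t)"

abbreviation area_measure :: "(real \<times> real) measure" where
  "area_measure \<equiv> lebesgue_on Omega"

abbreviation side_measure :: "real measure" where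
  "side_measure \<equiv> lebesgue_on {0<..<1}"

definition L2 :: "'a measure \<Rightarrow> ('a \<Rightarrow> 'b::euclidean_space) set" where
  "L2 M = {f \<in> borel_measurable M. integrable M (\<lambda>x. (norm (f x))\<^sup>2)}"

definition L2_norm :: "'a measure \<Rightarrow> ('a \<Rightarrow> 'b::euclidean_space) \<Rightarrow> real" where
  "L2_norm M f = sqrt (LINT x|M. (norm (f x))\<^sup>2)"


section \<open>The Sobolev space $H^1$ and traces\<close>

text \<open>
  Smoothness on the whole plane: the witness \<open>D i j\<close> is the mixed partial derivative of order
  \<open>i\<close> in the first and \<open>j\<close> in the second variable.
\<close>

definition smooth :: "(real \<times> real \<Rightarrow> complex) \<Rightarrow> bool" where
  "smooth \<phi> \<longleftrightarrow> (\<exists>D. D 0 0 = \<phi> \<and>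
     (\<forall>i j p. (D i j has_derivative
        (\<lambda>h. fst h *\<^sub>R D (Suc i) j p + snd h *\<^sub>R D i (Suc j) p)) (at p)))"

definition classical_grad ::
  "(real \<times> real \<Rightarrow> complex) \<Rightarrow> real \<times> real \<Rightarrow> complex \<times> complex" where
  "classical_grad \<phi> p = (frechet_derivative \<phi> (at p) (1, 0), frechet_derivative \<phi> (at p) (0, 1))"

definition test_functions :: "(real \<times> real \<Rightarrow> complex) set" where
  "test_functions =
     {\<phi>. smooth \<phi> \<and> (\<exists>K. compact K \<and> K \<subseteq> Omega \<and> (\<forall>p. p \<notin> K \<longrightarrow> \<phi> p = 0))}"

definition has_weak_grad ::
  "(real \<times> real \<Rightarrow> complex) \<Rightarrow> (real \<times> real \<Rightarrow> complex \<times> complex) \<Rightarrow> bool" where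
  "has_weak_grad u G \<longleftrightarrow> (\<forall>\<phi>\<in>test_functions.
     (LINT p|area_measure. u p * fst (classical_grad \<phi> p)) =
       - (LINT p|area_measure. fst (G p) * \<phi> p) \<and>
     (LINT p|area_measure. u p * snd (classical_grad \<phi> p)) =
       - (LINT p|area_measure. snd (G p) * \<phi> p))"

definition H1 :: "(real \<times> real \<Rightarrow> complex) set" where
  "H1 = {u \<in> L2 area_measure. \<exists>G \<in> L2 area_measure. has_weak_grad u G}"

text \<open>For \<open>u \<in> H1\<close> the weak gradient is unique up to a null set, so the choice is immaterial.\<close>

definition weak_grad :: "(real \<times> real \<Rightarrow> complex) \<Rightarrow> real \<times> real \<Rightarrow> complex \<times> complex" where
  "weak_grad u = (SOME G. G \<in> L2 area_measure \<and> has_weak_grad u G)"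

text \<open>
  The trace operator is the continuous extension to \<open>H1\<close> of the restriction to a side, defined for
  functions that are smooth up to the boundary (restrictions of smooth functions on the plane).
  It is given here by its graph; \<open>t\<close> is determined by \<open>u\<close> up to a null set, and
  exists for every \<open>u \<in> H1\<close> by the trace theorem.
\<close>

definition has_trace :: "side \<Rightarrow> (real \<times> real \<Rightarrow> complex) \<Rightarrow> (real \<Rightarrow> complex) \<Rightarrow> bool" where
  "has_trace j u t \<longleftrightarrow> u \<in> H1 \<and> t \<in> L2 side_measure \<and>
     (\<exists>\<phi> :: nat \<Rightarrow> real \<times> real \<Rightarrow> complex. (\<forall>n. smooth (\<phi> n)) \<and>
        (\<lambda>n. L2_norm area_measure (\<lambda>p. \<phi> n p - u p)) \<longlonglongrightarrow> 0 \<and>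
        (\<lambda>n. L2_norm area_measure (\<lambda>p. classical_grad (\<phi> n) p - weak_grad u p)) \<longlonglongrightarrow> 0 \<and>
        (\<lambda>n. L2_norm side_measure (\<lambda>y. \<phi> n (side_point j y) - t y)) \<longlonglongrightarrow> 0)"


section \<open>The Helmholtz boundary value problem\<close>

datatype bc = Dirichlet | Neumann | Impedance

definition energy_space :: "(side \<Rightarrow> bc) \<Rightarrow> (real \<times> real \<Rightarrow> complex) set" where
  "energy_space B = {v \<in> H1. \<forall>j. B j = Dirichlet \<longrightarrow> has_trace j v (\<lambda>_. 0)}"

text \<open>
  Weak solutions of the Helmholtz equation with vanishing source. The families \<open>\<gamma>u\<close> and
  \<open>\<gamma>v\<close> are the traces of \<open>u\<close> and \<open>v\<close> on the four sides.
\<close>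

definition weak_solution ::
  "real \<Rightarrow> (side \<Rightarrow> bc) \<Rightarrow> (side \<Rightarrow> real \<Rightarrow> complex) \<Rightarrow> (real \<times> real \<Rightarrow> complex) \<Rightarrow> bool" where
  "weak_solution k B g u \<longleftrightarrow> u \<in> H1 \<and>
     (\<forall>j. B j = Dirichlet \<longrightarrow> has_trace j u (g j)) \<and>
     (\<exists>\<gamma>u. (\<forall>j. has_trace j u (\<gamma>u j)) \<and>
       (\<forall>v\<in>energy_space B. \<forall>\<gamma>v. (\<forall>j. has_trace j v (\<gamma>v j)) \<longrightarrow>
         (LINT p|area_measure.
            fst (weak_grad u p) * cnj (fst (weak_grad v p)) +
            snd (weak_grad u p) * cnj (snd (weak_grad v p)) -
            (complex_of_real k)\<^sup>2 * u p * cnj (v p)) -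
         \<i> * complex_of_real k *
           (\<Sum>j | B j = Impedance. LINT y|side_measure. \<gamma>u j y * cnj (\<gamma>v j y)) =
         (\<Sum>j | B j = Impedance. LINT y|side_measure. g j y * cnj (\<gamma>v j y)) +
         (\<Sum>j | B j = Neumann. LINT y|side_measure. g j y * cnj (\<gamma>v j y))))"


section \<open>The spaces $\mathcal{Z}^s$ on the second side\<close>

text \<open>
  The arguments \<open>b1 b3\<close> are the boundary operators on the two horizontal sides; only Dirichlet and
  Neumann are meaningful.
\<close>

definition freq :: "bc \<Rightarrow> bc \<Rightarrow> nat \<Rightarrow> real" where
  "freq b1 b3 n = (if b1 = b3 then real n * pi else (real n + 1/2) * pi)"

fun mode :: "bc \<Rightarrow> bc \<Rightarrow> nat \<Rightarrow> real \<Rightarrow> real" where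
  "mode Dirichlet Dirichlet n y = (if n = 0 then 0 else sqrt 2 * sin (real n * pi * y))"
| "mode Neumann Neumann n y = (if n = 0 then 1 else sqrt 2 * cos (real n * pi * y))"
| "mode Dirichlet Neumann n y = sqrt 2 * sin ((real n + 1/2) * pi * y)"
| "mode Neumann Dirichlet n y = sqrt 2 * cos ((real n + 1/2) * pi * y)"

definition mode_coeff :: "bc \<Rightarrow> bc \<Rightarrow> (real \<Rightarrow> complex) \<Rightarrow> nat \<Rightarrow> complex" where
  "mode_coeff b1 b3 g n = (LINT y|side_measure. g y * complex_of_real (mode b1 b3 n y))"

text \<open>
  The case distinction on \<open>s = 0\<close> is needed because \<open>0 powr 0 = 0\<close>, whereas the weight of
  frequency \<open>0\<close> in the space of order \<open>0\<close> is \<open>1\<close>.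
\<close>

definition Z_term :: "bc \<Rightarrow> bc \<Rightarrow> real \<Rightarrow> (real \<Rightarrow> complex) \<Rightarrow> nat \<Rightarrow> real" where
  "Z_term b1 b3 s g n =
     (cmod (mode_coeff b1 b3 g n))\<^sup>2 * (if s = 0 then 1 else freq b1 b3 n powr (2 * s))"

definition Z_space :: "bc \<Rightarrow> bc \<Rightarrow> real \<Rightarrow> (real \<Rightarrow> complex) set" where
  "Z_space b1 b3 s = {g \<in> L2 side_measure. summable (Z_term b1 b3 s g)}"

definition Z_norm :: "bc \<Rightarrow> bc \<Rightarrow> real \<Rightarrow> (real \<Rightarrow> complex) \<Rightarrow> real" where
  "Z_norm b1 b3 s g = sqrt (\<Sum>n. Z_term b1 b3 s g n)"

end

theory Submission
  imports Defs
begin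

text \<open>
  Separation of variables. Testing the weak formulation with \<open>w(x) Y\<^sub>n(y)\<close> and integrating by parts
  determines \<open>u\<^sub>n(x) = \<integral> u(x,y) Y\<^sub>n(y) dy\<close> in duality with all smooth functions: every smooth \<open>h\<close>
  is \<open>w'' + \<lambda>w\<close>, \<open>\<lambda> = k\<^sup>2 - \<mu>\<^sub>n\<^sup>2\<close>, with vanishing Cauchy data of \<open>w\<close> at \<open>x = 1\<close>. Hence
  \<open>u\<^sub>n = b\<^sub>n (c - i k s)\<close>, where \<open>c, s\<close> solve \<open>w'' + \<lambda>w = 0\<close> with \<open>c(0) = s'(0) = 1\<close>, \<open>c'(0) = s(0) = 0\<close>; no regularity of
  \<open>u\<close> is needed. As \<open>c\<^sup>2 + \<lambda>s\<^sup>2 = 1\<close>, the energy density of a mode is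
  \<open>|b\<^sub>n|\<^sup>2 (2k\<^sup>2 + \<mu>\<^sub>n\<^sup>2 + 2\<mu>\<^sub>n\<^sup>4 s\<^sup>2)\<close>, to be compared with the boundary value at \<open>x = 1\<close>, which
  equals the \<open>n\<close>-th coefficient of the datum. The estimates are summed up with Parseval's identity for
  \<open>u\<close> and both components of its gradient (the \<open>y\<close>-derivative in the modes with Dirichlet
  and Neumann conditions exchanged) and Bessel's inequality for the datum.
\<close>

section \<open>Square-integrable functions\<close>

text \<open>Traces and gradient of \<open>u\<close> are accessible only through smooth
  approximations, a separate sequence for each side, and \<open>u\<^sub>n\<close> is a priori merely
  square-integrable. Hence the mode equation is used in very weak form, with all derivatives on
  \<open>w\<close>. The Cauchy data of \<open>w\<close> vanish at \<open>x = 1\<close> because value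
  and slope of \<open>u\<^sub>n\<close> are unknown there; at \<open>x = 0\<close> the impedance
  condition ties the slope to the value \<open>b\<^sub>n\<close>. Once \<open>u\<^sub>n\<close> is
  identified, other choices of \<open>w\<close> recover the condition at \<open>x = 1\<close>.
  Completeness of all four mode families has one source: multiplication by cos(pi y), which
  separates the points of [0,1], maps each span into itself, so Stone-Weierstrass applies to
  multipliers, and the lowest mode, positive inside, acts as generator. The powers of
  \<open>k\<close> in the estimates reflect the squared boundary value divided by
  \<open>|b\<^sub>n|^2\<close>: it is at least \<open>4 k^2\<close> for impedance and at least 1 for
  Dirichlet, whereas for Neumann a propagating mode may be close to resonance and only
  \<open>k^2 / (1 + k^2)\<close> is available.\<close>

lemma L2_norm_nonneg: "0 \<le> L2_norm M f"
  by (simp add: L2_norm_def)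

lemma L2_norm_sq: "(L2_norm M f)\<^sup>2 = (LINT x|M. (norm (f x))\<^sup>2)"
  by (simp add: L2_norm_def)

lemma L2_measurable: "f \<in> L2 M \<Longrightarrow> f \<in> borel_measurable M"
  by (simp add: L2_def)

lemma L2_integrable_sq: "f \<in> L2 M \<Longrightarrow> integrable M (\<lambda>x. (norm (f x))\<^sup>2)"
  by (simp add: L2_def)

lemma integrable_norm_mult:
  fixes f g :: "'a \<Rightarrow> complex"
  assumes "f \<in> L2 M" "g \<in> L2 M"
  shows "integrable M (\<lambda>x. cmod (f x) * cmod (g x))"
proof (rule Bochner_Integration.integrable_bound)
  show "integrable M (\<lambda>x. (cmod (f x))\<^sup>2 + (cmod (g x))\<^sup>2)"
    using assms by (auto dest: L2_integrable_sq)
  show "(\<lambda>x. cmod (f x) * cmod (g x)) \<in> borel_measurable M"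
    using assms[THEN L2_measurable] by measurable
  have "\<bar>a * b\<bar> \<le> a\<^sup>2 + b\<^sup>2" for a b :: real
  proof -
    have "\<bar>a\<bar> * \<bar>b\<bar> * 2 \<le> a\<^sup>2 + b\<^sup>2"
      using sum_squares_bound[of "\<bar>a\<bar>" "\<bar>b\<bar>"] by (simp add: mult.commute mult.left_commute)
    moreover have "0 \<le> \<bar>a\<bar> * \<bar>b\<bar>" by simp
    ultimately show ?thesis unfolding abs_mult by linarith
  qed
  then show "AE x in M. norm (cmod (f x) * cmod (g x)) \<le> norm ((cmod (f x))\<^sup>2 + (cmod (g x))\<^sup>2)"
    by (smt (verit, best) AE_I2 real_norm_def)
qed

lemma L2_mult_integrable:
  fixes f g :: "'a \<Rightarrow> complex"
  assumes "f \<in> L2 M" "g \<in> L2 M"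
  shows "integrable M (\<lambda>x. f x * g x)"
proof (rule Bochner_Integration.integrable_bound[OF integrable_norm_mult[OF assms]])
  show "(\<lambda>x. f x * g x) \<in> borel_measurable M"
    using assms[THEN L2_measurable] by measurable
qed (simp add: norm_mult)

text \<open>Derived from the inequality for nonnegative integrals. The moduli stay inside the
  integral because the triangle inequality below meets the cross term in exactly this form.\<close>

lemma L2_cauchy_schwarz_norm:
  fixes f g :: "'a \<Rightarrow> complex"
  assumes "f \<in> L2 M" "g \<in> L2 M"
  shows "(LINT x|M. cmod (f x) * cmod (g x)) \<le> L2_norm M f * L2_norm M g"
proof -
  have m: "f \<in> borel_measurable M" "g \<in> borel_measurable M"
    using assms by (auto dest: L2_measurable)
  have "ennreal ((LINT x|M. cmod (f x) * cmod (g x))\<^sup>2)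
      = (\<integral>\<^sup>+x. ennreal (cmod (f x)) * ennreal (cmod (g x)) \<partial>M)\<^sup>2"
  proof -
    have "(\<integral>\<^sup>+x. ennreal (cmod (f x)) * ennreal (cmod (g x)) \<partial>M) = ennreal (LINT x|M. cmod (f x) * cmod (g x))"
      by (subst nn_integral_eq_integral[OF integrable_norm_mult[OF assms], symmetric]) (auto simp: ennreal_mult)
    moreover have "0 \<le> (LINT x|M. cmod (f x) * cmod (g x))"
      by (intro integral_nonneg_AE) auto
    ultimately show ?thesis by (simp add: ennreal_power)
  qed
  also have "\<dots> \<le> (\<integral>\<^sup>+x. (ennreal (cmod (f x)))\<^sup>2 \<partial>M) * (\<integral>\<^sup>+x. (ennreal (cmod (g x)))\<^sup>2 \<partial>M)"
    using m by (intro Cauchy_Schwarz_nn_integral) auto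
  also have "\<dots> = ennreal ((LINT x|M. (cmod (f x))\<^sup>2)) * ennreal ((LINT x|M. (cmod (g x))\<^sup>2))"
    using assms[THEN L2_integrable_sq] by (simp add: ennreal_power nn_integral_eq_integral)
  also have "\<dots> = ennreal ((L2_norm M f * L2_norm M g)\<^sup>2)"
    unfolding power_mult_distrib L2_norm_sq by (rule ennreal_mult[symmetric]) auto
  finally have "(LINT x|M. cmod (f x) * cmod (g x))\<^sup>2 \<le> (L2_norm M f * L2_norm M g)\<^sup>2"
    by (simp add: ennreal_le_iff)
  then show ?thesis
    by (rule power2_le_imp_le) (simp add: L2_norm_nonneg)
qed

lemma L2_cauchy_schwarz:
  fixes f g :: "'a \<Rightarrow> complex"
  assumes "f \<in> L2 M" "g \<in> L2 M"
  shows "cmod (LINT x|M. f x * g x) \<le> L2_norm M f * L2_norm M g"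
proof -
  have "cmod (LINT x|M. f x * g x) \<le> (LINT x|M. cmod (f x * g x))"
    by (rule integral_norm_bound)
  then show ?thesis
    using L2_cauchy_schwarz_norm[OF assms] by (simp add: norm_mult)
qed

lemma L2_add_triangle:
  fixes f g :: "'a \<Rightarrow> complex"
  assumes "f \<in> L2 M" "g \<in> L2 M"
  shows "(\<lambda>x. f x + g x) \<in> L2 M"
    and "L2_norm M (\<lambda>x. f x + g x) \<le> L2_norm M f + L2_norm M g"
proof -
  have i: "integrable M (\<lambda>x. (cmod (f x))\<^sup>2 + 2 * (cmod (f x) * cmod (g x)) + (cmod (g x))\<^sup>2)"
    using assms by (intro Bochner_Integration.integrable_add integrable_mult_right integrable_norm_mult L2_integrable_sq)
  have le: "(cmod (f x + g x))\<^sup>2 \<le> (cmod (f x))\<^sup>2 + 2 * (cmod (f x) * cmod (g x)) + (cmod (g x))\<^sup>2" for x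
    using power_mono[OF norm_triangle_ineq[of "f x" "g x"], of 2] by (simp add: power2_sum algebra_simps)
  have m: "(\<lambda>x. f x + g x) \<in> borel_measurable M"
    using assms[THEN L2_measurable] by measurable
  have j: "integrable M (\<lambda>x. (cmod (f x + g x))\<^sup>2)"
    by (rule Bochner_Integration.integrable_bound[OF i]) (use m le in \<open>auto intro!: AE_I2 intro: order_trans[OF _ abs_ge_self]\<close>)
  with m show "(\<lambda>x. f x + g x) \<in> L2 M"
    by (simp add: L2_def)
  have "(L2_norm M (\<lambda>x. f x + g x))\<^sup>2
      \<le> (LINT x|M. (cmod (f x))\<^sup>2 + 2 * (cmod (f x) * cmod (g x)) + (cmod (g x))\<^sup>2)"
    unfolding L2_norm_sq by (intro integral_mono i j le)
  also have "\<dots> = (L2_norm M f)\<^sup>2 + 2 * (LINT x|M. cmod (f x) * cmod (g x)) + (L2_norm M g)\<^sup>2"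
    using assms by (simp add: L2_norm_sq integrable_norm_mult L2_integrable_sq)
  also have "\<dots> \<le> (L2_norm M f + L2_norm M g)\<^sup>2"
    using L2_cauchy_schwarz_norm[OF assms] by (simp add: power2_sum)
  finally show "L2_norm M (\<lambda>x. f x + g x) \<le> L2_norm M f + L2_norm M g"
    by (rule power2_le_imp_le) (simp add: L2_norm_nonneg)
qed

lemmas L2_add = L2_add_triangle(1) and L2_norm_triangle = L2_add_triangle(2)

lemma L2_cmult:
  fixes f :: "'a \<Rightarrow> complex"
  assumes "f \<in> L2 M"
  shows "(\<lambda>x. c * f x) \<in> L2 M"
  using assms by (auto simp: L2_def norm_mult power_mult_distrib)

lemma L2_norm_cmult: "L2_norm M (\<lambda>x. c * f x :: complex) = cmod c * L2_norm M f"
  by (simp add: L2_norm_def norm_mult power_mult_distrib real_sqrt_mult)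

lemma L2_diff:
  fixes f g :: "'a \<Rightarrow> complex"
  assumes "f \<in> L2 M" "g \<in> L2 M"
  shows "(\<lambda>x. f x - g x) \<in> L2 M"
  using L2_add[OF assms(1) L2_cmult[OF assms(2), of "-1"]] by simp

lemma L2_cnj:
  fixes f :: "'a \<Rightarrow> complex"
  assumes "f \<in> L2 M"
  shows "(\<lambda>x. cnj (f x)) \<in> L2 M"
proof -
  have "(\<lambda>x. cnj (f x)) \<in> borel_measurable M"
    using L2_measurable[OF assms]
    by (rule borel_measurable_continuous_on[OF continuous_on_cnj[OF continuous_on_id]])
  then show ?thesis
    using assms by (simp add: L2_def)
qed

lemma L2_norm_minus_commute:
  "L2_norm M (\<lambda>x. f x - g x) = L2_norm M (\<lambda>x. g x - f x)"
  by (simp add: L2_norm_def norm_minus_commute)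

lemma L2_norm_triangle_diff:
  fixes f g h :: "'a \<Rightarrow> complex"
  assumes "f \<in> L2 M" "g \<in> L2 M" "h \<in> L2 M"
  shows "L2_norm M (\<lambda>x. f x - h x) \<le> L2_norm M (\<lambda>x. f x - g x) + L2_norm M (\<lambda>x. g x - h x)"
  using L2_norm_triangle[OF L2_diff[OF assms(1,2)] L2_diff[OF assms(2,3)]] by simp

lemma L2_norm_sq_complex:
  fixes f :: "'a \<Rightarrow> complex"
  assumes "f \<in> L2 M"
  shows "(LINT x|M. f x * cnj (f x)) = complex_of_real ((L2_norm M f)\<^sup>2)"
  unfolding L2_norm_sq complex_norm_square[symmetric] of_real_power[symmetric]
  by (rule integral_complex_of_real)

text \<open>Cauchy-Schwarz for the difference. Through this lemma an identity for smooth functions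
  passes, term by term, to the limits that define a trace.\<close>

lemma L2_integral_limit:
  fixes f g :: "'a \<Rightarrow> complex"
  assumes F: "\<And>n. F n \<in> L2 M" and f: "f \<in> L2 M" and g: "g \<in> L2 M"
    and lim: "(\<lambda>n. L2_norm M (\<lambda>x. F n x - f x)) \<longlonglongrightarrow> 0"
  shows "(\<lambda>n. LINT x|M. F n x * g x) \<longlonglongrightarrow> (LINT x|M. f x * g x)"
proof (rule Lim_transform_bound[THEN LIM_zero_cancel])
  show "(\<lambda>n. L2_norm M (\<lambda>x. F n x - f x) * L2_norm M g) \<longlonglongrightarrow> 0"
    using tendsto_mult_left_zero[OF lim] .
  have "(LINT x|M. F n x * g x) - (LINT x|M. f x * g x) = (LINT x|M. (F n x - f x) * g x)" for n
    using L2_mult_integrable[OF F[of n] g] L2_mult_integrable[OF f g]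
    by (simp add: left_diff_distrib)
  then show "\<forall>\<^sub>F n in sequentially. norm ((LINT x|M. F n x * g x) - (LINT x|M. f x * g x))
      \<le> norm (L2_norm M (\<lambda>x. F n x - f x) * L2_norm M g)"
    using L2_cauchy_schwarz[OF L2_diff[OF F f] g] by (simp add: L2_norm_nonneg)
qed

lemma L2_norm_eq_0_AE:
  assumes "AE x in M. f x = 0"
  shows "L2_norm M f = 0"
proof -
  have "(LINT x|M. (norm (f x))\<^sup>2) = 0"
    using assms by (intro integral_eq_zero_AE) auto
  then show ?thesis by (simp add: L2_norm_def)
qed

lemma L2_pair:
  fixes G :: "'a \<Rightarrow> complex \<times> complex"
  assumes "G \<in> L2 M"
  shows "(\<lambda>x. fst (G x)) \<in> L2 M" "(\<lambda>x. snd (G x)) \<in> L2 M"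
    "(L2_norm M G)\<^sup>2 = (L2_norm M (\<lambda>x. fst (G x)))\<^sup>2 + (L2_norm M (\<lambda>x. snd (G x)))\<^sup>2"
proof -
  have m: "(\<lambda>x. fst (G x)) \<in> borel_measurable M" "(\<lambda>x. snd (G x)) \<in> borel_measurable M"
    using L2_measurable[OF assms]
    by (auto intro: borel_measurable_continuous_on[of fst, OF continuous_on_fst[OF continuous_on_id]]
        borel_measurable_continuous_on[of snd, OF continuous_on_snd[OF continuous_on_id]])
  have eq: "(norm (G x))\<^sup>2 = (cmod (fst (G x)))\<^sup>2 + (cmod (snd (G x)))\<^sup>2" for x
    by (simp add: norm_prod_def)
  have i1: "integrable M (\<lambda>x. (cmod (fst (G x)))\<^sup>2)"
    by (rule Bochner_Integration.integrable_bound[OF L2_integrable_sq[OF assms]]) (use m eq in auto)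
  have i2: "integrable M (\<lambda>x. (cmod (snd (G x)))\<^sup>2)"
    by (rule Bochner_Integration.integrable_bound[OF L2_integrable_sq[OF assms]]) (use m eq in auto)
  show "(\<lambda>x. fst (G x)) \<in> L2 M" "(\<lambda>x. snd (G x)) \<in> L2 M"
    using m i1 i2 by (auto simp: L2_def)
  show "(L2_norm M G)\<^sup>2 = (L2_norm M (\<lambda>x. fst (G x)))\<^sup>2 + (L2_norm M (\<lambda>x. snd (G x)))\<^sup>2"
    unfolding L2_norm_sq eq using i1 i2 by simp
qed

lemma L2_norm_component_le:
  fixes G :: "'a \<Rightarrow> complex \<times> complex"
  assumes "G \<in> L2 M"
  shows "L2_norm M (\<lambda>x. fst (G x)) \<le> L2_norm M G" "L2_norm M (\<lambda>x. snd (G x)) \<le> L2_norm M G"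
  by (rule power2_le_imp_le; simp add: L2_pair(3)[OF assms] L2_norm_nonneg)+

lemma L2_pairI:
  fixes G :: "'a \<Rightarrow> complex \<times> complex"
  assumes "(\<lambda>x. fst (G x)) \<in> L2 M" "(\<lambda>x. snd (G x)) \<in> L2 M"
  shows "G \<in> L2 M"
proof -
  have "(\<lambda>x. (fst (G x), snd (G x))) \<in> borel_measurable M"
    using assms by (intro borel_measurable_Pair) (auto dest: L2_measurable)
  moreover have "integrable M (\<lambda>x. (cmod (fst (G x)))\<^sup>2 + (cmod (snd (G x)))\<^sup>2)"
    using assms by (auto dest: L2_integrable_sq)
  ultimately show ?thesis
    by (simp add: L2_def norm_prod_def)
qed

lemma L2_bounded:
  fixes f :: "'a \<Rightarrow> complex"
  assumes "finite_measure M" "f \<in> borel_measurable M" "\<And>x. x \<in> space M \<Longrightarrow> cmod (f x) \<le> C"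
  shows "f \<in> L2 M" "(L2_norm M f)\<^sup>2 \<le> C\<^sup>2 * measure M (space M)"
proof -
  interpret finite_measure M by fact
  have le: "(cmod (f x))\<^sup>2 \<le> C\<^sup>2" if "x \<in> space M" for x
    using assms(3)[OF that] by (simp add: power_mono)
  have i: "integrable M (\<lambda>x. (cmod (f x))\<^sup>2)"
    by (rule integrable_const_bound[where B="C\<^sup>2"]) (use assms le in auto)
  then show "f \<in> L2 M" using assms by (simp add: L2_def)
  have "(LINT x|M. (cmod (f x))\<^sup>2) \<le> (LINT x|M. C\<^sup>2)"
    by (intro integral_mono i le) auto
  then show "(L2_norm M f)\<^sup>2 \<le> C\<^sup>2 * measure M (space M)"
    by (simp add: L2_norm_sq mult.commute)
qed

section \<open>The square and the unit interval as finite measure spaces\<close>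

lemma Omega_box: "Omega = box (0, 0) (1, 1)"
  by (auto simp: Omega_def box_def Basis_prod_def)

lemma Omega_sets [measurable]: "Omega \<in> sets lebesgue"
  by (simp add: Omega_box)

lemma finite_measure_area: "finite_measure area_measure"
  by (rule finite_measureI) (simp add: space_restrict_space emeasure_restrict_space Omega_box emeasure_lborel_box_eq)

lemma measure_area: "measure area_measure (space area_measure) = 1"
proof -
  have "measure area_measure (space area_measure) = measure lborel (box (0::real, 0::real) (1, 1))"
    by (simp add: measure_restrict_space space_restrict_space Omega_box)
  also have "\<dots> = 1"
    by (subst measure_lborel_box_eq) (auto simp: Basis_prod_def prod.union_disjoint prod.reindex inj_on_def)
  finally show ?thesis .
qed

lemma finite_measure_side: "finite_measure side_measure"
  by (rule finite_measureI) (simp add: space_restrict_space emeasure_restrict_space)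

lemma Omega_subset_cbox: "Omega \<subseteq> cbox (0, 0) (1, 1)"
  by (simp add: Omega_box box_subset_cbox)

lemma measurable_area: "continuous_on UNIV f \<Longrightarrow> f \<in> borel_measurable area_measure"
  by (rule continuous_imp_measurable_on_sets_lebesgue) (auto intro: continuous_on_subset)

lemma measurable_side: "continuous_on UNIV f \<Longrightarrow> f \<in> borel_measurable side_measure"
  by (rule continuous_imp_measurable_on_sets_lebesgue) (auto intro: continuous_on_subset)

lemma L2_area_bound:
  fixes f :: "real \<times> real \<Rightarrow> complex"
  assumes "f \<in> borel_measurable area_measure" "\<And>p. p \<in> Omega \<Longrightarrow> cmod (f p) \<le> C" "0 \<le> C"
  shows "f \<in> L2 area_measure" "L2_norm area_measure f \<le> C"
  using L2_bounded[OF finite_measure_area assms(1), of C] assms(2,3) measure_area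
  by (auto intro: power2_le_imp_le)

lemma L2_area_continuous:
  fixes f :: "real \<times> real \<Rightarrow> complex"
  assumes "continuous_on UNIV f"
  shows "f \<in> L2 area_measure"
proof -
  have "compact (f ` cbox (0, 0) (1, 1))"
    using assms by (intro compact_continuous_image) (auto intro: continuous_on_subset)
  then obtain C where "\<And>p. p \<in> cbox (0,0) (1,1) \<Longrightarrow> cmod (f p) \<le> C"
    by (meson bounded_iff compact_imp_bounded imageI)
  then show ?thesis
    using Omega_subset_cbox by (intro L2_bounded[OF finite_measure_area measurable_area[OF assms], of C]) auto
qed

lemma L2_side_continuous:
  fixes f :: "real \<Rightarrow> complex"
  assumes "continuous_on UNIV f"
  shows "f \<in> L2 side_measure"
proof -
  have "compact (f ` {0..1})"
    using assms by (intro compact_continuous_image) (auto intro: continuous_on_subset)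
  then obtain C where "\<And>p. p \<in> {0..1} \<Longrightarrow> cmod (f p) \<le> C"
    by (meson bounded_iff compact_imp_bounded imageI)
  then show ?thesis
    by (intro L2_bounded[OF finite_measure_side measurable_side[OF assms], of C]) auto
qed

lemma integral_side_continuous:
  fixes f :: "real \<Rightarrow> 'a::euclidean_space"
  assumes "continuous_on UNIV f"
  shows "integrable side_measure f" "(LINT y|side_measure. f y) = integral {0..1} f"
proof -
  have "integrable (lebesgue_on {0..1}) f"
    using assms by (intro continuous_imp_integrable_real) (auto intro: continuous_on_subset)
  then have "set_integrable lebesgue {0..1} f"
    by (simp add: integrable_restrict_space set_integrable_def)
  then have "set_integrable lebesgue {0<..<1} f"
    by (rule set_integrable_subset) auto
  then show i: "integrable side_measure f"
    by (simp add: integrable_restrict_space set_integrable_def)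
  show "(LINT y|side_measure. f y) = integral {0..1} f"
    using lebesgue_integral_eq_integral[OF i] by (simp add: integral_open_interval_real)
qed

text \<open>Both orders of iteration are recorded, since the divergence theorem integrates first in
  the direction of differentiation, which may be either one.\<close>

lemma integral_area_continuous:
  fixes f :: "real \<times> real \<Rightarrow> 'a::euclidean_space"
  assumes "continuous_on UNIV f"
  shows "integrable area_measure f"
    "(LINT p|area_measure. f p) = integral {0..1} (\<lambda>x. integral {0..1} (\<lambda>y. f (x, y)))"
    "(LINT p|area_measure. f p) = integral {0..1} (\<lambda>y. integral {0..1} (\<lambda>x. f (x, y)))"
proof -
  have c: "continuous_on S f" for S
    using assms by (auto intro: continuous_on_subset)
  have "integrable (lebesgue_on (cbox (0,0) (1,1))) f"
    using c by (intro continuous_imp_integrable)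
  then have "set_integrable lebesgue (cbox (0,0) (1,1)) f"
    by (simp add: integrable_restrict_space set_integrable_def)
  then have "set_integrable lebesgue Omega f"
    by (rule set_integrable_subset) (auto simp: Omega_subset_cbox)
  then show i: "integrable area_measure f"
    by (simp add: integrable_restrict_space set_integrable_def)
  have "(LINT p|area_measure. f p) = integral (cbox (0,0) (1,1)) f"
    using lebesgue_integral_eq_integral[OF i Omega_sets] by (simp add: Omega_box integral_open_interval)
  also have "\<dots> = integral {0..1} (\<lambda>x. integral {0..1} (\<lambda>y. f (x, y)))"
    using integral_prod_continuous[OF c, of 0 0 1 1] by simp
  finally show *: "(LINT p|area_measure. f p) = integral {0..1} (\<lambda>x. integral {0..1} (\<lambda>y. f (x, y)))" .
  show "(LINT p|area_measure. f p) = integral {0..1} (\<lambda>y. integral {0..1} (\<lambda>x. f (x, y)))"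
    unfolding * using integral_swap_continuous[of 0 0 1 1 "\<lambda>x y. f (x, y)"] c by simp
qed


section \<open>Smooth functions and the divergence theorem\<close>

text \<open>Class C^n by recursion on the order. The derivative is existentially quantified, so each
  closure rule is an induction whose witness is the corresponding differentiation formula.\<close>

primrec Cn :: "nat \<Rightarrow> (real \<Rightarrow> complex) \<Rightarrow> bool" where
  "Cn 0 f \<longleftrightarrow> continuous_on UNIV f"
| "Cn (Suc n) f \<longleftrightarrow> (\<exists>f'. (\<forall>x. (f has_vector_derivative f' x) (at x)) \<and> Cn n f')"

definition smooth1 :: "(real \<Rightarrow> complex) \<Rightarrow> bool" where
  "smooth1 f \<longleftrightarrow> (\<forall>n. Cn n f)"

lemma Cn_SucD: "Cn (Suc n) f \<Longrightarrow> Cn n f"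
proof (induction n arbitrary: f)
  case 0
  then show ?case
    unfolding Cn.simps by (meson continuous_at_imp_continuous_on has_vector_derivative_continuous)
next
  case (Suc n)
  then show ?case by (metis Cn.simps(2))
qed

lemma Cn_add: "Cn n f \<Longrightarrow> Cn n g \<Longrightarrow> Cn n (\<lambda>x. f x + g x)"
proof (induction n arbitrary: f g)
  case 0
  then show ?case by (auto intro: continuous_intros)
next
  case (Suc n)
  then obtain f' g' where
    "\<And>x. (f has_vector_derivative f' x) (at x)" "Cn n f'"
    "\<And>x. (g has_vector_derivative g' x) (at x)" "Cn n g'"
    by auto
  then show ?case
    unfolding Cn.simps
    by (intro exI[of _ "\<lambda>x. f' x + g' x"]) (auto intro!: Suc.IH has_vector_derivative_add)
qed

lemma Cn_mult: "Cn n f \<Longrightarrow> Cn n g \<Longrightarrow> Cn n (\<lambda>x. f x * g x)"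
proof (induction n arbitrary: f g)
  case 0
  then show ?case by (auto intro: continuous_intros)
next
  case (Suc n)
  then obtain f' g' where
    "\<And>x. (f has_vector_derivative f' x) (at x)" "Cn n f'"
    "\<And>x. (g has_vector_derivative g' x) (at x)" "Cn n g'"
    by auto
  moreover have "Cn n f" "Cn n g"
    using Suc.prems Cn_SucD by blast+
  ultimately show ?case
    unfolding Cn.simps
    by (intro exI[of _ "\<lambda>x. f x * g' x + f' x * g x"])
       (auto intro!: Cn_add Suc.IH has_vector_derivative_mult)
qed

lemma Cn_const: "Cn n (\<lambda>x. c)"
  by (induction n arbitrary: c) (auto intro: has_vector_derivative_const)

lemma Cn_cnj: "Cn n f \<Longrightarrow> Cn n (\<lambda>x. cnj (f x))"
proof (induction n arbitrary: f)
  case 0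
  then show ?case by (auto intro: continuous_intros)
next
  case (Suc n)
  then obtain f' where "\<And>x. (f has_vector_derivative f' x) (at x)" "Cn n f'"
    by auto
  then show ?case
    unfolding Cn.simps
    by (intro exI[of _ "\<lambda>x. cnj (f' x)"]) (auto intro!: Suc.IH has_vector_derivative_cnj)
qed

lemma smooth1_add: "smooth1 f \<Longrightarrow> smooth1 g \<Longrightarrow> smooth1 (\<lambda>x. f x + g x)"
  by (simp add: smooth1_def Cn_add)

lemma smooth1_mult: "smooth1 f \<Longrightarrow> smooth1 g \<Longrightarrow> smooth1 (\<lambda>x. f x * g x)"
  by (simp add: smooth1_def Cn_mult)

lemma smooth1_const: "smooth1 (\<lambda>x. c)"
  by (simp add: smooth1_def Cn_const)

lemma smooth1_cnj: "smooth1 f \<Longrightarrow> smooth1 (\<lambda>x. cnj (f x))"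
  by (simp add: smooth1_def Cn_cnj)

lemma smooth1_cmult: "smooth1 f \<Longrightarrow> smooth1 (\<lambda>x. c * f x)"
  by (intro smooth1_mult smooth1_const)

lemma smooth1_diff: "smooth1 f \<Longrightarrow> smooth1 g \<Longrightarrow> smooth1 (\<lambda>x. f x - g x)"
  using smooth1_add[OF _ smooth1_cmult[of g "-1"]] by simp

lemma smooth1_continuous: "smooth1 f \<Longrightarrow> continuous_on S f"
  unfolding smooth1_def by (metis Cn.simps(1) continuous_on_subset top_greatest)

lemma smooth1_antiderivative:
  assumes "\<And>x. (f has_vector_derivative f' x) (at x)" "smooth1 f'"
  shows "smooth1 f"
  unfolding smooth1_def
proof
  fix n
  have "Cn (Suc n) f"
    using assms unfolding smooth1_def by auto
  then show "Cn n f" by (rule Cn_SucD)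
qed

definition d1 :: "(real \<Rightarrow> complex) \<Rightarrow> real \<Rightarrow> complex" where
  "d1 f x = vector_derivative f (at x)"

lemma d1_eq: "(\<And>x. (f has_vector_derivative f' x) (at x)) \<Longrightarrow> d1 f = f'"
  by (auto simp: d1_def fun_eq_iff intro: vector_derivative_at)

lemma smooth1_d1:
  assumes "smooth1 f"
  shows "(f has_vector_derivative d1 f x) (at x)" "smooth1 (d1 f)"
proof -
  have "Cn (Suc n) f" for n
    using assms unfolding smooth1_def by blast
  then have *: "(\<forall>x. (f has_vector_derivative d1 f x) (at x)) \<and> Cn n (d1 f)" for n
    by simp (metis d1_eq)
  then show "(f has_vector_derivative d1 f x) (at x)" "smooth1 (d1 f)"
    unfolding smooth1_def by blast+
qed

lemma smooth1_id: "smooth1 complex_of_real"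
proof (rule smooth1_antiderivative)
  show "(complex_of_real has_vector_derivative 1) (at x)" for x
    using has_vector_derivative_of_real[OF DERIV_ident[of "at x"]] by simp
qed (rule smooth1_const)

text \<open>The two claims are proved together because differentiation exchanges the functions up to
  a constant factor, so neither induction closes alone.\<close>

lemma smooth1_cos_sin:
  "smooth1 (\<lambda>x. complex_of_real (cos (a * x)))" "smooth1 (\<lambda>x. complex_of_real (sin (a * x)))"
proof -
  have "Cn n (\<lambda>x. complex_of_real (cos (a * x))) \<and> Cn n (\<lambda>x. complex_of_real (sin (a * x)))" for n
  proof (induction n)
    case 0
    then show ?case by (auto intro!: continuous_intros)
  next
    case (Suc n)
    have "((\<lambda>x. complex_of_real (cos (a * x))) has_vector_derivative
            (complex_of_real (- a) * complex_of_real (sin (a * x)))) (at x)"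
         "((\<lambda>x. complex_of_real (sin (a * x))) has_vector_derivative
            (complex_of_real a * complex_of_real (cos (a * x)))) (at x)" for x
      unfolding of_real_mult[symmetric]
      by (auto intro!: has_vector_derivative_of_real derivative_eq_intros
          simp: has_real_derivative_iff_has_vector_derivative[symmetric])
    moreover note Cn_mult[OF Cn_const conjunct1[OF Suc.IH]] Cn_mult[OF Cn_const conjunct2[OF Suc.IH]]
    ultimately show ?case
      by (metis (no_types, lifting) Cn.simps(2))
  qed
  then show "smooth1 (\<lambda>x. complex_of_real (cos (a * x)))" "smooth1 (\<lambda>x. complex_of_real (sin (a * x)))"
    by (auto simp: smooth1_def)
qed

section \<open>Continuously differentiable functions on the plane and the divergence theorem\<close>

definition C1_plane :: "(real \<times> real \<Rightarrow> complex) \<Rightarrow> (real \<times> real \<Rightarrow> complex) \<Rightarrow> (real \<times> real \<Rightarrow> complex) \<Rightarrow> bool"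
  where "C1_plane a ax ay \<longleftrightarrow> continuous_on UNIV ax \<and> continuous_on UNIV ay \<and>
    (\<forall>p. (a has_derivative (\<lambda>h. fst h *\<^sub>R ax p + snd h *\<^sub>R ay p)) (at p))"

lemma C1_planeD:
  assumes "C1_plane a ax ay"
  shows "continuous_on UNIV ax" "continuous_on UNIV ay"
    "(a has_derivative (\<lambda>h. fst h *\<^sub>R ax p + snd h *\<^sub>R ay p)) (at p)"
  using assms unfolding C1_plane_def by blast+

lemma C1_plane_continuous: "C1_plane a ax ay \<Longrightarrow> continuous_on S a"
  unfolding C1_plane_def
  by (meson continuous_at_imp_continuous_on has_derivative_continuous)

lemma C1_plane_mult:
  assumes "C1_plane a ax ay" "C1_plane b bx by'"
  shows "C1_plane (\<lambda>p. a p * b p) (\<lambda>p. ax p * b p + a p * bx p) (\<lambda>p. ay p * b p + a p * by' p)"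
proof -
  have "((\<lambda>p. a p * b p) has_derivative
     (\<lambda>h. fst h *\<^sub>R (ax p * b p + a p * bx p) + snd h *\<^sub>R (ay p * b p + a p * by' p))) (at p)" for p
    by (rule has_derivative_mult[OF C1_planeD(3)[OF assms(1)] C1_planeD(3)[OF assms(2)], THEN has_derivative_eq_rhs])
       (simp add: fun_eq_iff algebra_simps)
  then show ?thesis
    unfolding C1_plane_def
    by (intro conjI allI continuous_intros C1_plane_continuous[OF assms(1)] C1_plane_continuous[OF assms(2)]
        C1_planeD(1,2)[OF assms(1)] C1_planeD(1,2)[OF assms(2)])
qed

lemma C1_plane_classical_grad: "C1_plane a ax ay \<Longrightarrow> classical_grad a p = (ax p, ay p)"
  unfolding classical_grad_def
  using frechet_derivative_at[OF C1_planeD(3), of a ax ay p, symmetric] by simp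

lemma C1_plane_smooth:
  assumes "smooth \<phi>"
  obtains ax ay where "C1_plane \<phi> ax ay"
proof -
  obtain D where D: "D 0 0 = \<phi>" "\<And>i j p. (D i j has_derivative
        (\<lambda>h. fst h *\<^sub>R D (Suc i) j p + snd h *\<^sub>R D i (Suc j) p)) (at p)"
    using assms unfolding smooth_def by blast
  have "continuous_on UNIV (D i j)" for i j
    using D(2) by (meson continuous_at_imp_continuous_on has_derivative_continuous)
  moreover have "(\<phi> has_derivative (\<lambda>h. fst h *\<^sub>R D 1 0 p + snd h *\<^sub>R D 0 1 p)) (at p)" for p
    using D(2)[of 0 0 p] D(1) by simp
  ultimately have "C1_plane \<phi> (D 1 0) (D 0 1)"
    unfolding C1_plane_def by blast
  then show ?thesis by (rule that)
qed

lemma C1_plane_slices: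
  assumes "C1_plane a ax ay"
  shows "((\<lambda>x. a (x, y)) has_vector_derivative ax (x, y)) (at x within S)"
    "((\<lambda>y. a (x, y)) has_vector_derivative ay (x, y)) (at y within S)"
proof -
  have D: "(a has_derivative (\<lambda>h. fst h *\<^sub>R ax p + snd h *\<^sub>R ay p)) (at p)" for p
    by (rule C1_planeD(3)[OF assms])
  have "((\<lambda>x. a (x, y)) has_derivative (\<lambda>h. h *\<^sub>R ax (x, y))) (at x within S)"
    by (rule has_derivative_compose[of "\<lambda>x. (x, y)" "\<lambda>h. (h, 0)", OF _ D, THEN has_derivative_eq_rhs])
       (auto intro!: derivative_eq_intros)
  then show "((\<lambda>x. a (x, y)) has_vector_derivative ax (x, y)) (at x within S)"
    by (simp add: has_vector_derivative_def)
  have "((\<lambda>y. a (x, y)) has_derivative (\<lambda>h. h *\<^sub>R ay (x, y))) (at y within S)"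
    by (rule has_derivative_compose[of "\<lambda>y. (x, y)" "\<lambda>h. (0, h)", OF _ D, THEN has_derivative_eq_rhs])
       (auto intro!: derivative_eq_intros)
  then show "((\<lambda>y. a (x, y)) has_vector_derivative ay (x, y)) (at y within S)"
    by (simp add: has_vector_derivative_def)
qed

text \<open>Fubini with the direction of differentiation innermost, then the fundamental theorem of
  calculus on each line.\<close>

lemma divergence_square:
  assumes "C1_plane a ax ay"
  shows "(LINT p|area_measure. ax p) = (LINT t|side_measure. a (side_point Gamma2 t) - a (side_point Gamma4 t))"
    "(LINT p|area_measure. ay p) = (LINT t|side_measure. a (side_point Gamma3 t) - a (side_point Gamma1 t))"
proof -
  have c: "continuous_on UNIV ax" "continuous_on UNIV ay"
    using C1_planeD[OF assms] by auto
  have ca: "continuous_on UNIV a" by (rule C1_plane_continuous[OF assms])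
  have "integral {0..1} (\<lambda>x. ax (x, y)) = a (1, y) - a (0, y)" for y
    by (intro integral_unique fundamental_theorem_of_calculus C1_plane_slices[OF assms]) auto
  moreover have "continuous_on UNIV (\<lambda>t. a (1, t) - a (0, t))"
    by (rule continuous_on_diff; rule continuous_on_compose2[OF ca]) (auto intro!: continuous_intros)
  ultimately show "(LINT p|area_measure. ax p) = (LINT t|side_measure. a (side_point Gamma2 t) - a (side_point Gamma4 t))"
    by (simp add: integral_area_continuous(3)[OF c(1)] integral_side_continuous(2))
  have "integral {0..1} (\<lambda>y. ay (x, y)) = a (x, 1) - a (x, 0)" for x
    by (intro integral_unique fundamental_theorem_of_calculus C1_plane_slices[OF assms]) auto
  moreover have "continuous_on UNIV (\<lambda>t. a (t, 1) - a (t, 0))"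
    by (rule continuous_on_diff; rule continuous_on_compose2[OF ca]) (auto intro!: continuous_intros)
  ultimately show "(LINT p|area_measure. ay p) = (LINT t|side_measure. a (side_point Gamma3 t) - a (side_point Gamma1 t))"
    by (simp add: integral_area_continuous(2)[OF c(2)] integral_side_continuous(2))
qed

section \<open>Products of functions of one variable\<close>

definition tensor :: "(real \<Rightarrow> complex) \<Rightarrow> (real \<Rightarrow> complex) \<Rightarrow> real \<times> real \<Rightarrow> complex" where
  "tensor h q p = h (fst p) * q (snd p)"

lemma smooth_tensor:
  assumes "smooth1 h" "smooth1 q"
  shows "smooth (tensor h q)"
proof -
  have s: "smooth1 ((d1 ^^ i) f)" if "smooth1 f" for f i
    using that by (induction i) (auto intro: smooth1_d1)
  have d: "((d1 ^^ i) f has_derivative (\<lambda>t. t *\<^sub>R (d1 ^^ Suc i) f x)) (at x)" if "smooth1 f" for f i x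
    using smooth1_d1(1)[OF s[OF that]] by (simp add: has_vector_derivative_def)
  have "(tensor ((d1 ^^ i) h) ((d1 ^^ j) q) has_derivative
        (\<lambda>t. fst t *\<^sub>R tensor ((d1 ^^ Suc i) h) ((d1 ^^ j) q) p +
             snd t *\<^sub>R tensor ((d1 ^^ i) h) ((d1 ^^ Suc j) q) p)) (at p)" for i j p
    unfolding tensor_def
    by (rule has_derivative_mult[OF has_derivative_compose[OF has_derivative_fst[OF has_derivative_ident] d[OF assms(1)]]
          has_derivative_compose[OF has_derivative_snd[OF has_derivative_ident] d[OF assms(2)]], THEN has_derivative_eq_rhs])
       (auto simp: algebra_simps simp del: funpow.simps)
  then show ?thesis
    unfolding smooth_def by (intro exI[of _ "\<lambda>i j. tensor ((d1 ^^ i) h) ((d1 ^^ j) q)"]) auto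
qed

lemma C1_plane_tensor:
  assumes "smooth1 h" "smooth1 q"
  shows "C1_plane (tensor h q) (tensor (d1 h) q) (tensor h (d1 q))"
proof -
  have d: "(f has_derivative (\<lambda>t. t *\<^sub>R d1 f x)) (at x)" if "smooth1 f" for f x
    using smooth1_d1(1)[OF that] by (simp add: has_vector_derivative_def)
  have D: "(tensor h q has_derivative
        (\<lambda>t. fst t *\<^sub>R tensor (d1 h) q p + snd t *\<^sub>R tensor h (d1 q) p)) (at p)" for p
    unfolding tensor_def
    by (rule has_derivative_mult[OF has_derivative_compose[OF has_derivative_fst[OF has_derivative_ident] d[OF assms(1)]]
          has_derivative_compose[OF has_derivative_snd[OF has_derivative_ident] d[OF assms(2)]], THEN has_derivative_eq_rhs])
       (simp add: fun_eq_iff scaleR_conv_of_real)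
  have c: "continuous_on UNIV (tensor a b)" if "smooth1 a" "smooth1 b" for a b
    unfolding tensor_def
    by (intro continuous_on_mult continuous_on_compose2[OF smooth1_continuous[OF that(1), of UNIV] continuous_on_fst[OF continuous_on_id]]
        continuous_on_compose2[OF smooth1_continuous[OF that(2), of UNIV] continuous_on_snd[OF continuous_on_id]]) auto
  show ?thesis
    unfolding C1_plane_def by (intro conjI allI c D assms smooth1_d1(2))
qed

lemma continuous_tensor: "smooth1 h \<Longrightarrow> smooth1 q \<Longrightarrow> continuous_on S (tensor h q)"
  by (rule C1_plane_continuous[OF C1_plane_tensor])

lemma L2_tensor: "smooth1 h \<Longrightarrow> smooth1 q \<Longrightarrow> tensor h q \<in> L2 area_measure"
  by (intro L2_area_continuous continuous_tensor)

lemma integral_tensor: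
  assumes "smooth1 h" "smooth1 q"
  shows "(LINT p|area_measure. tensor h q p) = (LINT x|side_measure. h x) * (LINT y|side_measure. q y)"
  using integral_area_continuous(2)[OF continuous_tensor[OF assms]]
  by (simp add: tensor_def integral_side_continuous(2) smooth1_continuous assms)


section \<open>Cut-off functions and transverse modes\<close>

text \<open>For \<open>j = 0\<close> this is the classical flat function exp(-1/t). The powers of
  1/t are included because the derivatives are linear combinations of members of the family, so
  smoothness becomes an induction inside it.\<close>

definition flat :: "nat \<Rightarrow> real \<Rightarrow> real" where
  "flat j t = (if t > 0 then (1/t)^j * exp (- (1/t)) else 0)"

text \<open>The substitution s = 1/t turns the limit from the right into that of s^j / exp s at
  infinity; on the left the function vanishes.\<close>

lemma flat_at_0: "(flat j \<longlongrightarrow> 0) (at 0)"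
proof -
  have "((\<lambda>s::real. s^j / exp s) \<longlongrightarrow> 0) at_top"
    by (rule tendsto_power_div_exp_0)
  then have "((\<lambda>t::real. (inverse t)^j / exp (inverse t)) \<longlongrightarrow> 0) (at_right 0)"
    by (rule filterlim_compose[OF _ filterlim_inverse_at_top_right])
  moreover have "\<forall>\<^sub>F t in at_right 0. (inverse t)^j / exp (inverse t) = flat j t"
    unfolding eventually_at_right_field
    by (intro exI[of _ 1]) (auto simp: flat_def exp_minus field_simps)
  ultimately have "(flat j \<longlongrightarrow> 0) (at_right 0)"
    by (rule Lim_transform_eventually)
  moreover have "(flat j \<longlongrightarrow> 0) (at_left 0)"
  proof (rule Lim_transform_eventually[OF tendsto_const])
    show "\<forall>\<^sub>F t in at_left 0. 0 = flat j t"
      unfolding eventually_at_left_field by (intro exI[of _ "-1"]) (auto simp: flat_def)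
  qed
  ultimately show ?thesis
    by (simp add: filterlim_split_at)
qed

lemma flat_deriv: "(flat j has_real_derivative flat (j + 2) t - real j * flat (j + 1) t) (at t)"
proof -
  consider "t > 0" | "t < 0" | "t = 0" by linarith
  then show ?thesis
  proof cases
    case 1
    have "((\<lambda>t. (1/t)^j * exp (- (1/t))) has_real_derivative flat (j + 2) t - real j * flat (j + 1) t) (at t)"
    proof -
      have *: "((\<lambda>t. q t ^ j * exp (- q t)) has_real_derivative
          q t ^ (j + 2) * exp (- q t) - real j * (q t ^ (j + 1) * exp (- q t))) (at t)"
        if "(q has_real_derivative - (q t)\<^sup>2) (at t)" for q :: "real \<Rightarrow> real"
        by (rule derivative_eq_intros that refl)+ (cases j; simp add: power2_eq_square algebra_simps)
      have "((\<lambda>t. 1 / t) has_real_derivative - (1 / t)\<^sup>2) (at t)"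
        using 1 by (auto intro!: derivative_eq_intros simp: power2_eq_square)
      from *[OF this] show ?thesis using 1 by (simp add: flat_def)
    qed
    then show ?thesis
      by (rule has_field_derivative_transform_within_open[of _ _ _ "{0<..}"])
         (use 1 in \<open>auto simp: flat_def\<close>)
  next
    case 2
    have "((\<lambda>t. 0) has_real_derivative flat (j + 2) t - real j * flat (j + 1) t) (at t)"
      using 2 by (simp add: flat_def)
    then show ?thesis
      by (rule has_field_derivative_transform_within_open[of _ _ _ "{..<0}"])
         (use 2 in \<open>auto simp: flat_def\<close>)
  next
    case 3
    \<comment> \<open>The difference quotient at 0 is itself a member of the family, so its limit is
      already known. The equation also holds at \<open>h = 0\<close>, where division by zero gives
      0.\<close>
    have "(\<lambda>h. (flat j (0 + h) - flat j 0) / h) = flat (Suc j)"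
      by (auto simp: flat_def fun_eq_iff)
    then have "(flat j has_real_derivative 0) (at 0)"
      unfolding DERIV_def using flat_at_0[of "Suc j"] by simp
    then show ?thesis
      using 3 by (simp add: flat_def)
  qed
qed

lemma Cn_flat: "Cn n (\<lambda>t. complex_of_real (flat j t))"
proof (induction n arbitrary: j)
  case 0
  have "continuous_on UNIV (flat j)"
    by (intro continuous_at_imp_continuous_on ballI DERIV_isCont[OF flat_deriv])
  then show ?case
    by (simp add: continuous_on_of_real)
next
  case (Suc n)
  have "((\<lambda>t. complex_of_real (flat j t)) has_vector_derivative
      complex_of_real (flat (j + 2) t) + complex_of_real (- real j) * complex_of_real (flat (j + 1) t)) (at t)" for t
    using has_vector_derivative_of_real[OF flat_deriv[of j t]] by simp
  moreover have "Cn n (\<lambda>t. complex_of_real (flat (j + 2) t) + complex_of_real (- real j) * complex_of_real (flat (j + 1) t))"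
    by (intro Cn_add Cn_mult Cn_const Suc.IH)
  ultimately show ?case
    unfolding Cn.simps
    by (intro exI[of _ "\<lambda>t. complex_of_real (flat (j + 2) t) + complex_of_real (- real j) * complex_of_real (flat (j + 1) t)"]) simp
qed

lemma Cn_affine: "Cn n f \<Longrightarrow> Cn n (\<lambda>x. f (a * x + b))"
proof (induction n arbitrary: f)
  case 0
  then show ?case
    unfolding Cn.simps by (rule continuous_on_compose2) (auto intro!: continuous_intros)
next
  case (Suc n)
  then obtain f' where f': "\<And>x. (f has_vector_derivative f' x) (at x)" "Cn n f'"
    by auto
  have "((\<lambda>x. f (a * x + b)) has_vector_derivative complex_of_real a * f' (a * x + b)) (at x)" for x
    by (rule vector_diff_chain_at[of "\<lambda>x. a * x + b" a x f "f' (a * x + b)", unfolded o_def, THEN has_vector_derivative_eq_rhs])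
       (auto intro!: f' derivative_eq_intros simp: scaleR_conv_of_real has_real_derivative_iff_has_vector_derivative[symmetric])
  moreover have "Cn n (\<lambda>x. complex_of_real a * f' (a * x + b))"
    by (intro Cn_mult Cn_const Suc.IH f')
  ultimately show ?case
    unfolding Cn.simps by (intro exI[of _ "\<lambda>x. complex_of_real a * f' (a * x + b)"]) simp
qed

lemma smooth1_affine: "smooth1 f \<Longrightarrow> smooth1 (\<lambda>x. f (a * x + b))"
  by (simp add: smooth1_def Cn_affine)

text \<open>There is no plateau: the function stays below 1 everywhere. Dominated convergence only
  needs the bound 1 and pointwise convergence to 1 inside the interval, and the growing slope
  \<open>m\<close> of the two arguments gives the latter.\<close>

definition cutoff :: "nat \<Rightarrow> real \<Rightarrow> complex" where
  "cutoff m x = complex_of_real (flat 0 (real m * x + (- 1))) * complex_of_real (flat 0 (- real m * x + (real m - 1)))"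

lemma smooth1_cutoff: "smooth1 (cutoff m)"
proof -
  have "smooth1 (\<lambda>t. complex_of_real (flat 0 t))"
    by (simp add: smooth1_def Cn_flat)
  from smooth1_mult[OF smooth1_affine[OF this] smooth1_affine[OF this]] show ?thesis
    unfolding cutoff_def[abs_def] .
qed

lemma flat_0_bounds: "0 \<le> flat 0 t" "flat 0 t \<le> 1"
  by (auto simp: flat_def)

lemma cmod_cutoff_le_1: "cmod (cutoff m x) \<le> 1"
  by (simp add: cutoff_def norm_mult flat_0_bounds mult_le_one)

lemma cutoff_support:
  assumes "m > 0" "cutoff m x \<noteq> 0"
  shows "x \<in> {1 / real m..1 - 1 / real m}"
  using assms by (auto simp: cutoff_def flat_def field_simps split: if_splits)

lemma cutoff_limit:
  assumes "0 < x" "x < 1"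
  shows "(\<lambda>m. cutoff m x) \<longlonglongrightarrow> 1"
proof -
  have F: "(\<lambda>m. flat 0 (z m)) \<longlonglongrightarrow> 1" if z: "filterlim z at_top sequentially" for z :: "nat \<Rightarrow> real"
  proof -
    have "(\<lambda>m. exp (- inverse (z m))) \<longlonglongrightarrow> exp (- 0)"
      by (intro tendsto_intros tendsto_inverse_0_at_top z)
    moreover have "\<forall>\<^sub>F m in sequentially. exp (- inverse (z m)) = flat 0 (z m)"
      using z unfolding filterlim_at_top_dense
      by (auto simp: flat_def inverse_eq_divide elim!: eventually_mono dest!: spec[of _ 0])
    ultimately show ?thesis
      using Lim_transform_eventually by fastforce
  qed
  have A: "filterlim (\<lambda>m. real m * c + b) at_top sequentially" if "c > 0" for c b
    using filterlim_tendsto_add_at_top[OF tendsto_const[of b]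
        filterlim_tendsto_pos_mult_at_top[OF tendsto_const that filterlim_real_sequentially]]
    by (simp add: ac_simps)
  have "(\<lambda>m. complex_of_real (flat 0 (real m * x + (- 1))) * complex_of_real (flat 0 (real m * (1 - x) + (- 1)))) \<longlonglongrightarrow>
      complex_of_real 1 * complex_of_real 1"
    using assms by (intro tendsto_intros F A) auto
  then show ?thesis
    by (simp add: cutoff_def algebra_simps)
qed


section \<open>Transverse modes\<close>

fun dual_bc :: "bc \<Rightarrow> bc" where
  "dual_bc Dirichlet = Neumann"
| "dual_bc Neumann = Dirichlet"
| "dual_bc Impedance = Impedance"

text \<open>Index 0 of the pure sine family is a placeholder: that mode vanishes identically and has
  to be excepted from orthonormality.\<close>

definition zero_mode :: "bc \<Rightarrow> bc \<Rightarrow> nat \<Rightarrow> bool" where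
  "zero_mode b1 b3 n \<longleftrightarrow> b1 = Dirichlet \<and> b3 = Dirichlet \<and> n = 0"

abbreviation cmode :: "bc \<Rightarrow> bc \<Rightarrow> nat \<Rightarrow> real \<Rightarrow> complex" where
  "cmode b1 b3 n y \<equiv> complex_of_real (mode b1 b3 n y)"

text \<open>A Dirichlet condition at \<open>y = 0\<close> makes the mode a sine, a Neumann condition
  makes it a cosine (possibly constant). The value is the sign that appears when the mode is
  differentiated.\<close>

definition dir_sign :: "bc \<Rightarrow> real" where
  "dir_sign b = (if b = Dirichlet then 1 else -1)"

lemma freq_dual: "b1 \<in> {Dirichlet, Neumann} \<Longrightarrow> b3 \<in> {Dirichlet, Neumann} \<Longrightarrow>
    freq (dual_bc b1) (dual_bc b3) n = freq b1 b3 n"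
  by (auto simp: freq_def)

lemma dual_bc_mem: "b \<in> {Dirichlet, Neumann} \<Longrightarrow> dual_bc b \<in> {Dirichlet, Neumann}"
  by auto

lemma freq_nonneg: "0 \<le> freq b1 b3 n"
  by (auto simp: freq_def)

text \<open>The spectral gap. It keeps the frequency of every evanescent mode away from 0, which is
  what makes the constants of the estimates absolute.\<close>

lemma freq_eq_0_or_ge: "freq b1 b3 n = 0 \<or> pi / 2 \<le> freq b1 b3 n"
proof (cases "b1 = b3")
  case True
  then show ?thesis
    using mult_right_mono[of 1 "real n" pi] pi_gt_zero by (cases "n = 0") (auto simp: freq_def)
next
  case False
  then show ?thesis
    using mult_right_mono[of 0 "real n" pi] pi_gt_zero by (auto simp: freq_def algebra_simps)
qed

lemma mode_zero_mode: "zero_mode b1 b3 n \<Longrightarrow> mode b1 b3 n y = 0"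
  by (auto simp: zero_mode_def)

text \<open>The argument is written as (n + e) pi y with e = 0 or e = 1/2, so that a single index
  shift formula and a single product formula serve every family. The constant mode is the only
  exception, since it lacks the factor sqrt 2.\<close>

lemma mode_eq:
  "mode Dirichlet Dirichlet n y = sqrt 2 * sin ((real n + 0) * pi * y)"
  "n > 0 \<Longrightarrow> mode Neumann Neumann n y = sqrt 2 * cos ((real n + 0) * pi * y)"
  "mode Neumann Neumann 0 y = 1"
  "mode Dirichlet Neumann n y = sqrt 2 * sin ((real n + 1/2) * pi * y)"
  "mode Neumann Dirichlet n y = sqrt 2 * cos ((real n + 1/2) * pi * y)"
  by auto

lemma mode_fun:
  "mode Dirichlet Dirichlet n = (\<lambda>y. sqrt 2 * sin ((real n + 0) * pi * y))"
  "n > 0 \<Longrightarrow> mode Neumann Neumann n = (\<lambda>y. sqrt 2 * cos ((real n + 0) * pi * y))"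
  "mode Neumann Neumann 0 = (\<lambda>y. 1)"
  "mode Dirichlet Neumann n = (\<lambda>y. sqrt 2 * sin ((real n + 1/2) * pi * y))"
  "mode Neumann Dirichlet n = (\<lambda>y. sqrt 2 * cos ((real n + 1/2) * pi * y))"
  by (auto simp: fun_eq_iff)

lemma bc_pair_cases:
  fixes n :: nat
  assumes "b1 \<in> {Dirichlet, Neumann}" "b3 \<in> {Dirichlet, Neumann}"
  obtains (DD) "b1 = Dirichlet" "b3 = Dirichlet" | (NN) "b1 = Neumann" "b3 = Neumann" "n = 0"
    | (NN') "b1 = Neumann" "b3 = Neumann" "n > 0"
    | (DN) "b1 = Dirichlet" "b3 = Neumann" | (ND) "b1 = Neumann" "b3 = Dirichlet"
  using assms by fastforce

lemma smooth1_cmode: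
  assumes "b1 \<in> {Dirichlet, Neumann}" "b3 \<in> {Dirichlet, Neumann}"
  shows "smooth1 (cmode b1 b3 n)"
proof -
  have "smooth1 (\<lambda>y. complex_of_real (sqrt 2 * sin (a * y)))" "smooth1 (\<lambda>y. complex_of_real (sqrt 2 * cos (a * y)))" for a
    using smooth1_cmult[OF smooth1_cos_sin(1)] smooth1_cmult[OF smooth1_cos_sin(2)] by simp_all
  with assms show ?thesis
    by (cases rule: bc_pair_cases[where n=n]) (simp_all only: mode_fun of_real_1 smooth1_const)
qed

lemma mode_deriv:
  assumes "b1 \<in> {Dirichlet, Neumann}" "b3 \<in> {Dirichlet, Neumann}"
  shows "(mode b1 b3 n has_real_derivative
     dir_sign b1 * freq b1 b3 n * mode (dual_bc b1) (dual_bc b3) n y) (at y)"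
proof -
  have s: "((\<lambda>y. sqrt 2 * sin (c * y)) has_real_derivative c * (sqrt 2 * cos (c * y))) (at y)"
    and c: "((\<lambda>y. sqrt 2 * cos (c * y)) has_real_derivative - (c * (sqrt 2 * sin (c * y)))) (at y)" for c
    by (auto intro!: derivative_eq_intros)
  show ?thesis
    using assms
  proof (cases rule: bc_pair_cases[where n=n])
    case DD
    then show ?thesis
      using s[of "real n * pi"] by (cases "n = 0") (simp_all add: mode_fun dir_sign_def freq_def del: mode.simps)
  next
    case NN
    then show ?thesis
      by (simp add: mode_fun(3) freq_def del: mode.simps)
  next
    case NN'
    then show ?thesis
      using c[of "real n * pi"] by (simp add: mode_fun mode_eq dir_sign_def freq_def del: mode.simps)
  next
    case DN
    then show ?thesis
      using s[of "(real n + 1/2) * pi"] by (simp add: mode_fun dir_sign_def freq_def del: mode.simps distrib_right_numeral)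
  next
    case ND
    then show ?thesis
      using c[of "(real n + 1/2) * pi"] by (simp add: mode_fun dir_sign_def freq_def del: mode.simps distrib_right_numeral)
  qed
qed

lemma d1_cmode:
  assumes "b1 \<in> {Dirichlet, Neumann}" "b3 \<in> {Dirichlet, Neumann}"
  shows "d1 (cmode b1 b3 n) =
    (\<lambda>y. complex_of_real (dir_sign b1 * freq b1 b3 n) * cmode (dual_bc b1) (dual_bc b3) n y)"
  by (rule d1_eq) (use has_vector_derivative_of_real[OF mode_deriv[OF assms]] in simp)

lemma mode_boundary:
  assumes "b1 \<in> {Dirichlet, Neumann}" "b3 \<in> {Dirichlet, Neumann}"
  shows "b1 = Dirichlet \<Longrightarrow> mode b1 b3 n 0 = 0" "b3 = Dirichlet \<Longrightarrow> mode b1 b3 n 1 = 0"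
proof -
  have "cos ((real n + 1/2) * pi) = 0"
    by (simp add: distrib_right cos_add)
  then show "b1 = Dirichlet \<Longrightarrow> mode b1 b3 n 0 = 0" "b3 = Dirichlet \<Longrightarrow> mode b1 b3 n 1 = 0"
    using assms by auto
qed

text \<open>The product formula for cos(pi y) with a sine or cosine gives half the sum of the two
  neighbouring modes. At the lower end \<open>n - 1\<close> is cut off at 0, and the coefficients
  are adapted there. As a consequence the span of the modes is a module over the polynomials in
  cos(pi y).\<close>

lemma mode_times_cos:
  assumes "b1 \<in> {Dirichlet, Neumann}" "b3 \<in> {Dirichlet, Neumann}"
  shows "\<exists>\<alpha> \<beta>. \<forall>y. cos (pi * y) * mode b1 b3 n y = \<alpha> * mode b1 b3 (Suc n) y + \<beta> * mode b1 b3 (n - 1) y"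
proof -
  have e: "(real (Suc n) + e) * pi * y = (real n + e) * pi * y + pi * y" for e y
    by (simp add: algebra_simps)
  have d: "(real (n - 1) + e) * pi * y = (real n + e) * pi * y - pi * y" if "n > 0" for e y
    using that by (simp add: algebra_simps of_nat_diff)
  have S: "cos (pi * y) * (sqrt 2 * sin x) = 1/2 * (sqrt 2 * sin (x + pi * y)) + 1/2 * (sqrt 2 * sin (x - pi * y))" for x y
    by (simp add: sin_add sin_diff algebra_simps)
  have C: "cos (pi * y) * (sqrt 2 * cos x) = 1/2 * (sqrt 2 * cos (x + pi * y)) + 1/2 * (sqrt 2 * cos (x - pi * y))" for x y
    by (simp add: cos_add cos_diff algebra_simps)
  show ?thesis
    using assms
  proof (cases rule: bc_pair_cases[where n=n])
    case DD
    show ?thesis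
    proof (cases "n = 0")
      case True
      then show ?thesis using DD by (intro exI[of _ 0]) auto
    next
      case False
      then show ?thesis
        unfolding DD mode_eq e by (intro exI[of _ "1/2"]) (simp only: d S neq0_conv simp_thms)
    qed
  next
    case NN
    then show ?thesis
      by (intro exI[of _ "1 / sqrt 2"] exI[of _ 0]) auto
  next
    case NN'
    show ?thesis
    proof (cases "n = 1")
      case True
      \<comment> \<open>The lower neighbour is the constant mode, normalised as 1 instead of sqrt 2
        times a cosine; hence sqrt 2 / 2 in place of 1/2.\<close>
      then show ?thesis
        unfolding NN' mode_eq(2)[OF NN'(3)] mode_eq(2)[OF zero_less_Suc] e
        by (intro exI[of _ "1/2"] exI[of _ "sqrt 2 / 2"]) (simp only: C, simp)
    next
      case False
      with NN' have n: "0 < n" "0 < n - 1" by auto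
      show ?thesis
        unfolding NN' mode_eq(2)[OF n(1)] mode_eq(2)[OF n(2)] mode_eq(2)[OF zero_less_Suc] e d[OF n(1)]
        by (intro exI[of _ "1/2"]) (simp only: C simp_thms)
    qed
  next
    case DN
    show ?thesis
    proof (cases "n = 0")
      case True
      \<comment> \<open>The downward shift produces sin(- pi y / 2), which is minus the mode 0
        itself, and \<open>n - 1 = 0\<close> here; hence the coefficient -1/2. For the cosines below
        the sign disappears.\<close>
      have m: "pi * y / 2 - pi * y = - (pi * y / 2)" for y by (simp add: algebra_simps)
      show ?thesis
        unfolding DN mode_eq e
        by (intro exI[of _ "1/2"] exI[of _ "-1/2"]) (simp only: S, simp add: True m)
    next
      case False
      then show ?thesis
        unfolding DN mode_eq e by (intro exI[of _ "1/2"]) (simp only: d S neq0_conv simp_thms)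
    qed
  next
    case ND
    show ?thesis
    proof (cases "n = 0")
      case True
      have m: "pi * y / 2 - pi * y = - (pi * y / 2)" for y by (simp add: algebra_simps)
      show ?thesis
        unfolding ND mode_eq e
        by (intro exI[of _ "1/2"] exI[of _ "1/2"]) (simp only: C, simp add: True m)
    next
      case False
      then show ?thesis
        unfolding ND mode_eq e by (intro exI[of _ "1/2"]) (simp only: d C neq0_conv simp_thms)
    qed
  qed
qed

text \<open>The lowest non-trivial mode has no interior zero. The density proof divides by it, in a
  regularised way.\<close>

lemma mode_positive:
  assumes "b1 \<in> {Dirichlet, Neumann}" "b3 \<in> {Dirichlet, Neumann}" "0 < y" "y < 1"
  shows "0 < mode b1 b3 (if b1 = Dirichlet \<and> b3 = Dirichlet then 1 else 0) y"
proof -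
  have "0 < pi * y" "pi * y < pi" "pi * y / 2 < pi / 2"
    using assms by auto
  then have "0 < sin (pi * y)" "0 < sin (pi * y / 2)" "0 < cos (pi * y / 2)"
    using sin_gt_zero[of "pi * y"] sin_gt_zero[of "pi * y / 2"] cos_gt_zero_pi[of "pi * y / 2"] by linarith+
  then show ?thesis
    using assms(1,2) by auto
qed

lemma integral_cos_multiple_pi: "((\<lambda>y. cos (of_int j * pi * y)) has_integral (if j = 0 then 1 else 0)) {0..1}"
proof (cases "j = 0")
  case True
  then show ?thesis
    using has_integral_const_real[of "1::real" 0 1] by simp
next
  case False
  have "((\<lambda>y. cos (of_int j * pi * y)) has_integral
      (sin (of_int j * pi * 1) / (of_int j * pi) - sin (of_int j * pi * 0) / (of_int j * pi))) {0..1}"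
    using False
    by (intro fundamental_theorem_of_calculus)
       (auto intro!: derivative_eq_intros simp: has_real_derivative_iff_has_vector_derivative[symmetric])
  then show ?thesis
    using False sin_integer_2pi[of "of_int j / 2"] by (simp add: mult.commute sin_int_times_real)
qed

text \<open>Product-to-sum formulas reduce every product to functions cos(j pi y) with integer j:
  the offsets 1/2 cancel in the difference of the arguments and add up to 1 in the sum. Products
  with the constant mode are already of this form.\<close>

lemma mode_orthonormal:
  assumes "b1 \<in> {Dirichlet, Neumann}" "b3 \<in> {Dirichlet, Neumann}"
  shows "((\<lambda>y. mode b1 b3 m y * mode b1 b3 n y) has_integral
     (if m = n \<and> \<not> zero_mode b1 b3 n then 1 else 0)) {0..1}"
proof -
  define I where "I j = (\<lambda>y. cos (of_int j * pi * y))" for j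
  have I: "(I j has_integral (if j = 0 then 1 else 0)) {0..1}" for j
    unfolding I_def by (rule integral_cos_multiple_pi)
  have ss: "sqrt 2 * sin x * (sqrt 2 * sin z) = cos (x - z) - cos (x + z)" for x z :: real
    by (simp add: cos_add cos_diff algebra_simps)
  have cc: "sqrt 2 * cos x * (sqrt 2 * cos z) = cos (x - z) + cos (x + z)" for x z :: real
    by (simp add: cos_add cos_diff algebra_simps)
  have m: "I (int m - int n) y = cos ((real m + e) * pi * y - (real n + e) * pi * y)" for e y
    unfolding I_def by (simp add: algebra_simps)
  have p0: "I (int m + int n) y = cos (real m * pi * y + real n * pi * y)" for y
    unfolding I_def by (simp add: algebra_simps)
  have p1: "I (int m + int n + 1) y = cos ((real m + 1/2) * pi * y + (real n + 1/2) * pi * y)" for y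
    unfolding I_def by (simp add: algebra_simps)
  consider "b1 = Dirichlet" "b3 = Dirichlet" | "b1 = Neumann" "b3 = Neumann"
    | "b1 = Dirichlet" "b3 = Neumann" | "b1 = Neumann" "b3 = Dirichlet"
    using assms by auto
  then show ?thesis
  proof cases
    case 1
    have "((\<lambda>y. I (int m - int n) y - I (int m + int n) y) has_integral
       ((if int m - int n = 0 then 1 else 0) - (if int m + int n = 0 then 1 else 0))) {0..1}"
      by (intro has_integral_diff I)
    moreover have "I (int m - int n) y - I (int m + int n) y = mode b1 b3 m y * mode b1 b3 n y" for y
      using 1 ss[of "real m * pi * y" "real n * pi * y"] m[of y 0] p0[of y]
      by (cases "m = 0"; cases "n = 0") (auto simp: I_def)
    ultimately show ?thesis
      using 1 by (auto simp: zero_mode_def split: if_splits)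
  next
    case 2
    show ?thesis
    proof (cases "m = 0 \<or> n = 0")
      case True
      define c where "c = (if m = 0 \<and> n = 0 then 1 else sqrt 2)"
      have "((\<lambda>y. c * I (int m + int n) y) has_integral c * (if int m + int n = 0 then 1 else 0)) {0..1}"
        by (intro has_integral_mult_right I)
      moreover have "c * I (int m + int n) y = mode b1 b3 m y * mode b1 b3 n y" for y
        using 2 True p0[of y] by (auto simp: c_def)
      ultimately show ?thesis
        using 2 True by (auto simp: zero_mode_def c_def split: if_splits)
    next
      case False
      have "((\<lambda>y. I (int m - int n) y + I (int m + int n) y) has_integral
         ((if int m - int n = 0 then 1 else 0) + (if int m + int n = 0 then 1 else 0))) {0..1}"
        by (intro has_integral_add I)
      moreover have "I (int m - int n) y + I (int m + int n) y = mode b1 b3 m y * mode b1 b3 n y" for y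
        using 2 False cc[of "real m * pi * y" "real n * pi * y"] m[of y 0] p0[of y] by auto
      ultimately show ?thesis
        using 2 False by (auto simp: zero_mode_def split: if_splits)
    qed
  next
    case 3
    have "((\<lambda>y. I (int m - int n) y - I (int m + int n + 1) y) has_integral
       ((if int m - int n = 0 then 1 else 0) - (if int m + int n + 1 = 0 then 1 else 0))) {0..1}"
      by (intro has_integral_diff I)
    moreover have "I (int m - int n) y - I (int m + int n + 1) y = mode b1 b3 m y * mode b1 b3 n y" for y
      using 3 ss[of "(real m + 1/2) * pi * y" "(real n + 1/2) * pi * y"] m[of y "1/2"] p1[of y] by auto
    ultimately show ?thesis
      using 3 by (auto simp: zero_mode_def split: if_splits)
  next
    case 4
    have "((\<lambda>y. I (int m - int n) y + I (int m + int n + 1) y) has_integral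
       ((if int m - int n = 0 then 1 else 0) + (if int m + int n + 1 = 0 then 1 else 0))) {0..1}"
      by (intro has_integral_add I)
    moreover have "I (int m - int n) y + I (int m + int n + 1) y = mode b1 b3 m y * mode b1 b3 n y" for y
      using 4 cc[of "(real m + 1/2) * pi * y" "(real n + 1/2) * pi * y"] m[of y "1/2"] p1[of y] by auto
    ultimately show ?thesis
      using 4 by (auto simp: zero_mode_def split: if_splits)
  qed
qed

lemma continuous_mode:
  assumes "b1 \<in> {Dirichlet, Neumann}" "b3 \<in> {Dirichlet, Neumann}"
  shows "continuous_on S (mode b1 b3 n)"
  by (intro continuous_at_imp_continuous_on ballI DERIV_isCont[OF mode_deriv[OF assms]])

lemma cmode_orthonormal:
  assumes "b1 \<in> {Dirichlet, Neumann}" "b3 \<in> {Dirichlet, Neumann}"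
  shows "(LINT y|side_measure. cmode b1 b3 m y * cmode b1 b3 n y) =
     (if m = n \<and> \<not> zero_mode b1 b3 n then 1 else 0)"
proof -
  have "(LINT y|side_measure. mode b1 b3 m y * mode b1 b3 n y) = (if m = n \<and> \<not> zero_mode b1 b3 n then 1 else 0)"
    using integral_unique[OF mode_orthonormal[OF assms]]
    by (subst integral_side_continuous(2)) (auto intro!: continuous_on_mult continuous_mode[OF assms])
  then have "complex_of_real (LINT y|side_measure. mode b1 b3 m y * mode b1 b3 n y) = (if m = n \<and> \<not> zero_mode b1 b3 n then 1 else 0)"
    by simp
  then show ?thesis
    unfolding integral_complex_of_real[symmetric] by simp
qed


section \<open>Density of mode sums and the fundamental lemma\<close>

locale mode_pair =
  fixes b1 b3 :: bc
  assumes b1: "b1 \<in> {Dirichlet, Neumann}" and b3: "b3 \<in> {Dirichlet, Neumann}"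
begin

abbreviation Y :: "nat \<Rightarrow> real \<Rightarrow> complex" where
  "Y n \<equiv> cmode b1 b3 n"

lemmas smooth1_Y = smooth1_cmode[OF b1 b3]

text \<open>Only the variable \<open>y\<close> is expanded; the coefficients remain arbitrary smooth
  functions of \<open>x\<close>, which is the form that separation of variables produces.\<close>

inductive mode_span :: "(real \<times> real \<Rightarrow> complex) \<Rightarrow> bool" where
  zero: "mode_span (\<lambda>p. 0)"
| step: "smooth1 h \<Longrightarrow> mode_span V \<Longrightarrow> mode_span (\<lambda>p. tensor h (Y n) p + V p)"

lemma mode_span_add: "mode_span V \<Longrightarrow> mode_span W \<Longrightarrow> mode_span (\<lambda>p. V p + W p)"
proof (induction rule: mode_span.induct)
  case (step h V n)
  from mode_span.step[OF step.hyps(1) step.IH[OF step.prems], of n] show ?case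
    by (simp add: add.assoc)
qed simp

lemma mode_span_tensor: "smooth1 h \<Longrightarrow> mode_span (tensor h (Y n))"
  using mode_span.step[OF _ mode_span.zero] by simp

lemma mode_span_sum: "(\<And>n. n < (N::nat) \<Longrightarrow> smooth1 (F n)) \<Longrightarrow> mode_span (\<lambda>p. \<Sum>n<N. tensor (F n) (Y n) p)"
  by (induction N) (simp_all add: mode_span.zero mode_span_add mode_span_tensor)

lemma continuous_mode_span: "mode_span V \<Longrightarrow> continuous_on S V"
  by (induction rule: mode_span.induct) (auto intro!: continuous_on_add continuous_tensor smooth1_Y)

lemma L2_mode_span: "mode_span V \<Longrightarrow> V \<in> L2 area_measure"
  by (intro L2_area_continuous continuous_mode_span)

text \<open>The product of two modes in general leaves the family, so the mode sums do not form an
  algebra. The functions that multiply mode sums into mode sums do, and Stone-Weierstrass is applied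
  to them.\<close>

definition multiplier :: "(real \<times> real \<Rightarrow> complex) \<Rightarrow> bool" where
  "multiplier m \<longleftrightarrow> (\<forall>V. mode_span V \<longrightarrow> mode_span (\<lambda>p. m p * V p))"

lemma multiplier_add: "multiplier m \<Longrightarrow> multiplier l \<Longrightarrow> multiplier (\<lambda>p. m p + l p)"
  unfolding multiplier_def distrib_right by (intro allI impI mode_span_add) simp_all

lemma multiplier_mult: "multiplier m \<Longrightarrow> multiplier l \<Longrightarrow> multiplier (\<lambda>p. m p * l p)"
  unfolding multiplier_def mult.assoc by simp

lemma multiplier_fst:
  assumes "smooth1 h"
  shows "multiplier (\<lambda>p. h (fst p))"
  unfolding multiplier_def
proof (intro allI impI)
  fix V assume "mode_span V"
  then show "mode_span (\<lambda>p. h (fst p) * V p)"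
  proof induction
    case zero
    then show ?case using mode_span.zero by simp
  next
    case (step h' V n)
    from mode_span.step[OF smooth1_mult[OF assms step.hyps(1)] step.IH, of n] show ?case
      by (simp add: tensor_def algebra_simps)
  qed
qed

lemma multiplier_cos: "multiplier (\<lambda>p. complex_of_real (cos (pi * snd p)))"
  unfolding multiplier_def
proof (intro allI impI)
  fix V assume "mode_span V"
  then show "mode_span (\<lambda>p. complex_of_real (cos (pi * snd p)) * V p)"
  proof induction
    case zero
    then show ?case using mode_span.zero by simp
  next
    case (step h V n)
    obtain \<alpha> \<beta> where ab: "\<And>y. cos (pi * y) * mode b1 b3 n y = \<alpha> * mode b1 b3 (Suc n) y + \<beta> * mode b1 b3 (n - 1) y"
      using mode_times_cos[OF b1 b3] by blast
    have c: "complex_of_real (cos (pi * y)) * Y n y = complex_of_real \<alpha> * Y (Suc n) y + complex_of_real \<beta> * Y (n - 1) y" for y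
      unfolding of_real_mult[symmetric] of_real_add[symmetric] ab ..
    have "complex_of_real (cos (pi * snd p)) * (tensor h (Y n) p + V p) =
        tensor (\<lambda>x. complex_of_real \<alpha> * h x) (Y (Suc n)) p + (tensor (\<lambda>x. complex_of_real \<beta> * h x) (Y (n - 1)) p
         + complex_of_real (cos (pi * snd p)) * V p)" for p
    proof -
      have "complex_of_real (cos (pi * snd p)) * tensor h (Y n) p = h (fst p) * (complex_of_real (cos (pi * snd p)) * Y n (snd p))"
        by (simp add: tensor_def)
      then show ?thesis
        unfolding c by (simp add: tensor_def algebra_simps)
    qed
    then show ?case
      using mode_span.step[OF smooth1_cmult[OF step.hyps(1)] mode_span.step[OF smooth1_cmult[OF step.hyps(1)] step.IH],
          of "complex_of_real \<alpha>" "Suc n" "complex_of_real \<beta>" "n - 1"]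
      by (simp only:)
  qed
qed

lemma multiplier_const: "multiplier (\<lambda>p. c)"
  using multiplier_fst[OF smooth1_const] by simp

lemma multiplier_polynomial:
  "real_polynomial_function r \<Longrightarrow> multiplier (\<lambda>p. complex_of_real (r (fst p, cos (pi * snd p))))"
proof (induction rule: real_polynomial_function.induct)
  case (linear r)
  interpret bounded_linear r by fact
  have R: "r (x, t) = x * r (1, 0) + t * r (0, 1)" for x t
    using add[of "x *\<^sub>R (1, 0)" "t *\<^sub>R (0, 1)"] by (simp only: scaleR) simp
  have "(\<lambda>p. complex_of_real (r (fst p, cos (pi * snd p)))) = (\<lambda>p. complex_of_real (fst p) * complex_of_real (r (1, 0))
      + complex_of_real (cos (pi * snd p)) * complex_of_real (r (0, 1)))"
    by (rule ext, subst R) simp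
  moreover have "multiplier \<dots>"
    by (intro multiplier_add multiplier_mult multiplier_const multiplier_cos multiplier_fst[OF smooth1_id])
  ultimately show ?case by metis
next
  case (const c)
  show ?case by (rule multiplier_const)
next
  case (add f g)
  show ?case unfolding of_real_add by (rule multiplier_add[OF add.IH])
next
  case (mult f g)
  show ?case unfolding of_real_mult by (rule multiplier_mult[OF mult.IH])
qed

text \<open>On [0,1] the function cos(pi y) is a coordinate with inverse arccos(.)/pi. In this
  coordinate \<open>k\<close> becomes a continuous function on [0,1] x [-1,1], and polynomials
  approximating its real and imaginary parts are multipliers.\<close>

lemma multiplier_approximation:
  fixes k :: "real \<times> real \<Rightarrow> complex"
  assumes "continuous_on UNIV k" "e > 0"
  obtains P where "multiplier P" "continuous_on UNIV P" "\<And>p. p \<in> Omega \<Longrightarrow> cmod (k p - P p) \<le> e"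
proof -
  define S where "S = {0..1::real} \<times> {-1..1::real}"
  define \<psi> where "\<psi> q = k (fst q, arccos (snd q) / pi)" for q
  have S: "compact S" unfolding S_def by (intro compact_Times compact_Icc)
  have "continuous_on S (\<lambda>q. (fst q, arccos (snd q) / pi))"
    unfolding S_def by (intro continuous_intros) auto
  then have c: "continuous_on S \<psi>"
    unfolding \<psi>_def by (rule continuous_on_compose2[OF assms(1)]) simp
  obtain r1 where r1: "real_polynomial_function r1" "\<And>q. q \<in> S \<Longrightarrow> \<bar>Re (\<psi> q) - r1 q\<bar> < e / 2"
    using Stone_Weierstrass_real_polynomial_function[OF S continuous_on_Re[OF c], of "e / 2"] assms(2) by auto
  obtain r2 where r2: "real_polynomial_function r2" "\<And>q. q \<in> S \<Longrightarrow> \<bar>Im (\<psi> q) - r2 q\<bar> < e / 2"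
    using Stone_Weierstrass_real_polynomial_function[OF S continuous_on_Im[OF c], of "e / 2"] assms(2) by auto
  define P where "P p = complex_of_real (r1 (fst p, cos (pi * snd p))) + \<i> * complex_of_real (r2 (fst p, cos (pi * snd p)))" for p
  have mP: "multiplier P"
    unfolding P_def[abs_def] by (intro multiplier_add multiplier_mult multiplier_const multiplier_polynomial r1 r2)
  have cr: "continuous_on UNIV (\<lambda>p. r (fst p, cos (pi * snd p)))" if "real_polynomial_function r"
    for r :: "real \<times> real \<Rightarrow> real"
  proof (rule continuous_on_compose2[of UNIV r])
    show "continuous_on UNIV r"
      using that by (intro continuous_at_imp_continuous_on ballI continuous_real_polymonial_function)
  qed (auto intro!: continuous_intros)
  have cP: "continuous_on UNIV P"
    unfolding P_def[abs_def]
    by (intro continuous_on_add continuous_on_mult continuous_on_const continuous_on_of_real cr r1 r2)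
  have "cmod (k p - P p) \<le> e" if p: "p \<in> Omega" for p
  proof -
    let ?q = "(fst p, cos (pi * snd p))"
    have y: "0 < snd p" "snd p < 1" "0 < fst p" "fst p < 1"
      using p by (auto simp: Omega_def)
    then have q: "?q \<in> S" by (auto simp: S_def)
    have "arccos (cos (pi * snd p)) = pi * snd p"
      using y by (intro arccos_cos) auto
    then have k: "\<psi> ?q = k p" by (simp add: \<psi>_def)
    have "cmod (k p - P p) \<le> \<bar>Re (k p - P p)\<bar> + \<bar>Im (k p - P p)\<bar>"
      by (rule cmod_le)
    also have "\<dots> \<le> e / 2 + e / 2"
      using r1(2)[OF q] r2(2)[OF q] unfolding k by (intro add_mono) (simp_all add: P_def)
    finally show ?thesis by simp
  qed
  with mP cP show ?thesis by (rule that)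
qed

text \<open>Let \<open>s\<close> be the positive lowest mode. It may vanish at the ends, so f / s
  need not be continuous; instead \<open>f\<close> is first replaced by f s^2 / (s^2 + 1/(m+1)),
  which tends to \<open>f\<close> by dominated convergence. This function is \<open>k\<close> times
  \<open>s\<close> with \<open>k\<close> continuous, and a multiplier close to \<open>k\<close>,
  applied to \<open>s\<close>, is a mode sum.\<close>

lemma mode_span_dense:
  fixes f :: "real \<times> real \<Rightarrow> complex"
  assumes f: "continuous_on UNIV f" and e: "e > 0"
  obtains V where "mode_span V" "L2_norm area_measure (\<lambda>p. f p - V p) < e"
proof -
  define n0 :: nat where "n0 = (if b1 = Dirichlet \<and> b3 = Dirichlet then 1 else 0)"
  define s where "s y = mode b1 b3 n0 y" for y
  have s_pos: "0 < s y" if "0 < y" "y < 1" for y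
    using mode_positive[OF b1 b3 that] by (simp add: s_def n0_def)
  have s_le: "\<bar>s y\<bar> \<le> 2" for y
  proof -
    have b: "sqrt 2 * \<bar>sin x\<bar> \<le> 2" "sqrt 2 * \<bar>cos x\<bar> \<le> 2" for x :: real
      using mult_mono[of "sqrt 2" 2 "\<bar>sin x\<bar>" 1] mult_mono[of "sqrt 2" 2 "\<bar>cos x\<bar>" 1] sqrt_le_D[of 2 2]
      by (auto simp: real_le_lsqrt)
    show ?thesis
      by (rule bc_pair_cases[OF b1 b3, where n=n0]) (simp_all add: b s_def mode_fun abs_mult del: mode.simps)
  qed
  have s_cont: "continuous_on S (\<lambda>p. s (snd p))" for S :: "(real \<times> real) set"
    unfolding s_def
    by (rule continuous_on_compose2[OF continuous_mode[OF b1 b3, of UNIV] continuous_on_snd[OF continuous_on_id]]) simp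
  define w where "w m y = (s y)\<^sup>2 / ((s y)\<^sup>2 + 1 / real (Suc m))" for m y
  have den: "0 < (s y)\<^sup>2 + 1 / real (Suc m)" for m y
    by (intro add_nonneg_pos) auto
  have w_bounds: "0 \<le> w m y" "w m y \<le> 1" for m y
    using den[of y m] by (auto simp: w_def)
  have w_cont: "continuous_on UNIV (\<lambda>p::real \<times> real. complex_of_real (w m (snd p)))" for m
    unfolding w_def using den[THEN less_imp_neq, THEN not_sym]
    by (intro continuous_on_of_real continuous_on_divide continuous_on_add continuous_on_power s_cont continuous_on_const) auto
  have w_lim: "(\<lambda>m. w m y) \<longlonglongrightarrow> 1" if "0 < y" "y < 1" for y
  proof -
    have "(\<lambda>m. w m y) \<longlonglongrightarrow> (s y)\<^sup>2 / ((s y)\<^sup>2 + 0)"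
      unfolding w_def using s_pos[OF that]
      by (intro tendsto_divide tendsto_add tendsto_const LIMSEQ_inverse_real_of_nat[unfolded inverse_eq_divide]) auto
    then show ?thesis using s_pos[OF that] by simp
  qed
  have fL2: "f \<in> L2 area_measure" by (rule L2_area_continuous[OF f])
  have FL2: "(\<lambda>p. f p * complex_of_real (w m (snd p))) \<in> L2 area_measure" for m
    by (intro L2_area_continuous continuous_on_mult f w_cont)
  have "(\<lambda>m. LINT p|area_measure. (cmod (f p - f p * complex_of_real (w m (snd p))))\<^sup>2) \<longlonglongrightarrow> (LINT p|area_measure. 0)"
  proof (rule integral_dominated_convergence)
    show "(\<lambda>p. (cmod (f p - f p * complex_of_real (w m (snd p))))\<^sup>2) \<in> borel_measurable area_measure" for m
      using L2_measurable[OF L2_diff[OF fL2 FL2]] by measurable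
    show "integrable area_measure (\<lambda>p. (cmod (f p))\<^sup>2)"
      by (rule L2_integrable_sq[OF fL2])
    show "AE p in area_measure. (\<lambda>m. (cmod (f p - f p * complex_of_real (w m (snd p))))\<^sup>2) \<longlonglongrightarrow> 0"
    proof (rule AE_I2)
      fix p assume "p \<in> space area_measure"
      then have "0 < snd p" "snd p < 1" by (auto simp: Omega_def)
      from w_lim[OF this]
      have "(\<lambda>m. (cmod (f p - f p * complex_of_real (w m (snd p))))\<^sup>2) \<longlonglongrightarrow> (cmod (f p - f p * complex_of_real 1))\<^sup>2"
        by (intro tendsto_intros)
      then show "(\<lambda>m. (cmod (f p - f p * complex_of_real (w m (snd p))))\<^sup>2) \<longlonglongrightarrow> 0" by simp
    qed
    show "AE p in area_measure. norm ((cmod (f p - f p * complex_of_real (w m (snd p))))\<^sup>2) \<le> (cmod (f p))\<^sup>2" for m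
    proof (rule AE_I2)
      fix p
      have "f p - f p * complex_of_real (w m (snd p)) = f p * complex_of_real (1 - w m (snd p))"
        by (simp add: algebra_simps)
      then have "cmod (f p - f p * complex_of_real (w m (snd p))) = cmod (f p) * \<bar>1 - w m (snd p)\<bar>"
        by (simp only: norm_mult norm_of_real)
      also have "\<dots> \<le> cmod (f p)"
        using w_bounds[of m "snd p"] by (intro mult_left_le) auto
      finally show "norm ((cmod (f p - f p * complex_of_real (w m (snd p))))\<^sup>2) \<le> (cmod (f p))\<^sup>2"
        by (simp add: power_mono)
    qed
  qed simp
  then have "(\<lambda>m. L2_norm area_measure (\<lambda>p. f p - f p * complex_of_real (w m (snd p)))) \<longlonglongrightarrow> 0"
    unfolding L2_norm_def using tendsto_real_sqrt by force
  then have "\<forall>\<^sub>F m in sequentially. L2_norm area_measure (\<lambda>p. f p - f p * complex_of_real (w m (snd p))) < e / 2"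
    using e by (rule_tac order_tendstoD(2)) auto
  then obtain m where m: "L2_norm area_measure (\<lambda>p. f p - f p * complex_of_real (w m (snd p))) < e / 2"
    using eventually_happens'[OF sequentially_bot] by auto
  define k where "k p = f p * complex_of_real (s (snd p) / ((s (snd p))\<^sup>2 + 1 / real (Suc m)))" for p
  have "continuous_on UNIV k"
    unfolding k_def using den[THEN less_imp_neq, THEN not_sym]
    by (intro continuous_on_mult f continuous_on_of_real continuous_on_divide continuous_on_add continuous_on_power s_cont continuous_on_const) auto
  \<comment> \<open>The crude bound 2 for the modulus of \<open>s\<close> turns the uniform error
    e/4 into e/2.\<close>
  then obtain P where P: "multiplier P" "continuous_on UNIV P" "\<And>p. p \<in> Omega \<Longrightarrow> cmod (k p - P p) \<le> e / 4"
    using multiplier_approximation[of k "e / 4"] e by auto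
  define V where "V p = P p * tensor (\<lambda>x. 1) (Y n0) p" for p
  have V: "mode_span V"
    unfolding V_def[abs_def]
    by (rule P(1)[unfolded multiplier_def, rule_format, OF mode_span_tensor[OF smooth1_const]])
  have "L2_norm area_measure (\<lambda>p. f p * complex_of_real (w m (snd p)) - V p) \<le> e / 2"
  proof (rule L2_area_bound)
    show "(\<lambda>p. f p * complex_of_real (w m (snd p)) - V p) \<in> borel_measurable area_measure"
      by (rule L2_measurable[OF L2_diff[OF FL2 L2_mode_span[OF V]]])
    fix p assume p: "p \<in> Omega"
    have "f p * complex_of_real (w m (snd p)) - V p = (k p - P p) * complex_of_real (s (snd p))"
      by (simp add: V_def tensor_def k_def w_def s_def power2_eq_square algebra_simps)
    then have "cmod (f p * complex_of_real (w m (snd p)) - V p) = cmod (k p - P p) * \<bar>s (snd p)\<bar>"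
      by (simp add: norm_mult)
    also have "\<dots> \<le> e / 4 * 2"
      using P(3)[OF p] s_le e by (intro mult_mono) auto
    finally show "cmod (f p * complex_of_real (w m (snd p)) - V p) \<le> e / 2" by simp
  qed (use e in simp)
  then have "L2_norm area_measure (\<lambda>p. f p - V p) < e"
    using L2_norm_triangle_diff[OF fL2 FL2 L2_mode_span[OF V], of m] m by linarith
  with V show ?thesis by (rule that)
qed

end

section \<open>The fundamental lemma of the calculus of variations\<close>

lemma tensor_cutoff_test_function:
  assumes "smooth1 h" "smooth1 q" "m > 0"
  shows "tensor (\<lambda>x. h x * cutoff m x) (\<lambda>y. q y * cutoff m y) \<in> test_functions"
proof -
  let ?K = "{1 / real m..1 - 1 / real m} \<times> {1 / real m..1 - 1 / real m}"
  have "smooth (tensor (\<lambda>x. h x * cutoff m x) (\<lambda>y. q y * cutoff m y))"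
    by (intro smooth_tensor smooth1_mult smooth1_cutoff assms)
  moreover have "compact ?K" by (intro compact_Times compact_Icc)
  moreover have "?K \<subseteq> Omega"
  proof -
    have "0 < 1 / real m" using assms(3) by simp
    show ?thesis
    proof
      fix p assume "p \<in> ?K"
      then have "1 / real m \<le> fst p" "fst p \<le> 1 - 1 / real m" "1 / real m \<le> snd p" "snd p \<le> 1 - 1 / real m"
        by auto
      with \<open>0 < 1 / real m\<close> have "0 < fst p" "fst p < 1" "0 < snd p" "snd p < 1"
        by linarith+
      then show "p \<in> Omega" by (cases p) (simp add: Omega_def)
    qed
  qed
  moreover have "tensor (\<lambda>x. h x * cutoff m x) (\<lambda>y. q y * cutoff m y) p = 0" if "p \<notin> ?K" for p
    using that cutoff_support[OF assms(3), of "fst p"] cutoff_support[OF assms(3), of "snd p"]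
    by (cases p) (auto simp: tensor_def)
  ultimately show ?thesis
    unfolding test_functions_def by blast
qed

text \<open>Cutting off both factors gives test functions that converge pointwise to the product and
  are dominated by it, so compact support is removed by dominated convergence.\<close>

lemma orthogonal_tensor:
  assumes d: "d \<in> L2 area_measure"
    and z: "\<And>\<phi>. \<phi> \<in> test_functions \<Longrightarrow> (LINT p|area_measure. d p * \<phi> p) = 0"
    and h: "smooth1 h" and q: "smooth1 q"
  shows "(LINT p|area_measure. d p * tensor h q p) = 0"
proof -
  define T where "T m = tensor (\<lambda>x. h x * cutoff (Suc m) x) (\<lambda>y. q y * cutoff (Suc m) y)" for m
  have T: "T m \<in> L2 area_measure" for m
    unfolding T_def by (intro L2_tensor smooth1_mult smooth1_cutoff h q)
  have "(\<lambda>m. LINT p|area_measure. d p * T m p) \<longlonglongrightarrow> (LINT p|area_measure. d p * tensor h q p)"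
  proof (rule integral_dominated_convergence)
    show "(\<lambda>p. d p * tensor h q p) \<in> borel_measurable area_measure"
      using L2_mult_integrable[OF d L2_tensor[OF h q]] by auto
    show "(\<lambda>p. d p * T m p) \<in> borel_measurable area_measure" for m
      using L2_mult_integrable[OF d T] by auto
    show "integrable area_measure (\<lambda>p. cmod (d p) * cmod (tensor h q p))"
      by (rule integrable_norm_mult[OF d L2_tensor[OF h q]])
    show "AE p in area_measure. (\<lambda>m. d p * T m p) \<longlonglongrightarrow> d p * tensor h q p"
    proof (rule AE_I2)
      fix p assume "p \<in> space area_measure"
      then have "0 < fst p" "fst p < 1" "0 < snd p" "snd p < 1" by (auto simp: Omega_def)
      then have "(\<lambda>m. d p * T m p) \<longlonglongrightarrow> d p * (h (fst p) * 1 * (q (snd p) * 1))"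
        unfolding T_def tensor_def
        by (intro tendsto_intros cutoff_limit[THEN LIMSEQ_Suc])
      then show "(\<lambda>m. d p * T m p) \<longlonglongrightarrow> d p * tensor h q p" by (simp add: tensor_def)
    qed
    show "AE p in area_measure. norm (d p * T m p) \<le> cmod (d p) * cmod (tensor h q p)" for m
    proof (rule AE_I2)
      fix p
      have "cmod (T m p) = cmod (tensor h q p) * (cmod (cutoff (Suc m) (fst p)) * cmod (cutoff (Suc m) (snd p)))"
        by (simp add: T_def tensor_def norm_mult)
      also have "\<dots> \<le> cmod (tensor h q p) * 1"
        by (intro mult_left_mono mult_le_one cmod_cutoff_le_1) auto
      finally show "norm (d p * T m p) \<le> cmod (d p) * cmod (tensor h q p)"
        by (simp add: norm_mult mult_left_mono)
    qed
  qed
  moreover have "(LINT p|area_measure. d p * T m p) = 0" for m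
    unfolding T_def by (intro z tensor_cutoff_test_function h q) simp
  ultimately show ?thesis
    by (simp add: LIMSEQ_const_iff)
qed

text \<open>Mode sums are finite sums of smooth products, and those of the pure Neumann family
  approximate \<open>f\<close> in the mean; Cauchy-Schwarz controls the error.\<close>

lemma orthogonal_continuous:
  assumes d: "d \<in> L2 area_measure"
    and z: "\<And>h q. smooth1 h \<Longrightarrow> smooth1 q \<Longrightarrow> (LINT p|area_measure. d p * tensor h q p) = 0"
    and f: "continuous_on UNIV f"
  shows "(LINT p|area_measure. d p * f p) = 0"
proof -
  interpret mode_pair Neumann Neumann by unfold_locales auto
  have V0: "(LINT p|area_measure. d p * V p) = 0" if "mode_span V" for V
    using that
  proof induction
    case (step h V n)
    then show ?case
      using L2_mult_integrable[OF d L2_tensor[OF step.hyps(1) smooth1_Y]] L2_mult_integrable[OF d L2_mode_span[OF step.hyps(2)]] z smooth1_Y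
      by (simp add: distrib_left del: mode.simps)
  qed simp
  have fL2: "f \<in> L2 area_measure" by (rule L2_area_continuous[OF f])
  have "cmod (LINT p|area_measure. d p * f p) \<le> 0 + e" if "e > 0" for e
  proof -
    define e' where "e' = e / (L2_norm area_measure d + 1)"
    have pos: "0 < L2_norm area_measure d + 1"
      using L2_norm_nonneg[of area_measure d] by simp
    then have "e' > 0" using that by (simp add: e'_def)
    then obtain V where V: "mode_span V" "L2_norm area_measure (\<lambda>p. f p - V p) < e'"
      using mode_span_dense[OF f] by blast
    have "(LINT p|area_measure. d p * f p) = (LINT p|area_measure. d p * (f p - V p))"
      using V0[OF V(1)] L2_mult_integrable[OF d fL2] L2_mult_integrable[OF d L2_mode_span[OF V(1)]]
      by (simp add: right_diff_distrib)
    also have "cmod \<dots> \<le> L2_norm area_measure d * L2_norm area_measure (\<lambda>p. f p - V p)"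
      by (intro L2_cauchy_schwarz d L2_diff fL2 L2_mode_span V)
    also have "\<dots> \<le> (L2_norm area_measure d + 1) * e'"
      using V(2) by (intro mult_mono) (auto simp: L2_norm_nonneg)
    also have "\<dots> = e" using pos by (simp add: e'_def)
    finally show ?thesis by simp
  qed
  then show ?thesis
    using field_le_epsilon[of "cmod (LINT p|area_measure. d p * f p)" 0] by simp
qed

text \<open>The test function is the normalised conjugate cnj d / (1 + |d|): it is bounded by 1, and
  its product with \<open>d\<close> is the nonnegative function |d|^2 / (1 + |d|). Boundedness
  allows it to be replaced by continuous functions of modulus at most 1, with \<open>|d|\<close> as
  the dominating function.\<close>

lemma fundamental_lemma_area:
  assumes d: "d \<in> L2 area_measure"
    and z: "\<And>\<phi>. \<phi> \<in> test_functions \<Longrightarrow> (LINT p|area_measure. d p * \<phi> p) = 0"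
  shows "AE p in area_measure. d p = (0::complex)"
proof -
  have zc: "(LINT p|area_measure. d p * f p) = 0" if "continuous_on UNIV f" for f
    by (rule orthogonal_continuous[OF d orthogonal_tensor[OF d z] that])
  define q where "q p = cnj (d p) / complex_of_real (1 + cmod (d p))" for p
  have dm: "d \<in> borel_measurable area_measure" by (rule L2_measurable[OF d])
  have qm: "q \<in> borel_measurable area_measure"
    unfolding q_def using L2_measurable[OF L2_cnj[OF d]] dm by measurable
  have q1: "cmod (q p) \<le> 1" for p
    unfolding q_def norm_divide norm_of_real by (simp add: add_pos_nonneg)
  \<comment> \<open>Measurability in the form of a limit of continuous functions off a negligible
    set. The truncation \<open>G\<close> below enforces the bound 1 and does not change the limit,
    because \<open>q\<close> already satisfies it.\<close>
  obtain N g where N: "negligible N" and g: "\<And>n. continuous_on UNIV (g n)"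
    and lim: "\<And>p. p \<notin> N \<Longrightarrow> (\<lambda>n. g n p) \<longlonglongrightarrow> (if p \<in> Omega then q p else 0)"
    using qm unfolding measurable_on_iff_borel_measurable[OF Omega_sets, symmetric] measurable_on_def by blast
  define G where "G n p = g n p / complex_of_real (max 1 (cmod (g n p)))" for n p
  have G1: "cmod (G n p) \<le> 1" for n p
    unfolding G_def norm_divide norm_of_real by (simp add: divide_le_eq_1 max_def)
  have Gc: "continuous_on UNIV (G n)" for n
    unfolding G_def by (intro continuous_on_divide g continuous_on_of_real continuous_on_max continuous_on_const continuous_on_norm) auto
  have dint: "integrable area_measure (\<lambda>p. cmod (d p))"
    using integrable_norm_mult[OF d L2_area_continuous[OF continuous_on_const[of UNIV 1]]] by simp
  have "(\<lambda>n. LINT p|area_measure. d p * G n p) \<longlonglongrightarrow> (LINT p|area_measure. d p * q p)"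
  proof (rule integral_dominated_convergence[OF _ _ dint])
    show "(\<lambda>p. d p * q p) \<in> borel_measurable area_measure"
      using dm qm by measurable
    show "(\<lambda>p. d p * G n p) \<in> borel_measurable area_measure" for n
      using dm measurable_area[OF Gc[of n]] by measurable
    have "AE p in area_measure. p \<notin> N"
    proof (rule AE_I')
      show "N \<inter> Omega \<in> null_sets area_measure"
        using N by (auto simp: null_sets_restrict_space negligible_iff_null_sets null_set_Int2)
    qed auto
    then show "AE p in area_measure. (\<lambda>n. d p * G n p) \<longlonglongrightarrow> d p * q p"
    proof (rule AE_mp[OF _ AE_I2[OF impI]])
      fix p assume "p \<in> space area_measure" "p \<notin> N"
      then have l: "(\<lambda>n. g n p) \<longlonglongrightarrow> q p" using lim[of p] by auto
      have "(\<lambda>n. d p * G n p) \<longlonglongrightarrow> d p * (q p / complex_of_real (max 1 (cmod (q p))))"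
        unfolding G_def by (intro tendsto_intros l) (auto simp: max_def)
      then show "(\<lambda>n. d p * G n p) \<longlonglongrightarrow> d p * q p"
        using q1[of p] by (simp add: max_def split: if_splits)
    qed
    show "AE p in area_measure. norm (d p * G n p) \<le> cmod (d p)" for n
      using G1[of n] by (auto simp: norm_mult intro!: mult_left_le)
  qed
  then have "(LINT p|area_measure. d p * q p) = 0"
    by (simp add: zc[OF Gc] LIMSEQ_const_iff)
  moreover have dq: "d p * q p = complex_of_real ((cmod (d p))\<^sup>2 / (1 + cmod (d p)))" for p
    unfolding q_def of_real_divide complex_norm_square by simp
  ultimately have "(LINT p|area_measure. (cmod (d p))\<^sup>2 / (1 + cmod (d p))) = 0"
    unfolding dq integral_complex_of_real by (simp del: of_real_add)
  moreover have "integrable area_measure (\<lambda>p. (cmod (d p))\<^sup>2 / (1 + cmod (d p)))"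
  proof (rule Bochner_Integration.integrable_bound[OF dint])
    show "(\<lambda>p. (cmod (d p))\<^sup>2 / (1 + cmod (d p))) \<in> borel_measurable area_measure"
      using dm by measurable
    have "a\<^sup>2 / (1 + a) \<le> a" if "0 \<le> a" for a :: real
      using that by (simp add: divide_le_eq power2_eq_square algebra_simps)
    then show "AE p in area_measure. norm ((cmod (d p))\<^sup>2 / (1 + cmod (d p))) \<le> norm (cmod (d p))"
      by (auto simp: abs_of_nonneg)
  qed
  ultimately have "AE p in area_measure. (cmod (d p))\<^sup>2 / (1 + cmod (d p)) = 0"
    by (subst (asm) integral_nonneg_eq_0_iff_AE) auto
  then show ?thesis
  proof (rule AE_mp[OF _ AE_I2[OF impI]])
    fix p assume "(cmod (d p))\<^sup>2 / (1 + cmod (d p)) = 0"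
    moreover have "1 + cmod (d p) \<noteq> 0" using norm_ge_zero[of "d p"] by linarith
    ultimately show "d p = 0" by simp
  qed
qed


section \<open>Traces and Green formulas\<close>

lemma weak_grad_spec:
  assumes "u \<in> H1"
  shows "weak_grad u \<in> L2 area_measure" "has_weak_grad u (weak_grad u)"
proof -
  have "\<exists>G. G \<in> L2 area_measure \<and> has_weak_grad u G"
    using assms unfolding H1_def by blast
  from someI_ex[OF this] show "weak_grad u \<in> L2 area_measure" "has_weak_grad u (weak_grad u)"
    unfolding weak_grad_def by auto
qed

lemma test_function_smooth: "\<phi> \<in> test_functions \<Longrightarrow> smooth \<phi>"
  by (simp add: test_functions_def)

lemma test_function_boundary: "\<phi> \<in> test_functions \<Longrightarrow> p \<notin> Omega \<Longrightarrow> \<phi> p = 0"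
  unfolding test_functions_def by blast

lemma continuous_smooth: "smooth \<phi> \<Longrightarrow> continuous_on S \<phi>"
  by (meson C1_plane_smooth C1_plane_continuous)

lemma L2_smooth: "smooth \<phi> \<Longrightarrow> \<phi> \<in> L2 area_measure"
  by (intro L2_area_continuous continuous_smooth)

lemma continuous_side_point: "continuous_on S (side_point j)"
proof -
  have "side_point j = (case j of Gamma1 \<Rightarrow> (\<lambda>t. (t, 0)) | Gamma2 \<Rightarrow> (\<lambda>t. (1, t))
      | Gamma3 \<Rightarrow> (\<lambda>t. (t, 1)) | Gamma4 \<Rightarrow> (\<lambda>t. (0, t)))"
    by (cases j) auto
  then show ?thesis
    by (cases j) (auto intro!: continuous_intros)
qed

lemma L2_smooth_side: "smooth \<phi> \<Longrightarrow> (\<lambda>t. \<phi> (side_point j t)) \<in> L2 side_measure"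
  by (intro L2_side_continuous continuous_on_compose2[OF continuous_smooth[of _ UNIV] continuous_side_point]) auto

lemma L2_classical_grad: "smooth \<phi> \<Longrightarrow> classical_grad \<phi> \<in> L2 area_measure"
proof -
  assume "smooth \<phi>"
  then obtain ax ay where c: "C1_plane \<phi> ax ay"
    by (rule C1_plane_smooth)
  show ?thesis
    by (rule L2_pairI) (simp_all add: C1_plane_classical_grad[OF c] L2_area_continuous C1_planeD[OF c])
qed

text \<open>The product with a test function vanishes on the boundary, so the divergence theorem
  leaves no boundary terms.\<close>

lemma classical_grad_has_weak_grad:
  assumes "smooth a"
  shows "has_weak_grad a (classical_grad a)"
  unfolding has_weak_grad_def
proof (intro ballI conjI)
  fix \<phi> assume \<phi>: "\<phi> \<in> test_functions"
  obtain ax ay where a: "C1_plane a ax ay"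
    using assms by (rule C1_plane_smooth)
  obtain fx fy where f: "C1_plane \<phi> fx fy"
    using test_function_smooth[OF \<phi>] by (rule C1_plane_smooth)
  have [simp]: "\<phi> (0, t) = 0" "\<phi> (1, t) = 0" "\<phi> (t, 0) = 0" "\<phi> (t, 1) = 0" for t
    by (rule test_function_boundary[OF \<phi>]; simp add: Omega_def)+
  have i: "integrable area_measure (\<lambda>p. ax p * \<phi> p) \<and> integrable area_measure (\<lambda>p. ay p * \<phi> p)
      \<and> integrable area_measure (\<lambda>p. a p * fx p) \<and> integrable area_measure (\<lambda>p. a p * fy p)"
    by (simp add: L2_mult_integrable L2_area_continuous C1_planeD[OF a] C1_planeD[OF f]
        C1_plane_continuous[OF a] C1_plane_continuous[OF f])
  have "(LINT p|area_measure. ax p * \<phi> p + a p * fx p) = 0"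
    using divergence_square(1)[OF C1_plane_mult[OF a f]] by simp
  moreover have "(LINT p|area_measure. ay p * \<phi> p + a p * fy p) = 0"
    using divergence_square(2)[OF C1_plane_mult[OF a f]] by simp
  ultimately show "(LINT p|area_measure. a p * fst (classical_grad \<phi> p)) = - (LINT p|area_measure. fst (classical_grad a p) * \<phi> p)"
    "(LINT p|area_measure. a p * snd (classical_grad \<phi> p)) = - (LINT p|area_measure. snd (classical_grad a p) * \<phi> p)"
    using i by (simp_all add: C1_plane_classical_grad[OF a] C1_plane_classical_grad[OF f] eq_neg_iff_add_eq_0 add.commute)
qed

lemma H1_smooth: "smooth a \<Longrightarrow> a \<in> H1"
  unfolding H1_def using L2_smooth L2_classical_grad classical_grad_has_weak_grad by blast

text \<open>The fundamental lemma, applied to each component of the difference.\<close>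

lemma weak_grad_unique:
  assumes G: "G \<in> L2 area_measure" "has_weak_grad u G" and G': "G' \<in> L2 area_measure" "has_weak_grad u G'"
  shows "AE p in area_measure. G p = G' p"
proof -
  have "(LINT p|area_measure. (fst (G p) - fst (G' p)) * \<phi> p) = 0 \<and>
    (LINT p|area_measure. (snd (G p) - snd (G' p)) * \<phi> p) = 0" if \<phi>: "\<phi> \<in> test_functions" for \<phi>
    using G(2) G'(2) \<phi> L2_mult_integrable[OF L2_pair(1)[OF G(1)] L2_smooth[OF test_function_smooth[OF \<phi>]]]
      L2_mult_integrable[OF L2_pair(1)[OF G'(1)] L2_smooth[OF test_function_smooth[OF \<phi>]]]
      L2_mult_integrable[OF L2_pair(2)[OF G(1)] L2_smooth[OF test_function_smooth[OF \<phi>]]]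
      L2_mult_integrable[OF L2_pair(2)[OF G'(1)] L2_smooth[OF test_function_smooth[OF \<phi>]]]
    unfolding has_weak_grad_def by (simp add: left_diff_distrib)
  then have "AE p in area_measure. fst (G p) - fst (G' p) = 0" "AE p in area_measure. snd (G p) - snd (G' p) = 0"
    by (intro fundamental_lemma_area L2_diff L2_pair G G'; blast)+
  then show ?thesis
    by eventually_elim (simp add: prod_eq_iff)
qed

lemma weak_grad_smooth:
  "smooth a \<Longrightarrow> AE p in area_measure. weak_grad a p = classical_grad a p"
  by (intro weak_grad_unique[of _ a] weak_grad_spec H1_smooth L2_classical_grad classical_grad_has_weak_grad)

text \<open>The constant sequence approximates; its gradient error has norm 0 because weak and
  classical gradient agree almost everywhere. This gives the traces of the separated test
  functions.\<close>

lemma has_trace_smooth: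
  assumes "smooth a"
  shows "has_trace j a (\<lambda>t. a (side_point j t))"
proof -
  have "L2_norm area_measure (\<lambda>p. classical_grad a p - weak_grad a p) = 0"
    using weak_grad_smooth[OF assms] by (intro L2_norm_eq_0_AE) auto
  then show ?thesis
    unfolding has_trace_def
    using assms by (intro conjI H1_smooth L2_smooth_side exI[of _ "\<lambda>_. a"]) (auto simp: L2_norm_def)
qed

text \<open>Every term is continuous in one of the three norms in which the approximating sequence
  converges. Since each side comes with its own sequence, the identity may contain boundary values
  on one side only.\<close>

lemma has_trace_identity:
  assumes tr: "has_trace j u t"
    and \<alpha>: "\<alpha> \<in> L2 area_measure" and \<beta>: "\<beta> \<in> L2 area_measure" and P: "P \<in> L2 area_measure" and Q: "Q \<in> L2 side_measure"
    and id: "\<And>\<phi>. smooth \<phi> \<Longrightarrow> (LINT p|area_measure. fst (classical_grad \<phi> p) * \<alpha> p) +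
       (LINT p|area_measure. snd (classical_grad \<phi> p) * \<beta> p) + (LINT p|area_measure. \<phi> p * P p)
       = (LINT y|side_measure. \<phi> (side_point j y) * Q y)"
  shows "(LINT p|area_measure. fst (weak_grad u p) * \<alpha> p) +
       (LINT p|area_measure. snd (weak_grad u p) * \<beta> p) + (LINT p|area_measure. u p * P p)
       = (LINT y|side_measure. t y * Q y)"
proof -
  obtain \<phi> where \<phi>: "\<And>n. smooth (\<phi> n)"
    and l0: "(\<lambda>n. L2_norm area_measure (\<lambda>p. \<phi> n p - u p)) \<longlonglongrightarrow> 0"
    and lg: "(\<lambda>n. L2_norm area_measure (\<lambda>p. classical_grad (\<phi> n) p - weak_grad u p)) \<longlonglongrightarrow> 0"
    and lt: "(\<lambda>n. L2_norm side_measure (\<lambda>y. \<phi> n (side_point j y) - t y)) \<longlonglongrightarrow> 0"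
    and u: "u \<in> H1" and t: "t \<in> L2 side_measure"
    using tr unfolding has_trace_def by blast
  have uL: "u \<in> L2 area_measure" using u by (simp add: H1_def)
  note W = weak_grad_spec(1)[OF u]
  note C = L2_classical_grad[OF \<phi>]
  have D: "(\<lambda>p. classical_grad (\<phi> n) p - weak_grad u p) \<in> L2 area_measure" for n
    by (rule L2_pairI) (simp_all add: L2_diff L2_pair C W)
  have l1: "(\<lambda>n. L2_norm area_measure (\<lambda>p. fst (classical_grad (\<phi> n) p) - fst (weak_grad u p))) \<longlonglongrightarrow> 0"
    using L2_norm_component_le(1)[OF D] by (intro tendsto_sandwich[OF _ _ tendsto_const lg]) (auto simp: L2_norm_nonneg)
  have l2: "(\<lambda>n. L2_norm area_measure (\<lambda>p. snd (classical_grad (\<phi> n) p) - snd (weak_grad u p))) \<longlonglongrightarrow> 0"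
    using L2_norm_component_le(2)[OF D] by (intro tendsto_sandwich[OF _ _ tendsto_const lg]) (auto simp: L2_norm_nonneg)
  have "(\<lambda>n. (LINT p|area_measure. fst (classical_grad (\<phi> n) p) * \<alpha> p) +
       (LINT p|area_measure. snd (classical_grad (\<phi> n) p) * \<beta> p) + (LINT p|area_measure. \<phi> n p * P p))
     \<longlonglongrightarrow> (LINT p|area_measure. fst (weak_grad u p) * \<alpha> p) +
       (LINT p|area_measure. snd (weak_grad u p) * \<beta> p) + (LINT p|area_measure. u p * P p)"
    by (intro tendsto_add L2_integral_limit L2_pair C W \<alpha> \<beta> P uL L2_smooth \<phi> l0 l1 l2)
  moreover have "(\<lambda>n. LINT y|side_measure. \<phi> n (side_point j y) * Q y) \<longlonglongrightarrow> (LINT y|side_measure. t y * Q y)"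
    by (intro L2_integral_limit L2_smooth_side \<phi> t Q lt)
  ultimately show ?thesis
    unfolding id[OF \<phi>] by (rule LIMSEQ_unique)
qed

lemma d1_mult:
  assumes "smooth1 f" "smooth1 g"
  shows "d1 (\<lambda>x. f x * g x) = (\<lambda>x. f x * d1 g x + d1 f x * g x)"
  by (intro d1_eq has_vector_derivative_mult smooth1_d1 assms)

lemma d1_of_real: "d1 complex_of_real = (\<lambda>x. 1)"
  by (rule d1_eq) (use has_vector_derivative_of_real[OF DERIV_ident[of "at _"]] in simp)

lemma d1_one_minus: "d1 (\<lambda>x. 1 - complex_of_real x) = (\<lambda>x. -1)"
proof (rule d1_eq)
  fix x :: real
  have "((\<lambda>x. 1 - x) has_real_derivative -1) (at x)"
    by (auto intro!: derivative_eq_intros)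
  from has_vector_derivative_of_real[OF this]
  show "((\<lambda>x. 1 - complex_of_real x) has_vector_derivative - 1) (at x)" by simp
qed

lemma smooth1_one_minus: "smooth1 (\<lambda>x. 1 - complex_of_real x)"
  by (intro smooth1_diff smooth1_const smooth1_id)

lemma green_smooth:
  assumes "smooth \<phi>" "smooth1 h" "smooth1 q"
  shows "(LINT p|area_measure. fst (classical_grad \<phi> p) * tensor h q p) + (LINT p|area_measure. \<phi> p * tensor (d1 h) q p)
      = (LINT y|side_measure. \<phi> (1, y) * (h 1 * q y) - \<phi> (0, y) * (h 0 * q y))"
    "(LINT p|area_measure. snd (classical_grad \<phi> p) * tensor h q p) + (LINT p|area_measure. \<phi> p * tensor h (d1 q) p)
      = (LINT x|side_measure. \<phi> (x, 1) * (h x * q 1) - \<phi> (x, 0) * (h x * q 0))"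
proof -
  obtain fx fy where f: "C1_plane \<phi> fx fy"
    using assms(1) by (rule C1_plane_smooth)
  note t = C1_plane_tensor[OF assms(2,3)]
  have i: "integrable area_measure (\<lambda>p. fx p * tensor h q p)" "integrable area_measure (\<lambda>p. fy p * tensor h q p)"
    "integrable area_measure (\<lambda>p. \<phi> p * tensor (d1 h) q p)" "integrable area_measure (\<lambda>p. \<phi> p * tensor h (d1 q) p)"
    by (simp_all add: L2_mult_integrable L2_area_continuous C1_planeD[OF f] C1_planeD[OF t]
        C1_plane_continuous[OF t] C1_plane_continuous[OF f])
  show "(LINT p|area_measure. fst (classical_grad \<phi> p) * tensor h q p) + (LINT p|area_measure. \<phi> p * tensor (d1 h) q p)
      = (LINT y|side_measure. \<phi> (1, y) * (h 1 * q y) - \<phi> (0, y) * (h 0 * q y))"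
    using divergence_square(1)[OF C1_plane_mult[OF f t]] i
    by (simp add: C1_plane_classical_grad[OF f] tensor_def)
  show "(LINT p|area_measure. snd (classical_grad \<phi> p) * tensor h q p) + (LINT p|area_measure. \<phi> p * tensor h (d1 q) p)
      = (LINT x|side_measure. \<phi> (x, 1) * (h x * q 1) - \<phi> (x, 0) * (h x * q 0))"
    using divergence_square(2)[OF C1_plane_mult[OF f t]] i
    by (simp add: C1_plane_classical_grad[OF f] tensor_def)
qed

lemma L2_smooth1: "smooth1 q \<Longrightarrow> q \<in> L2 side_measure"
  by (intro L2_side_continuous smooth1_continuous)

lemma L2_zero: "(\<lambda>x. 0::complex) \<in> L2 M"
  by (simp add: L2_def)

text \<open>The Green formula involves the traces on two opposite sides, hence two approximating
  sequences. The splitting \<open>h = x h + (1 - x) h\<close> separates them: the first summand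
  vanishes at \<open>x = 0\<close>, the second at \<open>x = 1\<close>, and each can be treated with
  a single trace.\<close>

lemma green_x:
  assumes t2: "has_trace Gamma2 u t2" and t4: "has_trace Gamma4 u t4" and h: "smooth1 h" and q: "smooth1 q"
  shows "(LINT p|area_measure. fst (weak_grad u p) * tensor h q p) =
     h 1 * (LINT y|side_measure. t2 y * q y) - h 0 * (LINT y|side_measure. t4 y * q y)
      - (LINT p|area_measure. u p * tensor (d1 h) q p)"
proof -
  define ha hb where "ha = (\<lambda>x. complex_of_real x * h x)" and "hb = (\<lambda>x. (1 - complex_of_real x) * h x)"
  have ha: "smooth1 ha" and hb: "smooth1 hb"
    unfolding ha_def hb_def by (intro smooth1_mult smooth1_id smooth1_one_minus h)+
  have u: "u \<in> H1" using t2 by (simp add: has_trace_def)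
  have uL: "u \<in> L2 area_measure" using u by (simp add: H1_def)
  note W = L2_pair[OF weak_grad_spec(1)[OF u]]
  note t = L2_tensor[OF _ q]
  have Ia: "(LINT p|area_measure. fst (weak_grad u p) * tensor ha q p) + (LINT p|area_measure. snd (weak_grad u p) * 0) +
      (LINT p|area_measure. u p * tensor (d1 ha) q p) = (LINT y|side_measure. t2 y * (ha 1 * q y))"
  proof (rule has_trace_identity[OF t2])
    fix \<phi> assume "smooth \<phi>"
    from green_smooth(1)[OF this ha q]
    show "(LINT p|area_measure. fst (classical_grad \<phi> p) * tensor ha q p) + (LINT p|area_measure. snd (classical_grad \<phi> p) * 0) +
      (LINT p|area_measure. \<phi> p * tensor (d1 ha) q p) = (LINT y|side_measure. \<phi> (side_point Gamma2 y) * (ha 1 * q y))"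
      by (simp add: ha_def)
  qed (intro t ha smooth1_d1 L2_zero L2_cmult L2_smooth1 q)+
  have Ib: "(LINT p|area_measure. fst (weak_grad u p) * tensor hb q p) + (LINT p|area_measure. snd (weak_grad u p) * 0) +
      (LINT p|area_measure. u p * tensor (d1 hb) q p) = (LINT y|side_measure. t4 y * (- hb 0 * q y))"
  proof (rule has_trace_identity[OF t4])
    fix \<phi> assume "smooth \<phi>"
    from green_smooth(1)[OF this hb q]
    show "(LINT p|area_measure. fst (classical_grad \<phi> p) * tensor hb q p) + (LINT p|area_measure. snd (classical_grad \<phi> p) * 0) +
      (LINT p|area_measure. \<phi> p * tensor (d1 hb) q p) = (LINT y|side_measure. \<phi> (side_point Gamma4 y) * (- hb 0 * q y))"
      by (simp add: hb_def)
  qed (intro t hb smooth1_d1 L2_zero L2_cmult L2_smooth1 q)+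
  have "tensor h q p = tensor ha q p + tensor hb q p" for p
    by (simp add: tensor_def ha_def hb_def algebra_simps)
  then have sp: "(LINT p|area_measure. fst (weak_grad u p) * tensor h q p) =
      (LINT p|area_measure. fst (weak_grad u p) * tensor ha q p) + (LINT p|area_measure. fst (weak_grad u p) * tensor hb q p)"
    using L2_mult_integrable[OF W(1) t[OF ha]] L2_mult_integrable[OF W(1) t[OF hb]] by (simp add: distrib_left)
  have "d1 ha = (\<lambda>x. complex_of_real x * d1 h x + 1 * h x)"
    unfolding ha_def d1_mult[OF smooth1_id h] d1_of_real ..
  moreover have "d1 hb = (\<lambda>x. (1 - complex_of_real x) * d1 h x + (-1) * h x)"
    unfolding hb_def d1_mult[OF smooth1_one_minus h] d1_one_minus ..
  ultimately have "tensor (d1 h) q p = tensor (d1 ha) q p + tensor (d1 hb) q p" for p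
    by (simp add: tensor_def algebra_simps)
  then have sd: "(LINT p|area_measure. u p * tensor (d1 h) q p) =
      (LINT p|area_measure. u p * tensor (d1 ha) q p) + (LINT p|area_measure. u p * tensor (d1 hb) q p)"
    using L2_mult_integrable[OF uL t[OF smooth1_d1(2)[OF ha]]] L2_mult_integrable[OF uL t[OF smooth1_d1(2)[OF hb]]]
    by (simp add: distrib_left)
  have "ha 1 = h 1" "hb 0 = h 0" by (simp_all add: ha_def hb_def)
  moreover have "(LINT y|side_measure. t2 y * (c * q y)) = c * (LINT y|side_measure. t2 y * q y)"
    "(LINT y|side_measure. t4 y * (c * q y)) = c * (LINT y|side_measure. t4 y * q y)" for c
    by (simp_all add: mult.left_commute[of _ c] del: mult_cancel_left)
  ultimately have "(LINT p|area_measure. fst (weak_grad u p) * tensor ha q p) =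
      h 1 * (LINT y|side_measure. t2 y * q y) - (LINT p|area_measure. u p * tensor (d1 ha) q p)"
    "(LINT p|area_measure. fst (weak_grad u p) * tensor hb q p) =
      - h 0 * (LINT y|side_measure. t4 y * q y) - (LINT p|area_measure. u p * tensor (d1 hb) q p)"
    using Ia Ib unfolding eq_diff_eq by simp_all
  then show ?thesis
    unfolding sp sd by simp
qed

text \<open>The same splitting, now of the factor that depends on \<open>y\<close>.\<close>

lemma green_y:
  assumes t3: "has_trace Gamma3 u t3" and t1: "has_trace Gamma1 u t1" and h: "smooth1 h" and q: "smooth1 q"
  shows "(LINT p|area_measure. snd (weak_grad u p) * tensor h q p) =
     q 1 * (LINT x|side_measure. t3 x * h x) - q 0 * (LINT x|side_measure. t1 x * h x)
      - (LINT p|area_measure. u p * tensor h (d1 q) p)"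
proof -
  define qa qb where "qa = (\<lambda>x. complex_of_real x * q x)" and "qb = (\<lambda>x. (1 - complex_of_real x) * q x)"
  have qa: "smooth1 qa" and qb: "smooth1 qb"
    unfolding qa_def qb_def by (intro smooth1_mult smooth1_id smooth1_one_minus q)+
  have u: "u \<in> H1" using t1 by (simp add: has_trace_def)
  have uL: "u \<in> L2 area_measure" using u by (simp add: H1_def)
  note W = L2_pair[OF weak_grad_spec(1)[OF u]]
  note t = L2_tensor[OF h]
  have Ia: "(LINT p|area_measure. fst (weak_grad u p) * 0) + (LINT p|area_measure. snd (weak_grad u p) * tensor h qa p) +
      (LINT p|area_measure. u p * tensor h (d1 qa) p) = (LINT x|side_measure. t3 x * (qa 1 * h x))"
  proof (rule has_trace_identity[OF t3])
    fix \<phi> assume "smooth \<phi>"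
    from green_smooth(2)[OF this h qa]
    show "(LINT p|area_measure. fst (classical_grad \<phi> p) * 0) + (LINT p|area_measure. snd (classical_grad \<phi> p) * tensor h qa p) +
      (LINT p|area_measure. \<phi> p * tensor h (d1 qa) p) = (LINT x|side_measure. \<phi> (side_point Gamma3 x) * (qa 1 * h x))"
      by (simp add: qa_def mult.commute)
  qed (intro t qa smooth1_d1 L2_zero L2_cmult L2_smooth1 h)+
  have Ib: "(LINT p|area_measure. fst (weak_grad u p) * 0) + (LINT p|area_measure. snd (weak_grad u p) * tensor h qb p) +
      (LINT p|area_measure. u p * tensor h (d1 qb) p) = (LINT x|side_measure. t1 x * (- qb 0 * h x))"
  proof (rule has_trace_identity[OF t1])
    fix \<phi> assume "smooth \<phi>"
    from green_smooth(2)[OF this h qb]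
    show "(LINT p|area_measure. fst (classical_grad \<phi> p) * 0) + (LINT p|area_measure. snd (classical_grad \<phi> p) * tensor h qb p) +
      (LINT p|area_measure. \<phi> p * tensor h (d1 qb) p) = (LINT x|side_measure. \<phi> (side_point Gamma1 x) * (- qb 0 * h x))"
      by (simp add: qb_def mult.commute)
  qed (intro t qb smooth1_d1 L2_zero L2_cmult L2_smooth1 h)+
  have "tensor h q p = tensor h qa p + tensor h qb p" for p
    by (simp add: tensor_def qa_def qb_def algebra_simps)
  then have sp: "(LINT p|area_measure. snd (weak_grad u p) * tensor h q p) =
      (LINT p|area_measure. snd (weak_grad u p) * tensor h qa p) + (LINT p|area_measure. snd (weak_grad u p) * tensor h qb p)"
    using L2_mult_integrable[OF W(2) t[OF qa]] L2_mult_integrable[OF W(2) t[OF qb]] by (simp add: distrib_left)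
  have "d1 qa = (\<lambda>x. complex_of_real x * d1 q x + 1 * q x)"
    unfolding qa_def d1_mult[OF smooth1_id q] d1_of_real ..
  moreover have "d1 qb = (\<lambda>x. (1 - complex_of_real x) * d1 q x + (-1) * q x)"
    unfolding qb_def d1_mult[OF smooth1_one_minus q] d1_one_minus ..
  ultimately have "tensor h (d1 q) p = tensor h (d1 qa) p + tensor h (d1 qb) p" for p
    by (simp add: tensor_def algebra_simps)
  then have sd: "(LINT p|area_measure. u p * tensor h (d1 q) p) =
      (LINT p|area_measure. u p * tensor h (d1 qa) p) + (LINT p|area_measure. u p * tensor h (d1 qb) p)"
    using L2_mult_integrable[OF uL t[OF smooth1_d1(2)[OF qa]]] L2_mult_integrable[OF uL t[OF smooth1_d1(2)[OF qb]]]
    by (simp add: distrib_left)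
  have "qa 1 = q 1" "qb 0 = q 0" by (simp_all add: qa_def qb_def)
  moreover have "(LINT y|side_measure. t3 y * (c * h y)) = c * (LINT y|side_measure. t3 y * h y)"
    "(LINT y|side_measure. t1 y * (c * h y)) = c * (LINT y|side_measure. t1 y * h y)" for c
    by (simp_all add: mult.left_commute[of _ c] del: mult_cancel_left)
  ultimately have "(LINT p|area_measure. snd (weak_grad u p) * tensor h qa p) =
      q 1 * (LINT y|side_measure. t3 y * h y) - (LINT p|area_measure. u p * tensor h (d1 qa) p)"
    "(LINT p|area_measure. snd (weak_grad u p) * tensor h qb p) =
      - q 0 * (LINT y|side_measure. t1 y * h y) - (LINT p|area_measure. u p * tensor h (d1 qb) p)"
    using Ia Ib unfolding eq_diff_eq by simp_all
  then show ?thesis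
    unfolding sp sd by simp
qed


section \<open>Parseval identity and the mode equation\<close>

lemma L2_norm_cnj: "L2_norm M (\<lambda>x. cnj (f x)) = L2_norm M f"
  by (simp add: L2_norm_def)

lemma L2_sum:
  assumes "\<And>n. n \<in> A \<Longrightarrow> (f n :: 'a \<Rightarrow> complex) \<in> L2 M"
  shows "(\<lambda>x. \<Sum>n\<in>A. f n x) \<in> L2 M"
  using assms by (induction A rule: infinite_finite_induct) (simp_all add: L2_zero L2_add)

lemma L2_pythagoras:
  fixes f w :: "'a \<Rightarrow> complex"
  assumes f: "f \<in> L2 M" and w: "w \<in> L2 M"
    and o: "(LINT x|M. (f x - w x) * cnj (w x)) = 0"
  shows "(L2_norm M f)\<^sup>2 = (L2_norm M w)\<^sup>2 + (L2_norm M (\<lambda>x. f x - w x))\<^sup>2"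
proof -
  define r where "r x = f x - w x" for x
  have r: "r \<in> L2 M" unfolding r_def by (rule L2_diff[OF f w])
  have o1: "(LINT x|M. r x * cnj (w x)) = 0" using o by (simp add: r_def)
  have "(LINT x|M. w x * cnj (r x)) = (LINT x|M. cnj (r x * cnj (w x)))" by (simp add: mult.commute)
  also have "\<dots> = cnj (LINT x|M. r x * cnj (w x))" by (rule Bochner_Integration.integral_cnj)
  also have "\<dots> = 0" unfolding o1 by simp
  finally have o2: "(LINT x|M. w x * cnj (r x)) = 0" .
  have e: "f x * cnj (f x) = (r x * cnj (r x) + r x * cnj (w x)) + (w x * cnj (r x) + w x * cnj (w x))" for x
    by (simp add: r_def algebra_simps)
  have "(LINT x|M. f x * cnj (f x)) = (LINT x|M. r x * cnj (r x)) + (LINT x|M. w x * cnj (w x))"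
    unfolding e using o1 o2 by (simp add: L2_mult_integrable r w L2_cnj del: mult_cancel_left)
  then have "complex_of_real ((L2_norm M f)\<^sup>2) = complex_of_real ((L2_norm M r)\<^sup>2 + (L2_norm M w)\<^sup>2)"
    by (simp only: L2_norm_sq_complex f r w of_real_add)
  then have "(L2_norm M f)\<^sup>2 = (L2_norm M r)\<^sup>2 + (L2_norm M w)\<^sup>2"
    by (simp only: of_real_eq_iff)
  then show ?thesis by (simp add: r_def[abs_def])
qed

context mode_pair
begin

lemma mode_coefficient_of_sum:
  assumes F: "\<And>n. smooth1 (F n)" and h: "smooth1 h"
  shows "(LINT p|area_measure. (\<Sum>m<N. tensor (F m) (Y m) p) * tensor h (Y n) p) =
    (if n < N \<and> \<not> zero_mode b1 b3 n then (LINT x|side_measure. F n x * h x) else 0)"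
proof -
  have t: "tensor (F m) (Y m) p * tensor h (Y n) p = tensor (\<lambda>x. F m x * h x) (\<lambda>y. Y m y * Y n y) p" for m p
    by (simp add: tensor_def)
  have "(LINT p|area_measure. (\<Sum>m<N. tensor (F m) (Y m) p) * tensor h (Y n) p) =
     (\<Sum>m<N. LINT p|area_measure. tensor (F m) (Y m) p * tensor h (Y n) p)"
    unfolding sum_distrib_right
    by (intro Bochner_Integration.integral_sum L2_mult_integrable L2_tensor F h smooth1_Y)
  also have "\<dots> = (\<Sum>m<N. (LINT x|side_measure. F m x * h x) * (LINT y|side_measure. Y m y * Y n y))"
    unfolding t by (intro sum.cong refl integral_tensor smooth1_mult F h smooth1_Y)
  also have "\<dots> = (\<Sum>m<N. if m = n then (if zero_mode b1 b3 n then 0 else (LINT x|side_measure. F n x * h x)) else 0)"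
    unfolding cmode_orthonormal[OF b1 b3] by (intro sum.cong) auto
  also have "\<dots> = (if n < N \<and> \<not> zero_mode b1 b3 n then (LINT x|side_measure. F n x * h x) else 0)"
    by (subst sum.delta) auto
  finally show ?thesis .
qed

lemma cnj_tensor: "cnj (tensor h (Y n) p) = tensor (\<lambda>x. cnj (h x)) (Y n) p"
  by (simp add: tensor_def)

text \<open>The coefficients \<open>F n\<close> are given only in duality with smooth functions. The
  remainder after \<open>N\<close> terms is orthogonal to all earlier modes with arbitrary smooth
  coefficients; it is therefore no larger than the distance of \<open>f\<close> to any mode sum,
  once \<open>N\<close> exceeds the indices occurring in that sum. Density of mode sums among
  continuous functions, combined with \<open>approx\<close>, makes this distance small.\<close>

lemma parseval_modes:
  assumes f: "f \<in> L2 area_measure"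
    and approx: "\<And>e. e > 0 \<Longrightarrow> \<exists>\<phi>. continuous_on UNIV \<phi> \<and> L2_norm area_measure (\<lambda>p. f p - \<phi> p) < e"
    and F: "\<And>n. smooth1 (F n)"
    and coeff: "\<And>n h. smooth1 h \<Longrightarrow> (LINT p|area_measure. f p * tensor h (Y n) p) = (LINT x|side_measure. F n x * h x)"
  shows "(\<lambda>n. (L2_norm side_measure (F n))\<^sup>2) sums (L2_norm area_measure f)\<^sup>2"
proof -
  define W where "W N p = (\<Sum>n<N. tensor (F n) (Y n) p)" for N p
  have Ws: "mode_span (W N)" for N
    unfolding W_def[abs_def] by (rule mode_span_sum) (rule F)
  note W = L2_mode_span[OF Ws]
  have r: "(\<lambda>p. f p - W N p) \<in> L2 area_measure" for N
    by (rule L2_diff[OF f W])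
  have orth: "(LINT p|area_measure. (f p - W N p) * tensor h (Y n) p) = 0" if "n < N" "smooth1 h" for N n h
  proof -
    have "(LINT p|area_measure. (f p - W N p) * tensor h (Y n) p) =
        (LINT p|area_measure. f p * tensor h (Y n) p) - (LINT p|area_measure. W N p * tensor h (Y n) p)"
      using L2_mult_integrable[OF f L2_tensor[OF that(2) smooth1_Y]] L2_mult_integrable[OF W L2_tensor[OF that(2) smooth1_Y]]
      by (simp add: left_diff_distrib)
    also have "\<dots> = (LINT x|side_measure. F n x * h x) - (if \<not> zero_mode b1 b3 n then (LINT x|side_measure. F n x * h x) else 0)"
      unfolding W_def mode_coefficient_of_sum[OF F that(2)] using coeff[OF that(2)] that(1) by simp
    also have "\<dots> = 0"
    \<comment> \<open>For the placeholder mode the partial sum contributes nothing, but the pairing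
      of \<open>F n\<close> vanishes too, because \<open>coeff\<close> equates it with an integral
      against 0.\<close>
    proof (cases "zero_mode b1 b3 n")
      case True
      have "(LINT x|side_measure. F n x * h x) = 0"
        unfolding coeff[OF that(2), symmetric] by (simp add: tensor_def mode_zero_mode[OF True])
      then show ?thesis by simp
    qed simp
    finally show ?thesis .
  qed
  have orth_span: "\<exists>N0. \<forall>N\<ge>N0. (LINT p|area_measure. (f p - W N p) * cnj (V p)) = 0" if "mode_span V" for V
    using that
  proof induction
    case zero
    then show ?case by simp
  next
    case (step h V n)
    then obtain N0 where N0: "\<And>N. N \<ge> N0 \<Longrightarrow> (LINT p|area_measure. (f p - W N p) * cnj (V p)) = 0" by blast
    have "(LINT p|area_measure. (f p - W N p) * cnj (tensor h (Y n) p + V p)) = 0" if "N \<ge> max N0 (Suc n)" for N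
    proof -
      have "(LINT p|area_measure. (f p - W N p) * cnj (tensor h (Y n) p + V p)) =
         (LINT p|area_measure. (f p - W N p) * tensor (\<lambda>x. cnj (h x)) (Y n) p) + (LINT p|area_measure. (f p - W N p) * cnj (V p))"
        using L2_mult_integrable[OF r L2_tensor[OF smooth1_cnj[OF step.hyps(1)] smooth1_Y]]
          L2_mult_integrable[OF r L2_cnj[OF L2_mode_span[OF step.hyps(2)]]]
        by (simp add: distrib_left cnj_tensor del: mode.simps)
      then show ?thesis
        using orth[of n N, OF _ smooth1_cnj[OF step.hyps(1)]] N0[of N] that by simp
    qed
    then show ?case by blast
  qed
  have cW: "cnj (W N p) = (\<Sum>n<N. tensor (\<lambda>x. cnj (F n x)) (Y n) p)" for N p
    unfolding W_def cnj_sum cnj_tensor ..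
  have sum_int: "(LINT p|area_measure. k p * cnj (W N p)) = (\<Sum>n<N. LINT p|area_measure. k p * tensor (\<lambda>x. cnj (F n x)) (Y n) p)"
    if "k \<in> L2 area_measure" for k N
    unfolding cW sum_distrib_left
    by (intro Bochner_Integration.integral_sum L2_mult_integrable that L2_tensor smooth1_cnj F smooth1_Y)
  have orthW: "(LINT p|area_measure. (f p - W N p) * cnj (W N p)) = 0" for N
    unfolding sum_int[OF r] by (intro sum.neutral ballI orth smooth1_cnj F) simp
  have pyth: "(L2_norm area_measure f)\<^sup>2 = (L2_norm area_measure (W N))\<^sup>2 + (L2_norm area_measure (\<lambda>p. f p - W N p))\<^sup>2" for N
    by (rule L2_pythagoras[OF f W orthW])
  have normW: "(L2_norm area_measure (W N))\<^sup>2 = (\<Sum>n<N. (L2_norm side_measure (F n))\<^sup>2)" for N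
  proof -
    have "(LINT p|area_measure. f p * cnj (W N p)) - (LINT p|area_measure. W N p * cnj (W N p)) = 0"
      using orthW[of N] L2_mult_integrable[OF f L2_cnj[OF W]] L2_mult_integrable[OF W L2_cnj[OF W]]
      by (simp add: left_diff_distrib)
    then have "(LINT p|area_measure. W N p * cnj (W N p)) = (\<Sum>n<N. LINT x|side_measure. F n x * cnj (F n x))"
      unfolding sum_int[OF f] coeff[OF smooth1_cnj[OF F]] by simp
    then have "complex_of_real ((L2_norm area_measure (W N))\<^sup>2) = complex_of_real (\<Sum>n<N. (L2_norm side_measure (F n))\<^sup>2)"
      unfolding L2_norm_sq_complex[OF W] L2_norm_sq_complex[OF L2_smooth1[OF F]] of_real_sum .
    then show ?thesis by (simp only: of_real_eq_iff)
  qed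
  have "(\<lambda>N. L2_norm area_measure (\<lambda>p. f p - W N p)) \<longlonglongrightarrow> 0"
  proof (rule LIMSEQ_I)
    fix e :: real assume e: "0 < e"
    obtain \<phi> where \<phi>: "continuous_on UNIV \<phi>" "L2_norm area_measure (\<lambda>p. f p - \<phi> p) < e / 2"
      using approx[of "e / 2"] e by auto
    obtain V where V: "mode_span V" "L2_norm area_measure (\<lambda>p. \<phi> p - V p) < e / 2"
      using mode_span_dense[OF \<phi>(1), of "e / 2"] e by auto
    have fV: "L2_norm area_measure (\<lambda>p. f p - V p) < e"
      using L2_norm_triangle_diff[OF f L2_area_continuous[OF \<phi>(1)] L2_mode_span[OF V(1)]] \<phi>(2) V(2) by linarith
    obtain N0 where N0: "\<And>N. N \<ge> N0 \<Longrightarrow> (LINT p|area_measure. (f p - W N p) * cnj (V p)) = 0"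
      using orth_span[OF V(1)] by blast
    have "L2_norm area_measure (\<lambda>p. f p - W N p) < e" if "N \<ge> N0" for N
    proof -
      define R where "R p = f p - W N p" for p
      have R: "R \<in> L2 area_measure" unfolding R_def by (rule r)
      have z: "(LINT p|area_measure. R p * cnj (V p)) = 0" "(LINT p|area_measure. R p * cnj (W N p)) = 0"
        using N0[OF that] orthW by (simp_all add: R_def)
      \<comment> \<open>\<open>R\<close> is orthogonal to \<open>V\<close> and to
        \<open>W N\<close>, so its squared norm equals its pairing with \<open>f - V\<close>; this
        is the best approximation property.\<close>
      have e1: "R p * cnj (R p) = R p * cnj (f p - V p) + R p * cnj (V p) - R p * cnj (W N p)" for p
        by (simp add: R_def algebra_simps)
      have "(LINT p|area_measure. R p * cnj (R p)) = (LINT p|area_measure. R p * cnj (f p - V p))"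
        unfolding e1 using z L2_mult_integrable[OF R L2_cnj[OF L2_diff[OF f L2_mode_span[OF V(1)]]]]
          L2_mult_integrable[OF R L2_cnj[OF L2_mode_span[OF V(1)]]] L2_mult_integrable[OF R L2_cnj[OF W]]
        by (simp only: Bochner_Integration.integral_diff Bochner_Integration.integral_add Bochner_Integration.integrable_add) simp
      moreover have "cmod (LINT p|area_measure. R p * cnj (f p - V p)) \<le> L2_norm area_measure R * L2_norm area_measure (\<lambda>p. f p - V p)"
        using L2_cauchy_schwarz[OF R L2_cnj[OF L2_diff[OF f L2_mode_span[OF V(1)]]]] unfolding L2_norm_cnj .
      ultimately have "cmod (complex_of_real ((L2_norm area_measure R)\<^sup>2)) \<le> L2_norm area_measure R * L2_norm area_measure (\<lambda>p. f p - V p)"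
        unfolding L2_norm_sq_complex[OF R, symmetric] by simp
      then have "L2_norm area_measure R * L2_norm area_measure R \<le> L2_norm area_measure R * L2_norm area_measure (\<lambda>p. f p - V p)"
        by (simp add: power2_eq_square abs_mult norm_mult L2_norm_nonneg)
      then have "L2_norm area_measure R \<le> L2_norm area_measure (\<lambda>p. f p - V p)"
        using L2_norm_nonneg[of area_measure R] L2_norm_nonneg[of area_measure "\<lambda>p. f p - V p"]
        by (cases "L2_norm area_measure R = 0") auto
      with fV show ?thesis by (simp add: R_def[abs_def])
    qed
    then show "\<exists>no. \<forall>n\<ge>no. norm (L2_norm area_measure (\<lambda>p. f p - W n p) - 0) < e"
      by (auto simp: L2_norm_nonneg)
  qed
  from tendsto_diff[OF tendsto_const tendsto_power[OF this, of 2], of "(L2_norm area_measure f)\<^sup>2"]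
  have "(\<lambda>N. (L2_norm area_measure f)\<^sup>2 - (L2_norm area_measure (\<lambda>p. f p - W N p))\<^sup>2) \<longlonglongrightarrow> (L2_norm area_measure f)\<^sup>2"
    by simp
  moreover have "(L2_norm area_measure f)\<^sup>2 - (L2_norm area_measure (\<lambda>p. f p - W N p))\<^sup>2 = (\<Sum>n<N. (L2_norm side_measure (F n))\<^sup>2)" for N
    using pyth[of N] normW[of N] by simp
  ultimately show ?thesis
    unfolding sums_def by simp
qed

text \<open>The finite mode sum with the coefficients of \<open>g\<close> is the orthogonal
  projection of \<open>g\<close>, hence not longer than \<open>g\<close>. An inequality is enough,
  since the datum occurs only on the larger side of the estimates.\<close>

lemma bessel_modes:
  assumes g: "g \<in> L2 side_measure"
  shows "(\<Sum>n<N. (cmod (mode_coeff b1 b3 g n))\<^sup>2) \<le> (L2_norm side_measure g)\<^sup>2"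
proof -
  define c where "c n = mode_coeff b1 b3 g n" for n
  define W where "W y = (\<Sum>n<N. c n * Y n y)" for y
  note YL = L2_smooth1[OF smooth1_Y]
  have W: "W \<in> L2 side_measure"
    unfolding W_def by (intro L2_sum L2_cmult YL)
  have r: "(\<lambda>y. g y - W y) \<in> L2 side_measure" by (rule L2_diff[OF g W])
  have cW: "cnj (W y) = (\<Sum>n<N. cnj (c n) * Y n y)" for y
    unfolding W_def cnj_sum complex_cnj_mult complex_cnj_complex_of_real ..
  have WY: "(LINT y|side_measure. W y * Y n y) = c n" if "n < N" for n
  proof -
    have "(LINT y|side_measure. W y * Y n y) = (\<Sum>m<N. LINT y|side_measure. (c m * Y m y) * Y n y)"
      unfolding W_def sum_distrib_right
      by (intro Bochner_Integration.integral_sum L2_mult_integrable L2_cmult YL)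
    also have "\<dots> = (\<Sum>m<N. c m * (LINT y|side_measure. Y m y * Y n y))"
      unfolding mult.assoc by (intro sum.cong refl integral_mult_right_zero)
    also have "\<dots> = (\<Sum>m<N. if m = n then (if zero_mode b1 b3 n then 0 else c n) else 0)"
      unfolding cmode_orthonormal[OF b1 b3] by (intro sum.cong) auto
    also have "\<dots> = (if zero_mode b1 b3 n then 0 else c n)"
      using that by (subst sum.delta) auto
    also have "\<dots> = c n"
      by (auto simp: c_def mode_coeff_def mode_zero_mode)
    finally show ?thesis .
  qed
  have si: "(LINT y|side_measure. k y * cnj (W y)) = (\<Sum>n<N. cnj (c n) * (LINT y|side_measure. k y * Y n y))"
    if k: "k \<in> L2 side_measure" for k
  proof -
    have "(LINT y|side_measure. k y * cnj (W y)) = (\<Sum>n<N. LINT y|side_measure. k y * (cnj (c n) * Y n y))"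
      unfolding cW sum_distrib_left
      by (intro Bochner_Integration.integral_sum L2_mult_integrable k L2_cmult YL)
    also have "\<dots> = (\<Sum>n<N. cnj (c n) * (LINT y|side_measure. k y * Y n y))"
      unfolding mult.left_commute[of "k _"] by (intro sum.cong refl integral_mult_right_zero)
    finally show ?thesis .
  qed
  have cg: "(LINT y|side_measure. g y * Y n y) = c n" for n
    by (simp add: c_def mode_coeff_def)
  have eq: "(LINT y|side_measure. g y * cnj (W y)) = (LINT y|side_measure. W y * cnj (W y))"
    unfolding si[OF g] si[OF W] cg by (intro sum.cong refl) (simp add: WY)
  have "(LINT y|side_measure. (g y - W y) * cnj (W y)) = 0"
    using eq L2_mult_integrable[OF g L2_cnj[OF W]] L2_mult_integrable[OF W L2_cnj[OF W]]
    by (simp add: left_diff_distrib)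
  from L2_pythagoras[OF g W this] have "(L2_norm side_measure W)\<^sup>2 \<le> (L2_norm side_measure g)\<^sup>2"
    by simp
  moreover have "complex_of_real ((L2_norm side_measure W)\<^sup>2) = complex_of_real (\<Sum>n<N. (cmod (c n))\<^sup>2)"
    unfolding L2_norm_sq_complex[OF W, symmetric] eq[symmetric] si[OF g] cg of_real_sum complex_norm_square
    by (intro sum.cong refl) (simp add: complex_norm_square mult.commute)
  ultimately show ?thesis
    by (simp only: of_real_eq_iff c_def)
qed

end

section \<open>The fundamental system of w'' + l w = 0\<close>

definition ode_s :: "real \<Rightarrow> real \<Rightarrow> real" where
  "ode_s l x = (if l > 0 then sin (sqrt l * x) / sqrt l else if l < 0 then sinh (sqrt (- l) * x) / sqrt (- l) else x)"

text \<open>Together with \<open>ode_s\<close> these are the real branches of cos(sqrt l x) and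
  sin(sqrt l x) / sqrt l. At \<open>l = 0\<close> the hyperbolic branch gives the required value
  1.\<close>

definition ode_c :: "real \<Rightarrow> real \<Rightarrow> real" where
  "ode_c l x = (if l > 0 then cos (sqrt l * x) else cosh (sqrt (- l) * x))"

lemma ode_0: "ode_s l 0 = 0" "ode_c l 0 = 1"
  by (simp_all add: ode_s_def ode_c_def)

lemma ode_pythagoras: "(ode_c l x)\<^sup>2 + l * (ode_s l x)\<^sup>2 = 1"
proof -
  consider "l > 0" | "l < 0" | "l = 0" by linarith
  then show ?thesis
  proof cases
    case 2
    then show ?thesis
      using cosh_square_eq[of "sqrt (- l) * x"] by (simp add: ode_s_def ode_c_def power_divide)
  qed (simp_all add: ode_s_def ode_c_def power_divide)
qed

lemma ode_deriv:
  "(ode_s l has_real_derivative ode_c l x) (at x)"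
  "(ode_c l has_real_derivative - l * ode_s l x) (at x)"
proof -
  consider "l > 0" | "l < 0" | "l = 0" by linarith
  then have "(ode_s l has_real_derivative ode_c l x) (at x) \<and> (ode_c l has_real_derivative - l * ode_s l x) (at x)"
  proof cases
    case 1
    define r where "r = sqrt l"
    have r: "r > 0" "l = r * r" using 1 by (simp_all add: r_def)
    have "ode_s l = (\<lambda>x. sin (r * x) / r)" "ode_c l = (\<lambda>x. cos (r * x))"
      using 1 by (auto simp: ode_s_def ode_c_def r_def)
    then show ?thesis
      using r by (auto intro!: derivative_eq_intros)
  next
    case 2
    define r where "r = sqrt (- l)"
    have r: "r > 0" "- l = r * r" using 2 by (simp_all add: r_def)
    have e: "ode_s l = (\<lambda>x. sinh (r * x) / r)" "ode_c l = (\<lambda>x. cosh (r * x))"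
      using 2 by (auto simp: ode_s_def ode_c_def r_def)
    have "((\<lambda>x. cosh (r * x)) has_real_derivative (r * r) * (sinh (r * x) / r)) (at x)"
      using r(1) by (auto intro!: derivative_eq_intros)
    moreover have "((\<lambda>x. sinh (r * x) / r) has_real_derivative cosh (r * x)) (at x)"
      using r(1) by (auto intro!: derivative_eq_intros)
    ultimately show ?thesis
      unfolding e r(2) by simp
  next
    case 3
    then show ?thesis unfolding ode_s_def[abs_def] ode_c_def[abs_def]
      by (auto intro!: derivative_eq_intros)
  qed
  then show "(ode_s l has_real_derivative ode_c l x) (at x)"
    "(ode_c l has_real_derivative - l * ode_s l x) (at x)" by auto
qed

abbreviation cs :: "real \<Rightarrow> real \<Rightarrow> complex" where "cs l x \<equiv> complex_of_real (ode_s l x)"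
abbreviation cc :: "real \<Rightarrow> real \<Rightarrow> complex" where "cc l x \<equiv> complex_of_real (ode_c l x)"

lemma ode_vector_deriv:
  "(cs l has_vector_derivative cc l x) (at x)"
  "(cc l has_vector_derivative complex_of_real (- l) * cs l x) (at x)"
  using has_vector_derivative_of_real[OF ode_deriv(1)] has_vector_derivative_of_real[OF ode_deriv(2)] by simp_all

lemma smooth1_ode: "smooth1 (cs l)" "smooth1 (cc l)"
proof -
  have "Cn n (cs l) \<and> Cn n (cc l)" for n
  proof (induction n)
    case 0
    show ?case
      unfolding Cn.simps
      by (intro conjI continuous_at_imp_continuous_on ballI has_vector_derivative_continuous[OF ode_vector_deriv(1)]
          has_vector_derivative_continuous[OF ode_vector_deriv(2)])
  next
    case (Suc n)
    then show ?case
      unfolding Cn.simps using ode_vector_deriv Cn_mult[OF Cn_const, of n "cs l" "complex_of_real (- l)"]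
      by (intro conjI exI[of _ "cc l"] exI[of _ "\<lambda>x. complex_of_real (- l) * cs l x"]) auto
  qed
  then show "smooth1 (cs l)" "smooth1 (cc l)" by (auto simp: smooth1_def)
qed

lemma d1_ode: "d1 (cs l) = cc l" "d1 (cc l) = (\<lambda>x. complex_of_real (- l) * cs l x)"
  by (intro d1_eq ode_vector_deriv)+

lemma antiderivative_exists:
  assumes "smooth1 f"
  obtains A where "smooth1 A" "d1 A = f"
proof -
  have "\<exists>F. \<forall>x::real. -\<infinity> < ereal x \<longrightarrow> ereal x < \<infinity> \<longrightarrow> (F has_vector_derivative f x) (at x)"
    using smooth1_continuous[OF assms, of UNIV]
    by (intro einterval_antiderivative) (auto simp: continuous_on_eq_continuous_at)
  then obtain F where F: "\<And>x. (F has_vector_derivative f x) (at x)" by auto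
  show ?thesis
    by (rule that[of F]) (use smooth1_antiderivative[OF F assms] d1_eq[OF F] in auto)
qed

lemma d1_add:
  assumes "smooth1 f" "smooth1 g"
  shows "d1 (\<lambda>x. f x + g x) = (\<lambda>x. d1 f x + d1 g x)"
  by (intro d1_eq has_vector_derivative_add smooth1_d1 assms)

lemma d1_diff:
  assumes "smooth1 f" "smooth1 g"
  shows "d1 (\<lambda>x. f x - g x) = (\<lambda>x. d1 f x - d1 g x)"
  by (intro d1_eq has_vector_derivative_diff smooth1_d1 assms)

lemma d1_const: "d1 (\<lambda>x. c) = (\<lambda>x. 0)"
  by (intro d1_eq has_vector_derivative_const)

lemma d1_cmult:
  assumes "smooth1 f"
  shows "d1 (\<lambda>x. c * f x) = (\<lambda>x. c * d1 f x)"
  using d1_mult[OF smooth1_const assms, of c] by (simp add: d1_const)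

text \<open>Variation of constants, started at the right end of the interval.\<close>

lemma ode_solvable:
  assumes h: "smooth1 h"
  obtains w where "smooth1 w" "w 1 = 0" "d1 w 1 = 0" "\<And>x. d1 (d1 w) x + complex_of_real l * w x = h x"
proof -
  obtain A where A: "smooth1 A" "d1 A = (\<lambda>x. cs l x * h x)"
    using antiderivative_exists[OF smooth1_mult[OF smooth1_ode(1) h]] .
  obtain B where B: "smooth1 B" "d1 B = (\<lambda>x. cc l x * h x)"
    using antiderivative_exists[OF smooth1_mult[OF smooth1_ode(2) h]] .
  define a b where "a x = A x - A 1" and "b x = B x - B 1" for x
  have a: "smooth1 a" "d1 a = (\<lambda>x. cs l x * h x)"
    unfolding a_def[abs_def] using A by (auto intro: smooth1_diff smooth1_const simp: d1_diff smooth1_const d1_const)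
  have b: "smooth1 b" "d1 b = (\<lambda>x. cc l x * h x)"
    unfolding b_def[abs_def] using B by (auto intro: smooth1_diff smooth1_const simp: d1_diff smooth1_const d1_const)
  note [simp] = d1_mult d1_diff d1_add d1_cmult d1_ode a b smooth1_ode smooth1_mult smooth1_diff smooth1_add smooth1_cmult
  define w where "w x = cs l x * b x - cc l x * a x" for x
  have sw: "smooth1 w" unfolding w_def[abs_def] by simp
  have d1w: "d1 w = (\<lambda>x. cc l x * b x + complex_of_real l * (cs l x * a x))"
    unfolding w_def[abs_def] by (simp add: fun_eq_iff algebra_simps)
  have "d1 (d1 w) x + complex_of_real l * w x = h x" for x
  proof -
    have "d1 (d1 w) x + complex_of_real l * w x = (cc l x * cc l x + complex_of_real l * (cs l x * cs l x)) * h x"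
      unfolding d1w by (simp add: w_def algebra_simps)
    also have "cc l x * cc l x + complex_of_real l * (cs l x * cs l x) = complex_of_real ((ode_c l x)\<^sup>2 + l * (ode_s l x)\<^sup>2)"
      by (simp add: power2_eq_square)
    finally show ?thesis by (simp add: ode_pythagoras)
  qed
  moreover have "w 1 = 0" "d1 w 1 = 0"
    unfolding d1w by (simp_all add: w_def a_def b_def)
  ultimately show ?thesis using sw that by blast
qed


section \<open>Separation of variables for the weak solution\<close>

lemma integral_d1:
  assumes "smooth1 f"
  shows "(LINT x|side_measure. d1 f x) = f 1 - f 0"
proof -
  have "integral {0..1} (d1 f) = f 1 - f 0"
    by (rule integral_unique, rule fundamental_theorem_of_calculus)
       (simp_all add: has_vector_derivative_at_within[OF smooth1_d1(1)[OF assms]])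
  then show ?thesis
    using integral_side_continuous(2)[OF smooth1_continuous[OF smooth1_d1(2)[OF assms]]] by simp
qed

lemma sum_sides: "(\<Sum>j | P j. f j) = (if P Gamma1 then f Gamma1 else 0) + (if P Gamma2 then f Gamma2 else 0)
     + (if P Gamma3 then f Gamma3 else 0) + (if P Gamma4 then f Gamma4 else (0::complex))"
proof -
  have U: "(UNIV :: side set) = {Gamma1, Gamma2, Gamma3, Gamma4}"
    using side.exhaust by auto
  have fin: "finite (UNIV :: side set)" unfolding U by simp
  have "(\<Sum>j | P j. f j) = (\<Sum>j\<in>UNIV. if P j then f j else 0)"
    using sum.inter_filter[OF fin, of f P] by simp
  then show ?thesis unfolding U by (simp add: add.assoc)
qed

lemma d1_cnj:
  assumes "smooth1 f"
  shows "d1 (\<lambda>x. cnj (f x)) = (\<lambda>x. cnj (d1 f x))"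
  by (intro d1_eq has_vector_derivative_cnj smooth1_d1 assms)

text \<open>The traces whose existence \<open>weak_solution\<close> asserts are fixed as
  \<open>\<gamma>\<close>, so that their mode coefficients can be named.\<close>

locale helmholtz =
  fixes k :: real and B :: "side \<Rightarrow> bc" and g :: "side \<Rightarrow> real \<Rightarrow> complex"
    and u :: "real \<times> real \<Rightarrow> complex" and \<gamma> :: "side \<Rightarrow> real \<Rightarrow> complex"
  assumes k: "k > 0"
    and B1: "B Gamma1 \<in> {Dirichlet, Neumann}" and B3: "B Gamma3 \<in> {Dirichlet, Neumann}"
    and B4: "B Gamma4 = Impedance"
    and g1: "g Gamma1 = (\<lambda>_. 0)" and g3: "g Gamma3 = (\<lambda>_. 0)" and g4: "g Gamma4 = (\<lambda>_. 0)"
    and g2: "g Gamma2 \<in> L2 side_measure"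
    and u_H1: "u \<in> H1"
    and dir: "\<And>j. B j = Dirichlet \<Longrightarrow> has_trace j u (g j)"
    and tr: "\<And>j. has_trace j u (\<gamma> j)"
    and weak: "\<And>v \<gamma>v. v \<in> energy_space B \<Longrightarrow> (\<And>j. has_trace j v (\<gamma>v j)) \<Longrightarrow>
         (LINT p|area_measure.
            fst (weak_grad u p) * cnj (fst (weak_grad v p)) +
            snd (weak_grad u p) * cnj (snd (weak_grad v p)) -
            (complex_of_real k)\<^sup>2 * u p * cnj (v p)) -
         \<i> * complex_of_real k *
           (\<Sum>j | B j = Impedance. LINT y|side_measure. \<gamma> j y * cnj (\<gamma>v j y)) =
         (\<Sum>j | B j = Impedance. LINT y|side_measure. g j y * cnj (\<gamma>v j y)) +
         (\<Sum>j | B j = Neumann. LINT y|side_measure. g j y * cnj (\<gamma>v j y))"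

sublocale helmholtz \<subseteq> mode_pair "B Gamma1" "B Gamma3"
  using B1 B3 by unfold_locales

sublocale helmholtz \<subseteq> dual: mode_pair "dual_bc (B Gamma1)" "dual_bc (B Gamma3)"
  using B1 B3 by unfold_locales (auto intro: dual_bc_mem)

context helmholtz
begin

abbreviation Gx :: "real \<times> real \<Rightarrow> complex" where "Gx p \<equiv> fst (weak_grad u p)"
abbreviation Gy :: "real \<times> real \<Rightarrow> complex" where "Gy p \<equiv> snd (weak_grad u p)"

abbreviation fr :: "nat \<Rightarrow> real" where "fr n \<equiv> freq (B Gamma1) (B Gamma3) n"

definition sg :: real where "sg = dir_sign (B Gamma1)"

lemma sg_sq: "sg * sg = 1"
  by (simp add: sg_def dir_sign_def)

lemma u_L2: "u \<in> L2 area_measure"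
  using u_H1 by (simp add: H1_def)

lemmas G_L2 = weak_grad_spec(1)[OF u_H1]
lemmas Gx_L2 = L2_pair(1)[OF G_L2] and Gy_L2 = L2_pair(2)[OF G_L2]

lemma d1_Y: "d1 (Y n) = (\<lambda>y. complex_of_real (sg * fr n) * dual.Y n y)"
  unfolding sg_def by (rule d1_cmode[OF B1 B3])

lemma d1_dual_Y: "d1 (dual.Y n) = (\<lambda>y. complex_of_real (- sg * fr n) * Y n y)"
proof -
  have "dual_bc (dual_bc (B Gamma1)) = B Gamma1" "dual_bc (dual_bc (B Gamma3)) = B Gamma3"
    "dir_sign (dual_bc (B Gamma1)) = - sg"
    using B1 B3 by (auto simp: sg_def dir_sign_def)
  then show ?thesis
    using d1_cmode[OF dual.b1 dual.b3, of n] freq_dual[OF B1 B3, of n] by simp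
qed

text \<open>On a Dirichlet side both the datum and \<open>\<gamma> Gamma2\<close> are traces of
  \<open>u\<close>. Taking the datum itself makes the end value of each mode the coefficient of
  \<open>g Gamma2\<close>.\<close>

definition t2 :: "real \<Rightarrow> complex" where
  "t2 = (if B Gamma2 = Dirichlet then g Gamma2 else \<gamma> Gamma2)"

lemma trace2: "has_trace Gamma2 u t2"
  using dir tr by (simp add: t2_def)

text \<open>On the horizontal sides the mode supplies the Dirichlet condition, on
  \<open>Gamma2\<close> the factor \<open>w\<close> does; \<open>Gamma4\<close> carries an impedance
  condition.\<close>

lemma energy_test:
  assumes w: "smooth1 w" and d: "B Gamma2 = Dirichlet \<Longrightarrow> w 1 = 0"
  shows "tensor w (Y n) \<in> energy_space B"
proof -
  have s: "smooth (tensor w (Y n))" by (rule smooth_tensor[OF w smooth1_Y])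
  have "has_trace j (tensor w (Y n)) (\<lambda>_. 0)" if j: "B j = Dirichlet" for j
  proof -
    have "tensor w (Y n) (side_point j t) = 0" for t
    proof (cases j)
      case Gamma1
      then show ?thesis using j mode_boundary(1)[OF B1 B3] by (simp add: tensor_def)
    next
      case Gamma2
      then show ?thesis using j d by (simp add: tensor_def)
    next
      case Gamma3
      then show ?thesis using j mode_boundary(2)[OF B1 B3] by (simp add: tensor_def)
    next
      case Gamma4
      then show ?thesis using j B4 by simp
    qed
    then show ?thesis
      using has_trace_smooth[OF s, of j] by simp
  qed
  then show ?thesis
    using H1_smooth[OF s] by (simp add: energy_space_def)
qed

lemma integral_cmult_side: "(LINT y|side_measure. f y * (c * q y)) = c * (LINT y|side_measure. f y * (q y :: complex))"
  unfolding mult.left_commute[of "f _"] by (rule integral_mult_right_zero)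

lemma weak_mode:
  assumes w: "smooth1 w" and d: "B Gamma2 = Dirichlet \<Longrightarrow> w 1 = 0"
  shows "(LINT p|area_measure. Gx p * tensor (d1 w) (Y n) p) + (LINT p|area_measure. Gy p * tensor w (d1 (Y n)) p)
     - (complex_of_real k)\<^sup>2 * (LINT p|area_measure. u p * tensor w (Y n) p)
     - \<i> * complex_of_real k * (w 0 * (LINT y|side_measure. \<gamma> Gamma4 y * Y n y)
        + (if B Gamma2 = Impedance then w 1 * (LINT y|side_measure. \<gamma> Gamma2 y * Y n y) else 0))
     = (if B Gamma2 = Dirichlet then 0 else w 1 * (LINT y|side_measure. g Gamma2 y * Y n y))"
proof -
  \<comment> \<open>The factor \<open>w\<close> is conjugated in advance, as the weak formulation is
    antilinear in the test function; the modes are real.\<close>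
  define v where "v = tensor (\<lambda>x. cnj (w x)) (Y n)"
  have cw: "smooth1 (\<lambda>x. cnj (w x))" by (rule smooth1_cnj[OF w])
  have sv: "smooth v" unfolding v_def by (rule smooth_tensor[OF cw smooth1_Y])
  have vE: "v \<in> energy_space B"
    unfolding v_def by (rule energy_test[OF cw]) (simp add: d)
  have cv: "cnj (v p) = tensor w (Y n) p" for p
    by (simp add: v_def tensor_def)
  have cg: "classical_grad v p = (tensor (d1 (\<lambda>x. cnj (w x))) (Y n) p, tensor (\<lambda>x. cnj (w x)) (d1 (Y n)) p)" for p
    unfolding v_def by (rule C1_plane_classical_grad[OF C1_plane_tensor[OF cw smooth1_Y]])
  have ae: "AE p in area_measure. cnj (fst (weak_grad v p)) = tensor (d1 w) (Y n) p \<and> cnj (snd (weak_grad v p)) = tensor w (d1 (Y n)) p"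
    using weak_grad_smooth[OF sv]
    by eventually_elim (simp add: cg tensor_def d1_cnj[OF w] d1_Y)
  have WL: "(\<lambda>p. cnj (fst (weak_grad v p))) \<in> L2 area_measure" "(\<lambda>p. cnj (snd (weak_grad v p))) \<in> L2 area_measure"
    by (intro L2_cnj L2_pair weak_grad_spec H1_smooth sv)+
  note T1 = L2_tensor[OF smooth1_d1(2)[OF w] smooth1_Y[of n]]
  note T2 = L2_tensor[OF w smooth1_d1(2)[OF smooth1_Y[of n]]]
  note T0 = L2_tensor[OF w smooth1_Y[of n]]
  have "(LINT p|area_measure. Gx p * cnj (fst (weak_grad v p)) + Gy p * cnj (snd (weak_grad v p)) - (complex_of_real k)\<^sup>2 * u p * cnj (v p))
     = (LINT p|area_measure. Gx p * cnj (fst (weak_grad v p))) + (LINT p|area_measure. Gy p * cnj (snd (weak_grad v p)))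
      - (complex_of_real k)\<^sup>2 * (LINT p|area_measure. u p * tensor w (Y n) p)"
    unfolding cv mult.assoc
    using L2_mult_integrable[OF Gx_L2 WL(1)] L2_mult_integrable[OF Gy_L2 WL(2)] L2_mult_integrable[OF u_L2 T0]
    by simp
  also have "(LINT p|area_measure. Gx p * cnj (fst (weak_grad v p))) = (LINT p|area_measure. Gx p * tensor (d1 w) (Y n) p)"
    using L2_mult_integrable[OF Gx_L2 WL(1)] L2_mult_integrable[OF Gx_L2 T1] ae
    by (intro integral_cong_AE) auto
  also have "(LINT p|area_measure. Gy p * cnj (snd (weak_grad v p))) = (LINT p|area_measure. Gy p * tensor w (d1 (Y n)) p)"
    using L2_mult_integrable[OF Gy_L2 WL(2)] L2_mult_integrable[OF Gy_L2 T2] ae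
    by (intro integral_cong_AE) auto
  finally have lhs: "(LINT p|area_measure. Gx p * cnj (fst (weak_grad v p)) + Gy p * cnj (snd (weak_grad v p)) - (complex_of_real k)\<^sup>2 * u p * cnj (v p))
     = (LINT p|area_measure. Gx p * tensor (d1 w) (Y n) p) + (LINT p|area_measure. Gy p * tensor w (d1 (Y n)) p)
     - (complex_of_real k)\<^sup>2 * (LINT p|area_measure. u p * tensor w (Y n) p)" .
  have s4: "(LINT y|side_measure. f y * cnj (v (side_point Gamma4 y))) = w 0 * (LINT y|side_measure. f y * Y n y)"
    and s2: "(LINT y|side_measure. f y * cnj (v (side_point Gamma2 y))) = w 1 * (LINT y|side_measure. f y * Y n y)" for f
    unfolding cv by (simp_all add: tensor_def integral_cmult_side)
  have b: "B Gamma1 \<noteq> Impedance" "B Gamma3 \<noteq> Impedance" "B Gamma4 \<noteq> Neumann"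
    using B1 B3 B4 by auto
  have z': "(LINT y|side_measure. g Gamma1 y * cnj (v (side_point Gamma1 y))) = 0"
    "(LINT y|side_measure. g Gamma3 y * cnj (v (side_point Gamma3 y))) = 0"
    "(LINT y|side_measure. g Gamma4 y * cnj (v (side_point Gamma4 y))) = 0"
    unfolding g1 g3 g4 by simp_all
  have "B Gamma2 = Dirichlet \<or> B Gamma2 = Neumann \<or> B Gamma2 = Impedance"
    by (cases "B Gamma2") auto
  then show ?thesis
    using weak[OF vE has_trace_smooth[OF sv]]
    unfolding lhs sum_sides[where P="\<lambda>j. B j = Impedance"] sum_sides[where P="\<lambda>j. B j = Neumann"] z'
    using b B4 by (elim disjE) (simp_all add: s4 s2 add.commute[of "w 0 * _"] del: side_point.simps)
qed

section \<open>Mode coefficients of the solution and of its gradient\<close>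

definition a :: "nat \<Rightarrow> complex" where "a n = (LINT y|side_measure. t2 y * Y n y)"
definition b :: "nat \<Rightarrow> complex" where "b n = (LINT y|side_measure. \<gamma> Gamma4 y * Y n y)"
definition gh :: "nat \<Rightarrow> complex" where "gh n = mode_coeff (B Gamma1) (B Gamma3) (g Gamma2) n"
definition lam :: "nat \<Rightarrow> real" where "lam n = k\<^sup>2 - (fr n)\<^sup>2"

lemma Gx_coeff:
  assumes "smooth1 h"
  shows "(LINT p|area_measure. Gx p * tensor h (Y n) p) =
     h 1 * a n - h 0 * b n - (LINT p|area_measure. u p * tensor (d1 h) (Y n) p)"
  unfolding a_def b_def by (rule green_x[OF trace2 tr assms smooth1_Y])

lemma tensor_cmult2: "tensor h (\<lambda>y. c * q y) p = c * tensor h q p"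
  by (simp add: tensor_def)

lemma integral_cmult_area: "(LINT p|area_measure. f p * (c * q p)) = c * (LINT p|area_measure. f p * (q p :: complex))"
  unfolding mult.left_commute[of "f _"] by (rule integral_mult_right_zero)

text \<open>No boundary term survives: on a horizontal Dirichlet side the trace of \<open>u\<close>
  is zero, on a Neumann side the dual mode is.\<close>

lemma Gy_coeff:
  assumes "smooth1 h"
  shows "(LINT p|area_measure. Gy p * tensor h (dual.Y n) p) =
     complex_of_real (sg * fr n) * (LINT p|area_measure. u p * tensor h (Y n) p)"
proof -
  define t1 where "t1 = (if B Gamma1 = Dirichlet then g Gamma1 else \<gamma> Gamma1)"
  define t3 where "t3 = (if B Gamma3 = Dirichlet then g Gamma3 else \<gamma> Gamma3)"
  have "has_trace Gamma1 u t1" "has_trace Gamma3 u t3"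
    using dir tr by (simp_all add: t1_def t3_def)
  note G = green_y[OF this(2,1) assms dual.smooth1_Y[of n]]
  have z3: "dual.Y n 1 * (LINT x|side_measure. t3 x * h x) = 0"
    using B3 mode_boundary(2)[OF dual.b1 dual.b3, of n] by (auto simp: t3_def g3)
  have z1: "dual.Y n 0 * (LINT x|side_measure. t1 x * h x) = 0"
    using B1 mode_boundary(1)[OF dual.b1 dual.b3, of n] by (auto simp: t1_def g1)
  show ?thesis
    unfolding G z1 z3 d1_dual_Y tensor_cmult2 integral_cmult_area by simp
qed

text \<open>The Green formulas remove both gradient components from the weak formulation, so that
  all derivatives fall on \<open>w\<close>. The two factors \<open>sg * fr n\<close>, one from
  differentiating the mode and one from \<open>Gy_coeff\<close>, multiply to the square of the
  frequency.\<close>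

lemma mode_identity:
  assumes w: "smooth1 w" and d: "B Gamma2 = Dirichlet \<Longrightarrow> w 1 = 0"
  shows "d1 w 1 * a n - d1 w 0 * b n
     - (LINT p|area_measure. u p * tensor (\<lambda>x. d1 (d1 w) x + complex_of_real (lam n) * w x) (Y n) p)
     - \<i> * complex_of_real k * (w 0 * b n + (if B Gamma2 = Impedance then w 1 * a n else 0))
     = (if B Gamma2 = Dirichlet then 0 else w 1 * gh n)"
proof -
  define I where "I h = (LINT p|area_measure. u p * tensor h (Y n) p)" for h
  have "(LINT p|area_measure. Gy p * tensor w (d1 (Y n)) p) = complex_of_real (sg * fr n) * (complex_of_real (sg * fr n) * I w)"
    unfolding d1_Y tensor_cmult2 integral_cmult_area Gy_coeff[OF w] I_def ..
  also have "\<dots> = complex_of_real ((sg * sg) * (fr n)\<^sup>2) * I w"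
    by (simp add: power2_eq_square)
  finally have 1: "(LINT p|area_measure. Gy p * tensor w (d1 (Y n)) p) = complex_of_real ((fr n)\<^sup>2) * I w"
    by (simp add: sg_sq)
  have 2: "(LINT p|area_measure. Gx p * tensor (d1 w) (Y n) p) = d1 w 1 * a n - d1 w 0 * b n - I (d1 (d1 w))"
    unfolding I_def by (rule Gx_coeff[OF smooth1_d1(2)[OF w]])
  have "tensor (\<lambda>x. d1 (d1 w) x + complex_of_real (lam n) * w x) (Y n) p = tensor (d1 (d1 w)) (Y n) p + complex_of_real (lam n) * tensor w (Y n) p" for p
    by (simp add: tensor_def algebra_simps)
  then have 3: "I (\<lambda>x. d1 (d1 w) x + complex_of_real (lam n) * w x) = I (d1 (d1 w)) + complex_of_real (lam n) * I w"
    unfolding I_def using L2_mult_integrable[OF u_L2 L2_tensor[OF w smooth1_Y[of n]]]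
      L2_mult_integrable[OF u_L2 L2_tensor[OF smooth1_d1(2)[OF smooth1_d1(2)[OF w]] smooth1_Y[of n]]]
    by (simp add: distrib_left integral_cmult_area mult.left_commute[of _ "complex_of_real (lam n)"] del: mult_cancel_left)
  have 4: "(if B Gamma2 = Impedance then w 1 * (LINT y|side_measure. \<gamma> Gamma2 y * Y n y) else 0) = (if B Gamma2 = Impedance then w 1 * a n else 0)"
    by (simp add: a_def t2_def)
  have 5: "(LINT y|side_measure. g Gamma2 y * Y n y) = gh n" "(LINT y|side_measure. \<gamma> Gamma4 y * Y n y) = b n"
    by (simp_all add: gh_def mode_coeff_def b_def)
  show ?thesis
    using weak_mode[OF w d, of n] unfolding I_def[symmetric] 1 2 3 4 5
    by (simp add: lam_def algebra_simps)
qed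

text \<open>The solution of the mode equation with value \<open>b n\<close> at \<open>x = 0\<close>
  that satisfies the homogeneous impedance condition there; the outward derivative on that side is
  -d/dx, hence the slope \<open>- i k b n\<close>.\<close>

definition U :: "nat \<Rightarrow> real \<Rightarrow> complex" where
  "U n x = b n * (cc (lam n) x - \<i> * complex_of_real k * cs (lam n) x)"

lemma smooth1_U: "smooth1 (U n)"
  unfolding U_def[abs_def] by (intro smooth1_cmult smooth1_diff smooth1_ode)

lemma d1_U: "d1 (U n) = (\<lambda>x. b n * (- (complex_of_real (lam n) * cs (lam n) x) - \<i> * complex_of_real k * cc (lam n) x))"
  unfolding U_def[abs_def]
  by (simp add: d1_cmult d1_diff smooth1_ode smooth1_cmult smooth1_diff d1_ode del: mult_minus_right)

lemma d1_d1_U: "d1 (d1 (U n)) = (\<lambda>x. - (complex_of_real (lam n) * U n x))"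
proof (rule d1_eq)
  fix x
  have "((\<lambda>x. b n * (complex_of_real (- lam n) * cs (lam n) x - \<i> * complex_of_real k * cc (lam n) x)) has_vector_derivative
      b n * (complex_of_real (- lam n) * cc (lam n) x - \<i> * complex_of_real k * (complex_of_real (- lam n) * cs (lam n) x))) (at x)"
    by (intro has_vector_derivative_mult_right has_vector_derivative_diff ode_vector_deriv)
  then show "(d1 (U n) has_vector_derivative - (complex_of_real (lam n) * U n x)) (at x)"
    unfolding d1_U by (simp add: U_def algebra_simps)
qed

lemma U_0: "U n 0 = b n" "d1 (U n) 0 = - (\<i> * complex_of_real k * b n)"
  unfolding d1_U by (simp_all add: U_def ode_0)

text \<open>Lagrange's identity: the integrand is the derivative of the Wronskian
  \<open>U w' - U' w\<close>.\<close>

lemma U_green: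
  assumes w: "smooth1 w"
  shows "(LINT x|side_measure. U n x * (d1 (d1 w) x + complex_of_real (lam n) * w x)) =
    (U n 1 * d1 w 1 - d1 (U n) 1 * w 1) - (U n 0 * d1 w 0 - d1 (U n) 0 * w 0)"
proof -
  have s: "smooth1 (\<lambda>x. U n x * d1 w x - d1 (U n) x * w x)"
    by (intro smooth1_diff smooth1_mult smooth1_U smooth1_d1(2) w)
  have "d1 (\<lambda>x. U n x * d1 w x - d1 (U n) x * w x) = (\<lambda>x. U n x * (d1 (d1 w) x + complex_of_real (lam n) * w x))"
    by (simp add: d1_diff d1_mult smooth1_mult smooth1_U smooth1_d1(2) w d1_d1_U fun_eq_iff algebra_simps)
  with integral_d1[OF s] show ?thesis by simp
qed

text \<open>With \<open>w\<close> flat at \<open>x = 1\<close> both the unknown trace and the datum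
  drop out of the weak identity. What remains at \<open>x = 0\<close> is the same combination of
  \<open>w(0)\<close> and \<open>w'(0)\<close> as in the Green identity for
  \<open>U\<close>.\<close>

lemma u_coeff:
  assumes "smooth1 h"
  shows "(LINT p|area_measure. u p * tensor h (Y n) p) = (LINT x|side_measure. U n x * h x)"
proof -
  obtain w where w: "smooth1 w" "w 1 = 0" "d1 w 1 = 0" "\<And>x. d1 (d1 w) x + complex_of_real (lam n) * w x = h x"
    using ode_solvable[OF assms, where l="lam n"] by blast
  show ?thesis
    using mode_identity[OF w(1), of n] U_green[OF w(1), of n] w(2,3) unfolding w(4) U_0
    by (simp add: algebra_simps add_eq_0_iff)
qed

text \<open>Now that \<open>u\<close> is known in duality, the weak identity can be compared with
  the Green identity for \<open>U\<close> without conditions on the slope of \<open>w\<close>; the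
  terms at \<open>x = 0\<close> cancel.\<close>

lemma end_identity:
  assumes w: "smooth1 w" and d: "B Gamma2 = Dirichlet \<Longrightarrow> w 1 = 0"
  shows "d1 w 1 * a n - \<i> * complex_of_real k * (if B Gamma2 = Impedance then w 1 * a n else 0)
     - (if B Gamma2 = Dirichlet then 0 else w 1 * gh n) = U n 1 * d1 w 1 - d1 (U n) 1 * w 1"
proof -
  have "smooth1 (\<lambda>x. d1 (d1 w) x + complex_of_real (lam n) * w x)"
    by (intro smooth1_add smooth1_cmult smooth1_d1(2) w)
  from mode_identity[OF w d, of n] u_coeff[OF this, of n] U_green[OF w, of n] show ?thesis
    unfolding U_0 by (simp add: algebra_simps)
qed

text \<open>The choice \<open>w = 1 - x\<close> has \<open>w(1) = 0\<close>, so it is admissible for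
  every condition on \<open>Gamma2\<close>, and its slope -1 isolates the value.\<close>

lemma U_1: "U n 1 = a n"
proof -
  have "smooth1 (\<lambda>x. 1 - complex_of_real x)" by (rule smooth1_one_minus)
  from end_identity[OF this, of n] show ?thesis
    by (simp add: d1_one_minus split: if_splits)
qed

text \<open>In the Dirichlet case the end value is the coefficient of \<open>t2\<close>, which is
  the datum. Otherwise the constant \<open>w = 1\<close> is admissible and isolates the
  slope.\<close>

lemma end_condition:
  "B Gamma2 = Dirichlet \<Longrightarrow> U n 1 = gh n"
  "B Gamma2 = Neumann \<Longrightarrow> d1 (U n) 1 = gh n"
  "B Gamma2 = Impedance \<Longrightarrow> d1 (U n) 1 - \<i> * complex_of_real k * U n 1 = gh n"
proof -
  show "U n 1 = gh n" if "B Gamma2 = Dirichlet"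
    unfolding U_1 using that by (simp add: a_def t2_def gh_def mode_coeff_def)
  have e: "B Gamma2 \<noteq> Dirichlet \<Longrightarrow> \<i> * complex_of_real k * (if B Gamma2 = Impedance then U n 1 else 0) + gh n = d1 (U n) 1"
    using end_identity[OF smooth1_const[of 1], of n] by (simp add: d1_const U_1) (simp add: neg_equal_iff_equal algebra_simps split: if_splits)
  show "B Gamma2 = Neumann \<Longrightarrow> d1 (U n) 1 = gh n" using e by simp
  show "B Gamma2 = Impedance \<Longrightarrow> d1 (U n) 1 - \<i> * complex_of_real k * U n 1 = gh n" using e by (simp add: algebra_simps)
qed

text \<open>The smooth sequence behind any one of the traces approximates \<open>u\<close> together
  with its gradient; the trace on \<open>Gamma1\<close> is used. This supplies the density
  hypothesis of \<open>parseval_modes\<close>.\<close>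

lemma approximable:
  assumes "e > 0"
  shows "\<exists>\<phi>. continuous_on UNIV \<phi> \<and> L2_norm area_measure (\<lambda>p. u p - \<phi> p) < e"
    "\<exists>\<phi>. continuous_on UNIV \<phi> \<and> L2_norm area_measure (\<lambda>p. Gx p - \<phi> p) < e"
    "\<exists>\<phi>. continuous_on UNIV \<phi> \<and> L2_norm area_measure (\<lambda>p. Gy p - \<phi> p) < e"
proof -
  obtain \<phi> where \<phi>: "\<And>n. smooth (\<phi> n)"
    and l0: "(\<lambda>n. L2_norm area_measure (\<lambda>p. \<phi> n p - u p)) \<longlonglongrightarrow> 0"
    and lg: "(\<lambda>n. L2_norm area_measure (\<lambda>p. classical_grad (\<phi> n) p - weak_grad u p)) \<longlonglongrightarrow> 0"
    using tr[of Gamma1] unfolding has_trace_def by blast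
  obtain n where n: "L2_norm area_measure (\<lambda>p. \<phi> n p - u p) < e"
    using order_tendstoD(2)[OF l0 assms] eventually_happens'[OF sequentially_bot] by auto
  obtain m where m: "L2_norm area_measure (\<lambda>p. classical_grad (\<phi> m) p - weak_grad u p) < e"
    using order_tendstoD(2)[OF lg assms] eventually_happens'[OF sequentially_bot] by auto
  obtain fx fy where f: "C1_plane (\<phi> m) fx fy"
    using \<phi> by (rule C1_plane_smooth)
  have D: "(\<lambda>p. classical_grad (\<phi> m) p - weak_grad u p) \<in> L2 area_measure"
    by (rule L2_pairI) (simp_all add: L2_diff L2_pair L2_classical_grad[OF \<phi>] G_L2)
  show "\<exists>\<phi>. continuous_on UNIV \<phi> \<and> L2_norm area_measure (\<lambda>p. u p - \<phi> p) < e"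
    using n continuous_smooth[OF \<phi>[of n], of UNIV] L2_norm_minus_commute[of area_measure u "\<phi> n"] by (intro exI[of _ "\<phi> n"]) simp
  show "\<exists>\<phi>. continuous_on UNIV \<phi> \<and> L2_norm area_measure (\<lambda>p. Gx p - \<phi> p) < e"
    using m L2_norm_component_le(1)[OF D] C1_planeD(1)[OF f] L2_norm_minus_commute[of area_measure Gx fx]
    by (intro exI[of _ fx]) (simp add: C1_plane_classical_grad[OF f])
  show "\<exists>\<phi>. continuous_on UNIV \<phi> \<and> L2_norm area_measure (\<lambda>p. Gy p - \<phi> p) < e"
    using m L2_norm_component_le(2)[OF D] C1_planeD(2)[OF f] L2_norm_minus_commute[of area_measure Gy fy]
    by (intro exI[of _ fy]) (simp add: C1_plane_classical_grad[OF f])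
qed

lemma u_parseval: "(\<lambda>n. (L2_norm side_measure (U n))\<^sup>2) sums (L2_norm area_measure u)\<^sup>2"
  by (intro parseval_modes u_L2 approximable smooth1_U u_coeff)

text \<open>Integration by parts for \<open>U n\<close> on the interval has the same boundary terms
  as the Green formula for \<open>u\<close>, because \<open>U n\<close> takes the values
  \<open>a n\<close> and \<open>b n\<close> at the ends.\<close>

lemma Gx_parseval: "(\<lambda>n. (L2_norm side_measure (d1 (U n)))\<^sup>2) sums (L2_norm area_measure Gx)\<^sup>2"
proof (intro parseval_modes Gx_L2 approximable smooth1_d1(2) smooth1_U)
  fix n and h :: "real \<Rightarrow> complex" assume h: "smooth1 h"
  have "(LINT x|side_measure. d1 (\<lambda>x. U n x * h x) x) = U n 1 * h 1 - U n 0 * h 0"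
    by (intro integral_d1 smooth1_mult smooth1_U h)
  moreover have "(LINT x|side_measure. d1 (\<lambda>x. U n x * h x) x) = (LINT x|side_measure. U n x * d1 h x) + (LINT x|side_measure. d1 (U n) x * h x)"
    unfolding d1_mult[OF smooth1_U h]
    by (intro Bochner_Integration.integral_add L2_mult_integrable L2_smooth1 smooth1_U smooth1_d1(2) h)
  ultimately show "(LINT p|area_measure. Gx p * tensor h (Y n) p) = (LINT x|side_measure. d1 (U n) x * h x)"
    unfolding Gx_coeff[OF h] u_coeff[OF smooth1_d1(2)[OF h]] U_1 U_0 by (simp add: algebra_simps)
qed

text \<open>The expansion runs over the dual modes with coefficients \<open>sg * fr n * U n\<close>;
  the sign disappears in the norm.\<close>

lemma Gy_parseval: "(\<lambda>n. (fr n)\<^sup>2 * (L2_norm side_measure (U n))\<^sup>2) sums (L2_norm area_measure Gy)\<^sup>2"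
proof -
  have "(\<lambda>n. (L2_norm side_measure (\<lambda>x. complex_of_real (sg * fr n) * U n x))\<^sup>2) sums (L2_norm area_measure Gy)\<^sup>2"
  proof (intro dual.parseval_modes Gy_L2 approximable smooth1_cmult smooth1_U)
    fix n and h :: "real \<Rightarrow> complex" assume h: "smooth1 h"
    show "(LINT p|area_measure. Gy p * tensor h (dual.Y n) p) = (LINT x|side_measure. complex_of_real (sg * fr n) * U n x * h x)"
      unfolding Gy_coeff[OF h] u_coeff[OF h] mult.assoc integral_mult_right_zero ..
  qed
  moreover have "(L2_norm side_measure (\<lambda>x. complex_of_real (sg * fr n) * U n x))\<^sup>2 = (fr n)\<^sup>2 * (L2_norm side_measure (U n))\<^sup>2" for n
  proof -
    have "(cmod (complex_of_real (sg * fr n)))\<^sup>2 = (fr n)\<^sup>2"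
      using sg_sq by (simp add: norm_mult power_mult_distrib) (simp add: power2_eq_square)
    then show ?thesis unfolding L2_norm_cmult power_mult_distrib by simp
  qed
  ultimately show ?thesis by simp
qed

section \<open>Energy and boundary value of a single mode\<close>

definition Is :: "nat \<Rightarrow> real" where "Is n = (LINT x|side_measure. (ode_s (lam n) x)\<^sup>2)"

lemma mode_energy:
  "(L2_norm side_measure (d1 (U n)))\<^sup>2 + (fr n)\<^sup>2 * (L2_norm side_measure (U n))\<^sup>2 + k\<^sup>2 * (L2_norm side_measure (U n))\<^sup>2
    = (cmod (b n))\<^sup>2 * (2 * k\<^sup>2 + (fr n)\<^sup>2 + 2 * (fr n) ^ 4 * Is n)"
proof -
  define s where "s x = ode_s (lam n) x" for x
  define c where "c x = ode_c (lam n) x" for x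
  have cm: "(cmod (complex_of_real x - \<i> * complex_of_real k * complex_of_real y))\<^sup>2 = x\<^sup>2 + k\<^sup>2 * y\<^sup>2" for x y
    unfolding cmod_power2 by (simp add: power_mult_distrib)
  have n1: "(cmod (U n x))\<^sup>2 = (cmod (b n))\<^sup>2 * ((c x)\<^sup>2 + k\<^sup>2 * (s x)\<^sup>2)" for x
    unfolding U_def norm_mult power_mult_distrib cm s_def c_def ..
  have n2: "(cmod (d1 (U n) x))\<^sup>2 = (cmod (b n))\<^sup>2 * ((lam n)\<^sup>2 * (s x)\<^sup>2 + k\<^sup>2 * (c x)\<^sup>2)" for x
    unfolding d1_U norm_mult power_mult_distrib of_real_mult[symmetric] of_real_minus[symmetric] cm s_def c_def
    by (simp add: power_mult_distrib)
  have pt: "(cmod (d1 (U n) x))\<^sup>2 + (fr n)\<^sup>2 * (cmod (U n x))\<^sup>2 + k\<^sup>2 * (cmod (U n x))\<^sup>2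
     = (cmod (b n))\<^sup>2 * (2 * k\<^sup>2 + (fr n)\<^sup>2 + 2 * (fr n) ^ 4 * (s x)\<^sup>2)" for x
  proof -
    have e: "(c x)\<^sup>2 = 1 - lam n * (s x)\<^sup>2"
      using ode_pythagoras[of "lam n" x] by (simp add: c_def s_def)
    show ?thesis
      unfolding n1 n2 e lam_def by (simp add: algebra_simps power2_eq_square power4_eq_xxxx)
  qed
  have si: "integrable side_measure (\<lambda>x. (s x)\<^sup>2)"
    unfolding s_def
    by (intro integral_side_continuous(1) continuous_on_power continuous_at_imp_continuous_on ballI DERIV_isCont[OF ode_deriv(1)])
  have "(LINT x|side_measure. (cmod (d1 (U n) x))\<^sup>2 + (fr n)\<^sup>2 * (cmod (U n x))\<^sup>2 + k\<^sup>2 * (cmod (U n x))\<^sup>2)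
     = (cmod (b n))\<^sup>2 * (2 * k\<^sup>2 + (fr n)\<^sup>2 + 2 * (fr n) ^ 4 * Is n)"
  proof -
    interpret finite_measure side_measure by (rule finite_measure_side)
    have "measure side_measure (space side_measure) = 1"
      by (simp add: measure_restrict_space space_restrict_space)
    then show ?thesis
      unfolding pt Is_def s_def[symmetric] using si by simp
  qed
  moreover have "integrable side_measure (\<lambda>x. (cmod (d1 (U n) x))\<^sup>2)" "integrable side_measure (\<lambda>x. (cmod (U n x))\<^sup>2)"
    by (intro L2_integrable_sq L2_smooth1 smooth1_d1(2) smooth1_U)+
  ultimately show ?thesis
    unfolding L2_norm_sq by simp
qed

lemma energy_sums:
  "(\<lambda>n. (cmod (b n))\<^sup>2 * (2 * k\<^sup>2 + (fr n)\<^sup>2 + 2 * (fr n) ^ 4 * Is n))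
    sums ((L2_norm area_measure (weak_grad u))\<^sup>2 + k\<^sup>2 * (L2_norm area_measure u)\<^sup>2)"
  unfolding mode_energy[symmetric] L2_pair(3)[OF G_L2]
  by (intro sums_add Gx_parseval Gy_parseval sums_mult u_parseval)

text \<open>Apart from \<open>b n\<close> each boundary value has the form x - i k y with real x and
  y. In the impedance case eliminating \<open>c1\<close> leaves (lam + k^2)^2 - 4 k^2 lam = (lam -
  k^2)^2, the fourth power of the frequency, in front of \<open>s1^2\<close>.\<close>

lemma end_value_norms:
  fixes n
  defines "s1 \<equiv> ode_s (lam n) 1" and "c1 \<equiv> ode_c (lam n) 1"
  shows "B Gamma2 = Dirichlet \<Longrightarrow> (cmod (gh n))\<^sup>2 = (cmod (b n))\<^sup>2 * (1 + (fr n)\<^sup>2 * s1\<^sup>2)"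
    "B Gamma2 = Neumann \<Longrightarrow> (cmod (gh n))\<^sup>2 = (cmod (b n))\<^sup>2 * ((lam n)\<^sup>2 * s1\<^sup>2 + k\<^sup>2 * c1\<^sup>2)"
    "B Gamma2 = Impedance \<Longrightarrow> (cmod (gh n))\<^sup>2 = (cmod (b n))\<^sup>2 * ((fr n) ^ 4 * s1\<^sup>2 + 4 * k\<^sup>2)"
proof -
  have cm: "(cmod (complex_of_real x - \<i> * complex_of_real k * complex_of_real y))\<^sup>2 = x\<^sup>2 + k\<^sup>2 * y\<^sup>2" for x y
    unfolding cmod_power2 by (simp add: power_mult_distrib)
  have p: "c1\<^sup>2 = 1 - lam n * s1\<^sup>2"
    using ode_pythagoras[of "lam n" 1] by (simp add: c1_def s1_def)
  show "(cmod (gh n))\<^sup>2 = (cmod (b n))\<^sup>2 * (1 + (fr n)\<^sup>2 * s1\<^sup>2)" if "B Gamma2 = Dirichlet"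
    unfolding end_condition(1)[OF that, of n, symmetric] U_def norm_mult power_mult_distrib cm s1_def[symmetric] c1_def[symmetric] p
    by (simp add: lam_def algebra_simps)
  show "(cmod (gh n))\<^sup>2 = (cmod (b n))\<^sup>2 * ((lam n)\<^sup>2 * s1\<^sup>2 + k\<^sup>2 * c1\<^sup>2)" if "B Gamma2 = Neumann"
    unfolding end_condition(2)[OF that, of n, symmetric] d1_U norm_mult power_mult_distrib of_real_mult[symmetric] of_real_minus[symmetric] cm
      s1_def[symmetric] c1_def[symmetric]
    by (simp add: power_mult_distrib)
  have "d1 (U n) 1 - \<i> * complex_of_real k * U n 1 =
      b n * (complex_of_real (- (lam n + k\<^sup>2) * s1) - \<i> * complex_of_real k * complex_of_real (2 * c1))"
    unfolding d1_U U_def s1_def[symmetric] c1_def[symmetric] by (simp add: algebra_simps power2_eq_square)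
  then show "(cmod (gh n))\<^sup>2 = (cmod (b n))\<^sup>2 * ((fr n) ^ 4 * s1\<^sup>2 + 4 * k\<^sup>2)" if "B Gamma2 = Impedance"
    unfolding end_condition(3)[OF that, of n, symmetric]
    by (simp only: norm_mult power_mult_distrib cm p) (simp add: lam_def algebra_simps power2_eq_square power4_eq_xxxx)
qed

end


section \<open>Energy estimates\<close>

lemma ode_s_bound_nonneg:
  assumes "0 \<le> l" "0 \<le> x"
  shows "(ode_s l x)\<^sup>2 \<le> x\<^sup>2"
proof (cases "l = 0")
  case False
  then have r: "0 < sqrt l" using assms by simp
  have "\<bar>sin (sqrt l * x)\<bar> \<le> sqrt l * x"
    using abs_sin_x_le_abs_x[of "sqrt l * x"] assms by (simp add: abs_mult)
  then have "\<bar>ode_s l x\<bar> \<le> x"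
    using False assms r by (simp add: ode_s_def abs_divide divide_le_eq mult.commute)
  then show ?thesis
    using power_mono[of "\<bar>ode_s l x\<bar>" x 2] by simp
qed (simp add: ode_s_def)

lemma integral_sq_le_third: "(LINT x|side_measure. x\<^sup>2) = (1/3 :: real)"
proof -
  have "((\<lambda>x::real. x\<^sup>2) has_integral (1^3/3 - 0^3/3)) {0..1}"
    by (intro fundamental_theorem_of_calculus)
       (auto intro!: derivative_eq_intros simp: has_real_derivative_iff_has_vector_derivative[symmetric])
  then have "integral {0..1} (\<lambda>x::real. x\<^sup>2) = 1/3"
    by (simp add: integral_unique)
  then show ?thesis
    using integral_side_continuous(2)[OF continuous_on_power[OF continuous_on_id], of 2] by simp
qed

lemma continuous_ode: "continuous_on S (ode_s l)" "continuous_on S (ode_c l)"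
  by (intro continuous_at_imp_continuous_on ballI DERIV_isCont[OF ode_deriv(1)] DERIV_isCont[OF ode_deriv(2)])+

lemma Is_nonneg_case:
  assumes "0 \<le> l"
  shows "(LINT x|side_measure. (ode_s l x)\<^sup>2) \<le> 1/3"
  unfolding integral_sq_le_third[symmetric]
  by (intro integral_mono integral_side_continuous(1) continuous_on_power continuous_ode continuous_on_id
      ode_s_bound_nonneg assms) auto

lemma ode_neg:
  assumes "l < 0" "0 \<le> x" "x \<le> y"
  shows "1 \<le> ode_c l x" "ode_c l x \<le> ode_c l y" "0 \<le> ode_s l x" "ode_s l x \<le> ode_s l y"
proof -
  have r: "0 < sqrt (- l)" using assms by simp
  have xy: "sqrt (- l) * x \<le> sqrt (- l) * y" using r assms by simp
  show "1 \<le> ode_c l x" using assms by (simp add: ode_c_def cosh_real_ge_1)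
  show "ode_c l x \<le> ode_c l y" using assms r xy by (simp add: ode_c_def cosh_real_nonneg_le_iff)
  show "0 \<le> ode_s l x" using assms r by (simp add: ode_s_def)
  show "ode_s l x \<le> ode_s l y" using assms r xy by (simp add: ode_s_def divide_right_mono)
qed

text \<open>By the mean value theorem the end value of \<open>ode_s\<close> is a value of
  \<open>ode_c\<close> inside the interval, hence between 1 and the end value of
  \<open>ode_c\<close>.\<close>

lemma ode_neg_end:
  assumes "l < 0"
  shows "1 \<le> ode_s l 1" "ode_s l 1 \<le> ode_c l 1"
proof -
  obtain z where z: "0 < z" "z < 1" "ode_s l 1 - ode_s l 0 = (1 - 0) * ode_c l z"
    using MVT2[of 0 1 "ode_s l" "ode_c l"] ode_deriv(1) by auto
  then show "1 \<le> ode_s l 1" "ode_s l 1 \<le> ode_c l 1"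
    using ode_neg(1)[OF assms, of z z] ode_neg(2)[OF assms, of z 1] by (auto simp: ode_0)
qed

lemma measure_side: "measure side_measure (space side_measure) = 1"
  by (simp add: measure_restrict_space space_restrict_space)

lemma Is_neg_case:
  assumes "l < 0"
  shows "(LINT x|side_measure. (ode_s l x)\<^sup>2) \<le> (ode_s l 1)\<^sup>2"
proof -
  interpret finite_measure side_measure by (rule finite_measure_side)
  have "(LINT x|side_measure. (ode_s l x)\<^sup>2) \<le> (LINT x|side_measure. (ode_s l 1)\<^sup>2)"
  proof (intro integral_mono integral_side_continuous(1) continuous_on_power continuous_ode continuous_on_const power_mono)
    fix x assume "x \<in> space side_measure"
    then show "ode_s l x \<le> ode_s l 1" "0 \<le> ode_s l x"
      using ode_neg(3,4)[OF assms, of x 1] by auto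
  qed
  then show ?thesis using measure_side by simp
qed

text \<open>The derivative of s c is c^2 - l s^2 = 1 - 2 l s^2. For negative \<open>l\<close> this
  evaluates the integral exactly by end values, where estimating s by its end value would lose a
  power of the frequency.\<close>

lemma Is_end: "ode_s l 1 * ode_c l 1 = 1 - 2 * l * (LINT x|side_measure. (ode_s l x)\<^sup>2)"
proof -
  have d: "((\<lambda>x. ode_s l x * ode_c l x) has_real_derivative 1 - 2 * l * (ode_s l x)\<^sup>2) (at x)" for x
  proof -
    have "(ode_c l x)\<^sup>2 = 1 - l * (ode_s l x)\<^sup>2" using ode_pythagoras[of l x] by simp
    then show ?thesis
      by (auto intro!: derivative_eq_intros ode_deriv simp: power2_eq_square)
  qed
  have "((\<lambda>x. 1 - 2 * l * (ode_s l x)\<^sup>2) has_integral (ode_s l 1 * ode_c l 1 - ode_s l 0 * ode_c l 0)) {0..1}"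
    using d by (intro fundamental_theorem_of_calculus)
      (auto simp: has_real_derivative_iff_has_vector_derivative[symmetric] intro: has_field_derivative_at_within)
  then have "ode_s l 1 * ode_c l 1 = (LINT x|side_measure. 1 - 2 * l * (ode_s l x)\<^sup>2)"
    by (subst integral_side_continuous(2))
       (auto intro!: continuous_intros continuous_ode simp: ode_0 integral_unique)
  moreover have "integrable side_measure (\<lambda>x. (ode_s l x)\<^sup>2)"
    by (intro integral_side_continuous(1) continuous_on_power continuous_ode)
  moreover have "integrable side_measure (\<lambda>x. 1::real)"
    by (rule integral_side_continuous(1)) simp
  ultimately show ?thesis using measure_side by simp
qed

text \<open>Needed for modes just above the cut-off frequency. By monotonicity it reduces to cosh 1,
  bounded with e < 2.72 and the Taylor bound e \<ge> 1 + 1 + 1/2.\<close>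

lemma ode_c_le:
  assumes "- 1 \<le> l" "l < 0"
  shows "ode_c l 1 \<le> 8/5"
proof -
  have "sqrt (- l) \<le> 1" using assms by simp
  then have "ode_c l 1 \<le> cosh 1"
    using assms by (simp add: ode_c_def cosh_real_nonneg_le_iff)
  moreover have "exp (1::real) \<ge> 5/2"
    using exp_lower_Taylor_quadratic[of 1] by simp
  then have "exp (- 1 :: real) \<le> 2/5"
    by (simp add: exp_minus inverse_eq_divide field_simps)
  then have "cosh (1::real) \<le> 8/5"
    using e_less_272 by (simp add: cosh_def)
  ultimately show ?thesis by simp
qed

text \<open>
  Writing \<open>m = freq\<^sup>2\<close>, \<open>t = k\<^sup>2\<close>, \<open>S\<close> for the square of \<open>ode_s\<close> at the right end and \<open>J\<close> for
  the integral of the square of \<open>ode_s\<close>, the energy of a mode is \<open>2t + m + 2m\<^sup>2J\<close> and the bounds below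
  compare it with the square of the boundary value of the mode.
\<close>

locale mode_bounds =
  fixes k f :: real
  assumes k: "k > 0" and f: "f = 0 \<or> pi / 2 \<le> f"
begin

definition t :: real where "t = k\<^sup>2"
definition m :: real where "m = f\<^sup>2"
definition l :: real where "l = t - m"
definition S :: real where "S = (ode_s l 1)\<^sup>2"
definition J :: real where "J = (LINT x|side_measure. (ode_s l x)\<^sup>2)"
definition Q :: real where "Q = 2 * t + m + 2 * m\<^sup>2 * J"
definition p :: real where "p = ode_s l 1 * ode_c l 1"

lemma t_pos: "0 < t" using k by (simp add: t_def)

text \<open>The spectral gap with pi > 3, which gives 9/4 = (3/2)^2.\<close>

lemma m_cases: "m = 0 \<or> 9/4 \<le> m"
proof -
  have "9/4 \<le> f\<^sup>2" if "pi / 2 \<le> f"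
  proof -
    have "3/2 \<le> f" using that pi_gt3 by simp
    then have "(3/2)\<^sup>2 \<le> f\<^sup>2" by (intro power_mono) auto
    then show ?thesis by (simp add: power2_eq_square)
  qed
  then show ?thesis using f by (auto simp: m_def)
qed

lemma S_nonneg: "0 \<le> S" by (simp add: S_def)

lemma m_nonneg: "0 \<le> m" by (simp add: m_def)

lemma c_sq: "(ode_c l 1)\<^sup>2 = 1 - l * S"
  using ode_pythagoras[of l 1] by (simp add: S_def)

text \<open>Propagating modes. The bound \<open>s(x)^2 \<le> x^2\<close> gives
  \<open>S \<le> 1\<close> and \<open>J \<le> 1/3\<close>, the integral of x^2;
  \<open>m \<le> t\<close> does the rest.\<close>

lemma low_frequency:
  assumes "m \<le> t"
  shows "S \<le> 1" "Q \<le> 3 * t + 2/3 * t\<^sup>2"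
proof -
  have l: "0 \<le> l" using assms by (simp add: l_def)
  show "S \<le> 1" using ode_s_bound_nonneg[OF l, of 1] by (simp add: S_def)
  have "J \<le> 1/3" using Is_nonneg_case[OF l] by (simp add: J_def)
  moreover have "0 \<le> J" unfolding J_def by (intro integral_nonneg_AE) auto
  moreover have "m\<^sup>2 \<le> t\<^sup>2" using assms m_nonneg by (rule power_mono)
  ultimately have "m\<^sup>2 * J \<le> t\<^sup>2 * (1/3)" by (intro mult_mono) auto
  then show "Q \<le> 3 * t + 2/3 * t\<^sup>2" using assms by (simp add: Q_def)
qed

text \<open>Evanescent modes. Writing m = t + (m - t) in one factor of \<open>m^2 J\<close>, the
  exact formula for the integral turns m + 2 m (m - t) J into \<open>m * p\<close>; only the
  remaining \<open>2 m t J\<close> is estimated, through \<open>J \<le> S\<close>.\<close>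

lemma high_frequency:
  assumes "t < m"
  shows "1 \<le> S" "0 \<le> p" "p\<^sup>2 = S * (1 + (m - t) * S)" "Q \<le> 2 * t + m * p + 2 * m * t * S" "9/4 \<le> m"
proof -
  have l: "l < 0" using assms by (simp add: l_def)
  show "9/4 \<le> m" using m_cases assms t_pos by auto
  show "1 \<le> S" using ode_neg_end[OF l] by (simp add: S_def)
  show "0 \<le> p" using ode_neg_end[OF l] by (simp add: p_def)
  show "p\<^sup>2 = S * (1 + (m - t) * S)"
    unfolding p_def power_mult_distrib c_sq S_def[symmetric] by (simp add: l_def algebra_simps)
  have "J \<le> S" using Is_neg_case[OF l] by (simp add: J_def S_def)
  then have "m * t * J \<le> m * t * S" using m_nonneg t_pos by (intro mult_left_mono) auto
  moreover have "p = 1 - 2 * l * J" unfolding p_def J_def by (rule Is_end)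
  then have mp: "m * p = m * (1 - 2 * l * J)" by simp
  have "Q = 2 * t + m * p + 2 * (m * t * J)"
    unfolding mp by (simp add: Q_def l_def algebra_simps power2_eq_square)
  ultimately show "Q \<le> 2 * t + m * p + 2 * m * t * S" by simp
qed

text \<open>For propagating modes the term \<open>4 t\<close> alone suffices, and dividing the
  energy bound by it leaves one power of \<open>t\<close>. For evanescent modes
  \<open>p \<le> m S\<close>, so the energy is controlled by \<open>m^2 S\<close> and
  \<open>t\<close> uniformly in \<open>k\<close>.\<close>

lemma bound_impedance: "Q \<le> 6 * (max k 1)\<^sup>2 * (f ^ 4 * S + 4 * t)"
proof -
  define M where "M = (max k 1)\<^sup>2"
  have M: "1 \<le> M" "t \<le> M"
    unfolding M_def t_def using k by (auto intro!: power_mono simp: one_le_power)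
  have f4: "f ^ 4 = m\<^sup>2" by (simp add: m_def power_mult[symmetric])
  have "Q \<le> 6 * M * (m\<^sup>2 * S + 4 * t)"
  proof (cases "m \<le> t")
    case True
    have "t * 1 \<le> t * M" "t * t \<le> t * M"
      using M t_pos by (intro mult_left_mono; simp)+
    then have "3 * t + 2/3 * (t * t) \<le> 24 * (t * M)"
      using t_pos by linarith
    then have "3 * t + 2/3 * t\<^sup>2 \<le> 6 * M * (4 * t)"
      by (simp add: power2_eq_square mult.commute)
    also have "\<dots> \<le> 6 * M * (m\<^sup>2 * S + 4 * t)"
      using M S_nonneg by (intro mult_left_mono) auto
    finally show ?thesis using low_frequency(2)[OF True] by simp
  next
    case False
    then have h: "t < m" by simp
    note H = high_frequency[OF h]
    \<comment> \<open>The spectral gap enters: \<open>m \<ge> 9/4\<close> gives 1 + m \<le> m^2, and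
      \<open>S \<ge> 1\<close> absorbs the summand 1.\<close>
    have "1 + (m - t) * S \<le> S * m\<^sup>2"
    proof -
      have "(9/4) * m \<le> m * m" using H(5) by (intro mult_right_mono) auto
      then have "1 + m \<le> m\<^sup>2" using H(5) unfolding power2_eq_square by linarith
      then have "S * (1 + m) \<le> S * m\<^sup>2" using S_nonneg by (rule mult_left_mono)
      moreover have "(m - t) * S \<le> m * S" using t_pos S_nonneg by (intro mult_right_mono) auto
      ultimately show ?thesis using H(1) by (simp add: algebra_simps)
    qed
    then have "p\<^sup>2 \<le> (S * m)\<^sup>2"
      unfolding H(3) using mult_left_mono[of "1 + (m - t) * S" "S * m\<^sup>2" S] S_nonneg by (simp add: power2_eq_square algebra_simps)
    then have "p \<le> S * m" by (rule power2_le_imp_le) (simp add: S_nonneg m_nonneg)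
    then have "m * p \<le> m * (S * m)" using m_nonneg by (rule mult_left_mono)
    moreover have "m * t * S \<le> m * m * S"
      using h m_nonneg S_nonneg by (intro mult_right_mono mult_left_mono) auto
    ultimately have "Q \<le> 6 * (m\<^sup>2 * S + 4 * t)"
      using H(4) t_pos S_nonneg mult_nonneg_nonneg[OF mult_nonneg_nonneg[OF m_nonneg m_nonneg] S_nonneg]
      by (simp add: power2_eq_square algebra_simps)
    also have "\<dots> \<le> M * (6 * (m\<^sup>2 * S + 4 * t))"
      using M(1) S_nonneg t_pos by (intro mult_right_mono[of 1 M, simplified]) auto
    finally show ?thesis by (simp add: algebra_simps)
  qed
  then show ?thesis unfolding M_def f4 .
qed

text \<open>In the evanescent range \<open>f * p\<close> is at most \<open>N = 1 + m S\<close>,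
  because its square is m S (1 + (m - t) S). Thus \<open>m * p\<close> costs exactly one factor
  \<open>f\<close>, which is the weight in the squared norm of order 1/2.\<close>

lemma bound_dirichlet: "Q \<le> 7 * ((max (k\<^sup>2) 1)\<^sup>2 + max k 1 * f) * (1 + f\<^sup>2 * S)"
proof -
  define M where "M = (max (k\<^sup>2) 1)\<^sup>2"
  have f0: "0 \<le> f" using f pi_gt3 by auto
  have M1: "1 \<le> M" unfolding M_def by (simp add: one_le_power)
  have Mt2: "t\<^sup>2 \<le> M" unfolding M_def t_def by (rule power_mono) auto
  have Mt: "t \<le> M"
  proof (cases "t \<le> 1")
    case False
    then have "t * 1 \<le> t * t" using t_pos by (intro mult_left_mono) auto
    then show ?thesis using Mt2 by (simp add: power2_eq_square)
  qed (use M1 in simp)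
  define N where "N = 1 + m * S"
  have N: "1 \<le> N" using m_nonneg S_nonneg by (simp add: N_def)
  have "Q \<le> (7 * M + 7 * f) * N"
  proof (cases "m \<le> t")
    case True
    have "Q \<le> 7 * M" using low_frequency(2)[OF True] Mt Mt2 M1 by linarith
    also have "\<dots> \<le> 7 * M * N" using mult_left_mono[OF N, of "7 * M"] M1 by simp
    also have "\<dots> \<le> (7 * M + 7 * f) * N" using f0 N by (intro mult_right_mono) auto
    finally show ?thesis .
  next
    case False
    then have h: "t < m" by simp
    note H = high_frequency[OF h]
    have "(f * p)\<^sup>2 = m * S * (1 + (m - t) * S)"
      unfolding power_mult_distrib H(3) m_def by simp
    also have "\<dots> \<le> N * N"
    proof (rule mult_mono)
      have "(m - t) * S \<le> m * S" using t_pos S_nonneg by (intro mult_right_mono) auto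
      then show "1 + (m - t) * S \<le> N" by (simp add: N_def)
      have "0 \<le> (m - t) * S" using h S_nonneg by simp
      then show "0 \<le> 1 + (m - t) * S" by simp
    qed (use N in \<open>simp_all add: N_def\<close>)
    finally have "(f * p)\<^sup>2 \<le> N\<^sup>2" by (simp only: power2_eq_square[of N])
    then have "f * p \<le> N"
      by (rule power2_le_imp_le) (use N in linarith)
    then have "f * (f * p) \<le> f * N" using f0 by (rule mult_left_mono)
    then have "m * p \<le> f * N" by (simp add: m_def power2_eq_square)
    moreover have "2 * t + 2 * m * t * S = 2 * t * N" by (simp add: N_def algebra_simps)
    moreover have "2 * t * N \<le> 2 * M * N" using Mt N by (intro mult_right_mono) auto
    ultimately have "Q \<le> 2 * M * N + f * N" using H(4) by linarith
    also have "\<dots> \<le> (7 * M + 7 * f) * N"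
      using f0 N M1 by (simp add: algebra_simps)
    finally show ?thesis .
  qed
  also have "\<dots> \<le> (7 * M + 7 * (max k 1 * f)) * N"
    using f0 N mult_right_mono[of 1 "max k 1" f] by (intro mult_right_mono) auto
  finally show ?thesis unfolding M_def N_def m_def by (simp add: algebra_simps)
qed

text \<open>The squared boundary derivative is r = t - l m S up to \<open>|b|^2\<close>. It can be
  small in two ways: by resonance of a propagating mode, or near cut-off, where \<open>l\<close> is
  close to 0. The second makes it necessary to divide the evanescent range at m - t = 1/2.\<close>

lemma bound_neumann: "Q \<le> 10 * (max (k\<^sup>2) 1)\<^sup>2 * (l\<^sup>2 * S + t * (ode_c l 1)\<^sup>2)"
proof -
  define M where "M = (max (k\<^sup>2) 1)\<^sup>2"
  define r where "r = l\<^sup>2 * S + t * (ode_c l 1)\<^sup>2"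
  have M1: "1 \<le> M" unfolding M_def by (simp add: one_le_power)
  have Mt2: "t\<^sup>2 \<le> M" unfolding M_def t_def by (rule power_mono) auto
  have Mt: "t \<le> M"
  proof (cases "t \<le> 1")
    case False
    then have "t * 1 \<le> t * t" using t_pos by (intro mult_left_mono) auto
    then show ?thesis using Mt2 by (simp add: power2_eq_square)
  qed (use M1 in simp)
  have r: "r = t - l * m * S"
    unfolding r_def c_sq by (simp add: l_def algebra_simps power2_eq_square)
  have "Q \<le> 10 * M * r"
  proof (cases "m \<le> t")
    case True
    show ?thesis
    proof (cases "m = 0")
      case True
      then have "Q = 2 * t" "r = t" unfolding r by (simp_all add: Q_def)
      then show ?thesis using mult_right_mono[OF M1, of t] t_pos by simp
    next
      case False
      then have t1: "1 \<le> t" using m_cases True by simp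
      \<comment> \<open>The difference of the two sides is m^2 S c^2, with \<open>c\<close> the end
        value of \<open>ode_c\<close>. With \<open>m S \<le> t\<close> this yields r \<ge> t / (1 +
        t), a lower bound that persists at resonance.\<close>
      have "t \<le> r * (1 + m * S)"
      proof -
        have "r * (1 + m * S) - t = m * S * (t - l * (1 + m * S))"
          unfolding r by (simp add: algebra_simps)
        also have "\<dots> = m\<^sup>2 * S * (1 - l * S)" by (simp add: l_def algebra_simps power2_eq_square)
        also have "\<dots> \<ge> 0" unfolding c_sq[symmetric] using S_nonneg by simp
        finally show ?thesis by simp
      qed
      moreover have r0: "0 \<le> r" unfolding r_def using S_nonneg t_pos by simp
      have "m * S \<le> t * 1" using True low_frequency(1)[OF True] m_nonneg S_nonneg t_pos by (intro mult_mono) auto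
      then have "r * (1 + m * S) \<le> r * (1 + t)" using r0 by (intro mult_left_mono) auto
      ultimately have rt: "t \<le> r * (1 + t)" by simp
      have tt: "1 * t \<le> t * t" using t1 by (intro mult_right_mono) auto
      have "(3 * t + 2/3 * t\<^sup>2) * (1 + t) = t * (3 + 11/3 * t + 2/3 * (t * t))"
        by (simp add: field_simps power2_eq_square)
      also have "\<dots> \<le> t * (10 * (t * t))"
        using tt t1 t_pos by (intro mult_left_mono) linarith+
      also have "\<dots> = 10 * t\<^sup>2 * t" by (simp add: power2_eq_square)
      also have "\<dots> \<le> 10 * t\<^sup>2 * (r * (1 + t))" using rt by (intro mult_left_mono) auto
      finally have "(3 * t + 2/3 * t\<^sup>2) * (1 + t) \<le> (10 * t\<^sup>2 * r) * (1 + t)" by (simp add: algebra_simps)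
      then have "3 * t + 2/3 * t\<^sup>2 \<le> 10 * t\<^sup>2 * r"
        using t_pos by (simp add: mult_le_cancel_right)
      also have "\<dots> \<le> 10 * M * r" using Mt2 r0 by (intro mult_right_mono) auto
      finally show ?thesis using low_frequency(2)[OF True] by simp
    qed
  next
    case False
    then have h: "t < m" by simp
    note H = high_frequency[OF h]
    define \<kappa> where "\<kappa> = m - t"
    have r2: "r = t + \<kappa> * m * S" unfolding r by (simp add: l_def \<kappa>_def algebra_simps)
    have \<kappa>0: "0 < \<kappa>" using h by (simp add: \<kappa>_def)
    have mS: "0 \<le> m * S" using m_nonneg S_nonneg by simp
    have r0: "0 \<le> r" unfolding r2 using t_pos \<kappa>0 mS by (simp add: mult.assoc)
    show ?thesis
    proof (cases "1/2 \<le> \<kappa>")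
      \<comment> \<open>Away from cut-off. For \<open>\<kappa> \<ge> 1/2\<close> one has 1 +
        \<kappa> \<le> (3 \<kappa>)^2, hence \<open>p \<le> 3 \<kappa> S\<close>, and
        \<open>m * p\<close> is a multiple of the second term of \<open>r\<close>.\<close>
      case True
      have "(1/2) * (1/2) \<le> \<kappa> * \<kappa>" "(1/2) * \<kappa> \<le> \<kappa> * \<kappa>" using True by (intro mult_mono; simp)+
      then have "1 + \<kappa> \<le> 9 * (\<kappa> * \<kappa>)" by linarith
      then have "S * (1 + \<kappa>) \<le> S * (9 * (\<kappa> * \<kappa>))" using S_nonneg by (rule mult_left_mono)
      then have "1 + \<kappa> * S \<le> S * (9 * (\<kappa> * \<kappa>))" using H(1) by (simp add: algebra_simps)
      then have "S * (1 + \<kappa> * S) \<le> S * (S * (9 * (\<kappa> * \<kappa>)))" using S_nonneg by (rule mult_left_mono)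
      then have "p\<^sup>2 \<le> (3 * \<kappa> * S)\<^sup>2"
        unfolding H(3) \<kappa>_def[symmetric] by (simp add: power2_eq_square algebra_simps)
      then have "p \<le> 3 * \<kappa> * S" by (rule power2_le_imp_le) (use S_nonneg \<kappa>0 in simp)
      then have a: "m * p \<le> m * (3 * \<kappa> * S)" using m_nonneg by (rule mult_left_mono)
      define X where "X = \<kappa> * (m * S)"
      have X0: "0 \<le> X" using mS \<kappa>0 by (simp add: X_def)
      have "(1/2) * (m * S) \<le> X" unfolding X_def using True mS by (rule mult_right_mono)
      then have "t * (2 * (m * S)) \<le> t * (4 * X)" using t_pos by (intro mult_left_mono) auto
      moreover have "t * (4 * X) \<le> M * (4 * X)" using Mt X0 by (intro mult_right_mono) auto
      moreover have "1 * (3 * X) \<le> M * (3 * X)" "1 * (2 * t) \<le> M * (2 * t)"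
        using M1 X0 t_pos by (intro mult_right_mono; simp)+
      moreover have "Q \<le> 2 * t + 3 * X + t * (2 * (m * S))"
        using H(4) a by (simp add: X_def algebra_simps)
      ultimately have "Q \<le> M * (2 * t) + M * (3 * X) + M * (4 * X)" by linarith
      also have "\<dots> \<le> M * (10 * (t + X))"
        unfolding distrib_left[symmetric] using X0 t_pos M1 by (intro mult_left_mono) auto
      finally show ?thesis unfolding r2 X_def by (simp add: algebra_simps)
    next
      case False
      \<comment> \<open>Near cut-off the term \<open>\<kappa> m S\<close> may be arbitrarily small
        and only \<open>r \<ge> t\<close> is used. In return \<open>t \<ge> 9/4 - 1/2\<close>, and
        \<open>p\<close> and \<open>S\<close> are bounded by constants, as \<open>l\<close> is close
        to 0.\<close>
      then have t1: "7/4 \<le> t" "m \<le> t + 1/2" using H(5) by (auto simp: \<kappa>_def)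
      have l: "l < 0" "-1 \<le> l" using h False by (auto simp: l_def \<kappa>_def)
      have c: "ode_c l 1 \<le> 8/5" by (rule ode_c_le[OF l(2,1)])
      have s: "1 \<le> ode_s l 1" "ode_s l 1 \<le> 8/5" using ode_neg_end[OF l(1)] c by auto
      have "p \<le> (8/5) * (8/5)" unfolding p_def using s c ode_neg_end[OF l(1)] by (intro mult_mono) auto
      moreover have "S \<le> (8/5) * (8/5)" unfolding S_def power2_eq_square using s by (intro mult_mono) auto
      ultimately have pS: "p \<le> 3" "S \<le> 3" by simp_all
      have "m * p \<le> (t + 1/2) * 3" using t1 pS(1) H(2) t_pos by (intro mult_mono) auto
      moreover have "m * t * S \<le> (t + 1/2) * t * 3"
        using t1 pS(2) S_nonneg t_pos m_nonneg by (intro mult_mono) auto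
      ultimately have "Q \<le> 6 * (t * t) + 8 * t + 3/2"
        using H(4) by (simp add: algebra_simps)
      moreover have tt: "(7/4) * t \<le> t * t" using t1 by (intro mult_right_mono) auto
      moreover have "(7/4) * (t * t) \<le> t * (t * t)" using t1 by (intro mult_right_mono) auto
      ultimately have "Q \<le> 10 * (t * (t * t))" using t1 by linarith
      also have "\<dots> = 10 * t\<^sup>2 * t" by (simp add: power2_eq_square)
      also have "\<dots> \<le> 10 * M * r"
        using Mt2 M1 t_pos mS \<kappa>0 by (intro mult_mono) (auto simp: r2 mult.assoc)
      finally show ?thesis .
    qed
  qed
  then show ?thesis unfolding M_def r_def .
qed

end

section \<open>Summation over the modes\<close>

context helmholtz
begin

text \<open>The sum of two norms is estimated by (x + y)^2 \<le> 2 (x^2 + y^2), hence the half. This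
  factor 2 turns the constants 6, 10 and 7 for single modes into sqrt 12, sqrt 20 and sqrt
  14.\<close>

lemma energy_bound:
  assumes "\<And>N. (\<Sum>n<N. (cmod (b n))\<^sup>2 * (2 * k\<^sup>2 + (fr n)\<^sup>2 + 2 * (fr n) ^ 4 * Is n)) \<le> C\<^sup>2 / 2" "0 \<le> C"
  shows "L2_norm area_measure (weak_grad u) + k * L2_norm area_measure u \<le> C"
proof -
  define x y where "x = L2_norm area_measure (weak_grad u)" and "y = k * L2_norm area_measure u"
  have "x\<^sup>2 + y\<^sup>2 \<le> C\<^sup>2 / 2"
    unfolding x_def y_def power_mult_distrib
    by (rule LIMSEQ_le_const2[OF energy_sums[unfolded sums_def]]) (use assms(1) in blast)
  moreover have "(x + y)\<^sup>2 \<le> 2 * (x\<^sup>2 + y\<^sup>2)"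
    using sum_squares_bound[of x y] by (simp add: power2_sum)
  ultimately have "(x + y)\<^sup>2 \<le> 2 * (C\<^sup>2 / 2)"
    by (meson order_trans mult_left_mono zero_le_numeral)
  then have "(x + y)\<^sup>2 \<le> C\<^sup>2" by simp
  then have "x + y \<le> C"
    using assms(2) by (rule power2_le_imp_le)
  then show ?thesis
    by (simp add: x_def y_def)
qed

text \<open>The bridge to \<open>mode_bounds\<close>: the factor of \<open>|b n|^2\<close> is its
  \<open>Q\<close>. Passing through \<open>x\<close> keeps the conclusion in the notation of this
  locale, while each caller interprets \<open>mode_bounds\<close> inside its own proof.\<close>

lemma mode_energy_le:
  fixes n
  assumes "\<And>x. mode_bounds k (fr n) \<Longrightarrow> x = mode_bounds.Q k (fr n) \<Longrightarrow> (cmod (b n))\<^sup>2 * x \<le> R"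
  shows "(cmod (b n))\<^sup>2 * (2 * k\<^sup>2 + (fr n)\<^sup>2 + 2 * (fr n) ^ 4 * Is n) \<le> R"
proof -
  interpret mode_bounds k "fr n"
    using k freq_eq_0_or_ge by unfold_locales
  show ?thesis
    by (rule assms) (unfold_locales, simp add: Q_def J_def Is_def l_def lam_def t_def m_def power_mult[symmetric])
qed

lemma gh_bessel: "(\<Sum>n<N. (cmod (gh n))\<^sup>2) \<le> (L2_norm side_measure (g Gamma2))\<^sup>2"
  unfolding gh_def by (rule bessel_modes[OF g2])

lemma mode_impedance:
  assumes "B Gamma2 = Impedance"
  shows "(cmod (b n))\<^sup>2 * (2 * k\<^sup>2 + (fr n)\<^sup>2 + 2 * (fr n) ^ 4 * Is n) \<le> 6 * (max k 1)\<^sup>2 * (cmod (gh n))\<^sup>2"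
proof (rule mode_energy_le)
  fix x assume "mode_bounds k (fr n)" and x: "x = mode_bounds.Q k (fr n)"
  then interpret mode_bounds k "fr n" by simp
  show "(cmod (b n))\<^sup>2 * x \<le> 6 * (max k 1)\<^sup>2 * (cmod (gh n))\<^sup>2"
    unfolding x end_value_norms(3)[OF assms]
    using mult_left_mono[OF bound_impedance, of "(cmod (b n))\<^sup>2"]
    by (simp add: S_def l_def t_def m_def lam_def algebra_simps)
qed

lemma mode_neumann:
  assumes "B Gamma2 = Neumann"
  shows "(cmod (b n))\<^sup>2 * (2 * k\<^sup>2 + (fr n)\<^sup>2 + 2 * (fr n) ^ 4 * Is n) \<le> 10 * (max (k\<^sup>2) 1)\<^sup>2 * (cmod (gh n))\<^sup>2"
proof (rule mode_energy_le)
  fix x assume "mode_bounds k (fr n)" and x: "x = mode_bounds.Q k (fr n)"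
  then interpret mode_bounds k "fr n" by simp
  have l: "lam n = l" by (simp add: l_def t_def m_def lam_def)
  show "(cmod (b n))\<^sup>2 * x \<le> 10 * (max (k\<^sup>2) 1)\<^sup>2 * (cmod (gh n))\<^sup>2"
    unfolding x end_value_norms(2)[OF assms] l
    using mult_left_mono[OF bound_neumann, of "(cmod (b n))\<^sup>2"]
    by (simp add: S_def t_def mult_ac)
qed

lemma mode_dirichlet:
  assumes "B Gamma2 = Dirichlet"
  shows "(cmod (b n))\<^sup>2 * (2 * k\<^sup>2 + (fr n)\<^sup>2 + 2 * (fr n) ^ 4 * Is n)
    \<le> 7 * ((max (k\<^sup>2) 1)\<^sup>2 + max k 1 * fr n) * (cmod (gh n))\<^sup>2"
proof (rule mode_energy_le)
  fix x assume "mode_bounds k (fr n)" and x: "x = mode_bounds.Q k (fr n)"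
  then interpret mode_bounds k "fr n" by simp
  have l: "lam n = l" by (simp add: l_def t_def m_def lam_def)
  show "(cmod (b n))\<^sup>2 * x \<le> 7 * ((max (k\<^sup>2) 1)\<^sup>2 + max k 1 * fr n) * (cmod (gh n))\<^sup>2"
    unfolding x end_value_norms(1)[OF assms] l
    using mult_left_mono[OF bound_dirichlet, of "(cmod (b n))\<^sup>2"]
    by (simp add: S_def mult_ac)
qed

lemma sum_modes_le:
  assumes "\<And>n. e n \<le> c * (cmod (gh n))\<^sup>2" "0 \<le> c"
  shows "(\<Sum>n<N. e n) \<le> c * (L2_norm side_measure (g Gamma2))\<^sup>2"
proof -
  have "(\<Sum>n<N. e n) \<le> c * (\<Sum>n<N. (cmod (gh n))\<^sup>2)"
    unfolding sum_distrib_left by (intro sum_mono assms)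
  also have "\<dots> \<le> c * (L2_norm side_measure (g Gamma2))\<^sup>2"
    by (intro mult_left_mono gh_bessel assms)
  finally show ?thesis .
qed

lemma estimate_impedance:
  assumes "B Gamma2 = Impedance"
  shows "L2_norm area_measure (weak_grad u) + k * L2_norm area_measure u
          \<le> sqrt 12 * max k 1 * L2_norm side_measure (g Gamma2)"
proof (rule energy_bound)
  show "(\<Sum>n<N. (cmod (b n))\<^sup>2 * (2 * k\<^sup>2 + (fr n)\<^sup>2 + 2 * (fr n) ^ 4 * Is n))
      \<le> (sqrt 12 * max k 1 * L2_norm side_measure (g Gamma2))\<^sup>2 / 2" for N
    using sum_modes_le[OF mode_impedance[OF assms], of N] by (simp add: power_mult_distrib)
qed (simp add: L2_norm_nonneg)

lemma estimate_neumann: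
  assumes "B Gamma2 = Neumann"
  shows "L2_norm area_measure (weak_grad u) + k * L2_norm area_measure u
          \<le> sqrt 20 * max (k\<^sup>2) 1 * L2_norm side_measure (g Gamma2)"
proof (rule energy_bound)
  show "(\<Sum>n<N. (cmod (b n))\<^sup>2 * (2 * k\<^sup>2 + (fr n)\<^sup>2 + 2 * (fr n) ^ 4 * Is n))
      \<le> (sqrt 20 * max (k\<^sup>2) 1 * L2_norm side_measure (g Gamma2))\<^sup>2 / 2" for N
    using sum_modes_le[OF mode_neumann[OF assms], of N] by (simp add: power_mult_distrib)
qed (simp add: L2_norm_nonneg)

text \<open>The two parts of the factor in \<open>mode_dirichlet\<close> are summed separately, one
  by Bessel's inequality and one by the series of the fractional norm. The cross term of (A G + P
  z)^2 is nonnegative, so the two squares fit under one square.\<close>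

lemma estimate_dirichlet:
  assumes D: "B Gamma2 = Dirichlet" and Z: "g Gamma2 \<in> Z_space (B Gamma1) (B Gamma3) (1/2)"
  shows "L2_norm area_measure (weak_grad u) + k * L2_norm area_measure u
          \<le> sqrt 14 * (max (k\<^sup>2) 1 * L2_norm side_measure (g Gamma2) +
               max (k powr (1/2)) 1 * Z_norm (B Gamma1) (B Gamma3) (1/2) (g Gamma2))"
proof (rule energy_bound)
  define q where "q n = (cmod (gh n))\<^sup>2 * fr n" for n
  define G where "G = L2_norm side_measure (g Gamma2)"
  define z where "z = Z_norm (B Gamma1) (B Gamma3) (1/2) (g Gamma2)"
  define A where "A = max (k\<^sup>2) 1"
  define P where "P = max (k powr (1/2)) 1"
  have P2: "P\<^sup>2 = max k 1"
  proof -
    have "P = sqrt (max k 1)"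
      using k by (auto simp: P_def powr_half_sqrt max_def)
    then show ?thesis using k by simp
  qed
  have pos: "0 \<le> A" "0 \<le> P" by (auto simp: A_def P_def)
  have G: "0 \<le> G" by (simp add: G_def L2_norm_nonneg)
  \<comment> \<open>For order 1/2 the exponent is 1 and the weight is the frequency itself, at
    frequency 0 as well.\<close>
  have qZ: "Z_term (B Gamma1) (B Gamma3) (1/2) (g Gamma2) = q"
    using freq_nonneg[of "B Gamma1" "B Gamma3"] by (auto simp: Z_term_def q_def gh_def fun_eq_iff)
  have sq: "summable q" using Z qZ by (simp add: Z_space_def)
  have q0: "0 \<le> q n" for n by (simp add: q_def freq_nonneg)
  have z2: "z\<^sup>2 = (\<Sum>n. q n)"
    unfolding z_def Z_norm_def qZ using suminf_nonneg[OF sq q0] by simp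
  have z: "0 \<le> z" unfolding z_def Z_norm_def qZ using suminf_nonneg[OF sq q0] by simp
  have "0 \<le> sqrt 14 * (A * G + P * z)" using pos G z by simp
  then show "0 \<le> sqrt 14 * (max (k\<^sup>2) 1 * L2_norm side_measure (g Gamma2) +
               max (k powr (1/2)) 1 * Z_norm (B Gamma1) (B Gamma3) (1/2) (g Gamma2))"
    by (simp add: A_def G_def P_def z_def)
  fix N
  have "(\<Sum>n<N. (cmod (b n))\<^sup>2 * (2 * k\<^sup>2 + (fr n)\<^sup>2 + 2 * (fr n) ^ 4 * Is n))
     \<le> (\<Sum>n<N. 7 * A\<^sup>2 * (cmod (gh n))\<^sup>2 + 7 * P\<^sup>2 * q n)"
    using mode_dirichlet[OF D] by (intro sum_mono) (simp add: A_def P2 q_def algebra_simps)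
  also have "\<dots> = 7 * A\<^sup>2 * (\<Sum>n<N. (cmod (gh n))\<^sup>2) + 7 * P\<^sup>2 * (\<Sum>n<N. q n)"
    by (simp add: sum.distrib sum_distrib_left)
  also have "\<dots> \<le> 7 * A\<^sup>2 * G\<^sup>2 + 7 * P\<^sup>2 * z\<^sup>2"
    unfolding z2 G_def
    by (intro add_mono mult_left_mono gh_bessel sum_le_suminf sq q0) auto
  also have "\<dots> \<le> 7 * (A * G + P * z)\<^sup>2"
  proof -
    have "0 \<le> (A * G) * (P * z)" using pos G z by simp
    then show ?thesis by (simp add: power2_sum power_mult_distrib)
  qed
  also have "\<dots> = (sqrt 14 * (A * G + P * z))\<^sup>2 / 2"
    by (simp add: power_mult_distrib)
  finally show "(\<Sum>n<N. (cmod (b n))\<^sup>2 * (2 * k\<^sup>2 + (fr n)\<^sup>2 + 2 * (fr n) ^ 4 * Is n))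
      \<le> (sqrt 14 * (max (k\<^sup>2) 1 * L2_norm side_measure (g Gamma2) +
               max (k powr (1/2)) 1 * Z_norm (B Gamma1) (B Gamma3) (1/2) (g Gamma2)))\<^sup>2 / 2"
    by (simp add: A_def G_def P_def z_def)
qed

end

theorem theorem2p4:
  fixes k :: real
    and B :: "side \<Rightarrow> bc"
    and g :: "side \<Rightarrow> real \<Rightarrow> complex"
    and u :: "real \<times> real \<Rightarrow> complex"
  assumes "k > 0"
    and "B Gamma1 \<in> {Dirichlet, Neumann}"
    and "B Gamma3 \<in> {Dirichlet, Neumann}"
    and "B Gamma4 = Impedance"
    and "g Gamma1 = (\<lambda>_. 0)"
    and "g Gamma3 = (\<lambda>_. 0)"
    and "g Gamma4 = (\<lambda>_. 0)"
    and "g Gamma2 \<in> L2 side_measure"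
    and "weak_solution k B g u"
  shows
    "(B Gamma2 = Impedance \<longrightarrow>
        L2_norm area_measure (weak_grad u) + k * L2_norm area_measure u
          \<le> sqrt 12 * max k 1 * L2_norm side_measure (g Gamma2)) \<and>
     (B Gamma2 = Neumann \<longrightarrow>
        L2_norm area_measure (weak_grad u) + k * L2_norm area_measure u
          \<le> sqrt 20 * max (k\<^sup>2) 1 * L2_norm side_measure (g Gamma2)) \<and>
     (B Gamma2 = Dirichlet \<and> g Gamma2 \<in> Z_space (B Gamma1) (B Gamma3) (1/2) \<longrightarrow>
        L2_norm area_measure (weak_grad u) + k * L2_norm area_measure u
          \<le> sqrt 14 * (max (k\<^sup>2) 1 * L2_norm side_measure (g Gamma2) +
               max (k powr (1/2)) 1 * Z_norm (B Gamma1) (B Gamma3) (1/2) (g Gamma2)))"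
proof -
  have "\<exists>\<gamma>. helmholtz k B g u \<gamma>"
    using assms(9) unfolding weak_solution_def
  proof (elim conjE exE, goal_cases)
    case (1 \<gamma>)
    show ?case
      by (intro exI[of _ \<gamma>] helmholtz.intro assms(1-8) 1(1) 1(2)[rule_format] 1(3)[rule_format] 1(4)[rule_format]; assumption)
  qed
  then obtain \<gamma> where "helmholtz k B g u \<gamma>" by blast
  then interpret helmholtz k B g u \<gamma> .
  show ?thesis
    by (intro conjI impI estimate_impedance estimate_neumann estimate_dirichlet) simp_all
qed

end
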